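(* Let $d=1$ and let $\sigma$ be a real number with $2.4537956056<\sigma<6.1288520139$. Let $R:\mathbb{R}\to\mathbb{R}$ be the soliton of the nonlinear Schrödinger equation $i\psi_t+\psi_{xx}+|\psi|^{2\sigma}\psi=0$ with frequency $\omega=1$, i.e. the positive, even solution, in $L^2$ and vanishing at infinity, of $-R+R''+R^{2\sigma+1}=0$. Let $$L_+=-\frac{d^2}{dx^2}+1-(2\sigma+1)R^{2\sigma},\qquad L_-=-\frac{d^2}{dx^2}+1-R^{2\sigma},\qquad JL=\begin{pmatrix}0&L_-\\-L_+&0\end{pmatrix}.$$ Then $JL$, acting on $L^2(\mathbb{R};\mathbb{C})\times L^2(\mathbb{R};\mathbb{C})$, has no nonzero purely imaginary eigenvalues (neither in the spectral gap nor embedded in the essential spectrum).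
   Context: $JL$ is the linearization of the equation about the solitary wave $e^{it}R$: writing $\psi=e^{it}(R+u+iv)$, the linear part of the evolution of $(u,v)^T$ is $\partial_t(u,v)^T=JL(u,v)^T$, with $J=\begin{pmatrix}0&1\\-1&0\end{pmatrix}$ and $L=\mathrm{diag}(L_+,L_-)$. Its domain is $H^2\times H^2$. The essential spectrum of $JL$ is $i(-\infty,-1]\cup i[1,\infty)$. The value $0$ is always an eigenvalue of $JL$. *)

theory Defs
  imports "HOL-Analysis.Analysis"
begin

text \<open>
  Square-integrable functions are represented by Borel functions rather than by equivalence
  classes; equality in \<open>L\<^sup>2\<close> is therefore equality almost everywhere.
\<close>

definition L2 :: "(real \<Rightarrow> 'a::real_normed_vector) set" where
  "L2 = {f \<in> borel_measurable lborel. integrable lborel (\<lambda>x. (norm (f x))\<^sup>2)}"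

definition test_functions :: "(real \<Rightarrow> real) set" where
  "test_functions = {\<phi>. (\<forall>n x. (deriv ^^ n) \<phi> differentiable at x) \<and>
                        compact (closure {x. \<phi> x \<noteq> 0})}"

text \<open>
  Real test functions suffice for complex \<open>f\<close> and \<open>g\<close>, by linearity. The notion is only used for
  \<open>f\<close> and \<open>g\<close> in \<open>L2\<close>, where both integrals exist.
\<close>

definition has_weak_deriv :: "(real \<Rightarrow> complex) \<Rightarrow> (real \<Rightarrow> complex) \<Rightarrow> bool" where
  "has_weak_deriv f g \<longleftrightarrow>
     (\<forall>\<phi>\<in>test_functions.
        (\<integral>x. deriv \<phi> x *\<^sub>R f x \<partial>lborel) = - (\<integral>x. \<phi> x *\<^sub>R g x \<partial>lborel))"

definition H2 :: "(real \<Rightarrow> complex) set" where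
  "H2 = {f \<in> L2. \<exists>g\<in>L2. \<exists>h\<in>L2. has_weak_deriv f g \<and> has_weak_deriv g h}"

text \<open>
  A weak derivative is unique only up to null sets, and one representative is chosen. Equations
  involving it are to be read almost everywhere; they do not depend on the choice.
\<close>

definition weak_deriv :: "(real \<Rightarrow> complex) \<Rightarrow> real \<Rightarrow> complex" where
  "weak_deriv f = (SOME g. g \<in> L2 \<and> has_weak_deriv f g)"

text \<open>
  As \<open>R\<close> is positive, \<open>powr\<close> is the genuine real power.
\<close>

definition soliton :: "real \<Rightarrow> (real \<Rightarrow> real) \<Rightarrow> bool" where
  "soliton \<sigma> R \<longleftrightarrow>
     (\<forall>x. R x > 0) \<and> (\<forall>x. R (- x) = R x) \<and> R \<in> L2 \<and> (R \<longlongrightarrow> 0) at_infinity \<and>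
     (\<forall>x. R differentiable at x \<and> deriv R differentiable at x \<and>
          - R x + deriv (deriv R) x + R x powr (2 * \<sigma> + 1) = 0)"

definition L_plus :: "real \<Rightarrow> (real \<Rightarrow> real) \<Rightarrow> (real \<Rightarrow> complex) \<Rightarrow> real \<Rightarrow> complex" where
  "L_plus \<sigma> R u = (\<lambda>x. - weak_deriv (weak_deriv u) x + u x
                       - of_real ((2 * \<sigma> + 1) * R x powr (2 * \<sigma>)) * u x)"

definition L_minus :: "real \<Rightarrow> (real \<Rightarrow> real) \<Rightarrow> (real \<Rightarrow> complex) \<Rightarrow> real \<Rightarrow> complex" where
  "L_minus \<sigma> R v = (\<lambda>x. - weak_deriv (weak_deriv v) x + v x
                        - of_real (R x powr (2 * \<sigma>)) * v x)"

definition JL :: "real \<Rightarrow> (real \<Rightarrow> real) \<Rightarrow> (real \<Rightarrow> complex) \<times> (real \<Rightarrow> complex)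
    \<Rightarrow> (real \<Rightarrow> complex) \<times> (real \<Rightarrow> complex)" where
  "JL \<sigma> R = (\<lambda>(u, v). (L_minus \<sigma> R v, \<lambda>x. - L_plus \<sigma> R u x))"

definition is_eigenvalue ::
  "((real \<Rightarrow> complex) \<times> (real \<Rightarrow> complex)) set
   \<Rightarrow> ((real \<Rightarrow> complex) \<times> (real \<Rightarrow> complex) \<Rightarrow> (real \<Rightarrow> complex) \<times> (real \<Rightarrow> complex))
   \<Rightarrow> complex \<Rightarrow> bool" where
  "is_eigenvalue D T z \<longleftrightarrow>
     (\<exists>w\<in>D. \<not> (AE x in lborel. fst w x = 0 \<and> snd w x = 0) \<and>
            (AE x in lborel. fst (T w) x = z * fst w x \<and> snd (T w) x = z * snd w x))"

end

theory Submission
  imports Defs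
begin

text \<open>
  The soliton is \<open>R\<^sup>2\<^sup>\<sigma> = (\<sigma> + 1) sech\<^sup>2 (\<sigma> x)\<close>, so with \<open>a = 1 / \<sigma>\<close> and \<open>y = \<sigma> x\<close> an eigenfunction for
  an imaginary eigenvalue gives real solutions of \<open>A\<^sub>- v = \<mu> u\<close>, \<open>A\<^sub>+ u = \<mu> v\<close> with \<open>\<mu> > 0\<close>,
  \<open>A\<^sub>- = - d\<^sup>2 + a\<^sup>2 - a (a + 1) sech\<^sup>2\<close> and \<open>A\<^sub>+ = - d\<^sup>2 + a\<^sup>2 - (a + 1) (a + 2) sech\<^sup>2\<close>;
  they may be taken even or odd. Supercriticality means \<open>a < 1 / 2\<close>.

  In the gap, \<open>\<mu> \<le> a\<^sup>2\<close>, the argument is one of counting directions. If \<open>m\<close> is such that the form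
  \<open>\<langle>(A\<^sub>- A\<^sub>+ A\<^sub>- - \<mu>\<^sup>2 A\<^sub>-) m, m\<rangle>\<close> is negative, then this form is nonpositive on the span of \<open>v\<close> and
  \<open>m\<close>, whereas a lower bound for \<open>A\<^sub>+\<close> of codimension one makes it positive somewhere on that plane.
  With \<open>Q = sech\<^sup>a\<close> one takes \<open>m = y\<^sup>2 Q\<close> for even and \<open>m = y Q\<close> for odd solutions (the generalized
  kernel); the former is where \<open>a < 1 / 2\<close> enters.

  For \<open>\<mu> > a\<^sup>2\<close> the decaying solution at \<open>+ \<infinity>\<close> is unique up to a factor, and it is a Frobenius series in
  \<open>sech\<^sup>2\<close> whose coefficient vectors satisfy a two-term recurrence with invertible matrices \<open>1 - O(1 / n)\<close>.
  So they decay no faster than a fixed power of \<open>n\<close>; a series of this kind is singular at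
  \<open>sech\<^sup>2 0 = 1\<close>, hence at the origin, and does not extend to
  a smooth even or odd function.
\<close>

section \<open>Integration on the whole line\<close>

text \<open>The essential spectra of both operators begin at \<open>a\<^sup>2\<close>, and this
  constant decides where the two arguments meet. Counting directions multiplies a lower bound
  \<open>a\<^sup>2\<close> for \<open>A\<^sub>+\<close> by a lower bound \<open>a\<^sup>2\<close>
  from the factorization of \<open>A\<^sub>-\<close>, and the product dominates
  \<open>\<mu>\<^sup>2\<close> exactly up to \<open>\<mu> = a\<^sup>2\<close>. Above it
  \<open>v + u\<close> oscillates at infinity; decay has to remove the oscillation, and this leaves
  a single solution.

  The Frobenius argument rests on \<open>tanh = sqrt (1 - sech\<^sup>2)\<close>. On the half-line a
  solution generically has parts of both parities at the origin, and the part of the wrong parity is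
  a square root branch point at \<open>sech\<^sup>2 = 1\<close>; the coefficients of such a root
  decay like \<open>n\<close> to the power -3/2. The obstacle is cancellation, since slow decay of
  coefficients alone does not exclude boundedness of the series. It is overcome because the
  recurrence matrices eventually have positive entries: from some index on each component keeps its
  sign, and for such series boundedness at the boundary already gives summability.\<close>

lemma continuous_on_of_DERIV:
  fixes f :: "real \<Rightarrow> real"
  assumes "\<And>x. x \<in> A \<Longrightarrow> (f has_real_derivative f' x) (at x)"
  shows "continuous_on A f"
  using assms by (auto intro!: continuous_at_imp_continuous_on DERIV_isCont)

lemma even_deriv_0:
  fixes h :: "real \<Rightarrow> real"
  assumes "(h has_real_derivative D) (at 0)" "\<And>y. h (- y) = h y"
  shows "D = 0"
proof -
  have "(h has_real_derivative D) (at (- 0))" using assms(1) by simp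
  from DERIV_chain2[OF this DERIV_minus[OF DERIV_ident]]
  have "((\<lambda>y. h (- y)) has_real_derivative - D) (at 0)" by simp
  moreover have "(\<lambda>y. h (- y)) = h" using assms(2) by (rule ext)
  ultimately have "(h has_real_derivative - D) (at 0)" by simp
  from DERIV_unique[OF assms(1) this] show ?thesis by simp
qed

text \<open>The antiderivative vanishing at minus infinity has the whole-line integral as its limit
  at plus infinity, so boundary terms become limits. Its explicit form as a lower integral is kept
  because, for an integrand of mean zero and compact support, it is itself a compactly supported
  function to test with.\<close>

lemma lower_integral_antiderivative:
  fixes g :: "real \<Rightarrow> real"
  assumes cont: "continuous_on UNIV g" and int: "integrable lborel g"
  defines "G \<equiv> (\<lambda>x. LINT t:{..x}|lborel. g t)"
  shows "\<And>x. (G has_real_derivative g x) (at x)" "(G \<longlongrightarrow> 0) at_bot"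
    "(G \<longlongrightarrow> (LBINT x. g x)) at_top"
proof -
  have si: "set_integrable lborel A g" if "A \<in> sets borel" for A
    unfolding set_integrable_def by (rule integrable_mult_indicator) (use int that in auto)
  have eq: "G y = G c + integral {c..y} g" if "c \<le> y" for c y
  proof -
    have "{..y} = {..c} \<union> {c<..y}" using that by auto
    then have "G y = G c + (LINT t:{c<..y}|lborel. g t)"
      unfolding G_def by (subst set_integral_Un[symmetric]) (auto simp: si)
    also have "(LINT t:{c<..y}|lborel. g t) = (LINT t:{c..y}|lborel. g t)"
      using that by (simp add: interval_integral_eq_integral[symmetric]
        interval_integral_Ioc[symmetric] interval_integral_Icc[symmetric])
    also have "\<dots> = integral {c..y} g"
      by (rule set_borel_integral_eq_integral) (simp add: si)
    finally show ?thesis .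
  qed
  show "(G has_real_derivative g x) (at x)" for x
  proof -
    have "((\<lambda>u. integral {x-1..u} g) has_real_derivative g x) (at x within {x-1..x+1})"
      by (rule integral_has_real_derivative) (auto intro: continuous_on_subset[OF cont])
    then have "((\<lambda>u. integral {x-1..u} g) has_real_derivative g x) (at x)"
      by (simp add: at_within_Icc_at)
    then have "((\<lambda>u. G (x-1) + integral {x-1..u} g) has_real_derivative g x) (at x)"
      by (auto intro!: derivative_eq_intros)
    then show ?thesis
    proof (rule has_field_derivative_transform_within_open)
      show "open {x-1<..<x+1}" "x \<in> {x-1<..<x+1}" by auto
      fix y assume "y \<in> {x-1<..<x+1}"
      then show "G (x-1) + integral {x-1..y} g = G y" using eq[of "x-1" y] by simp
    qed
  qed
  show "(G \<longlongrightarrow> (LBINT x. g x)) at_top"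
  proof -
    have *: "((\<lambda>y. LINT t:{0..y}|lborel. g t) \<longlongrightarrow> (LINT t:{0..}|lborel. g t)) at_top"
      by (rule tendsto_set_lebesgue_integral_at_top) (auto simp: si)
    have "((\<lambda>y. G 0 + (LINT t:{0..y}|lborel. g t)) \<longlongrightarrow> G 0 + (LINT t:{0..}|lborel. g t)) at_top"
      by (intro tendsto_intros *)
    moreover have "G 0 + (LINT t:{0..}|lborel. g t) = (LBINT x. g x)"
    proof -
      have "(LINT t:{0<..}|lborel. g t) = (LINT t:{0..}|lborel. g t)"
        unfolding set_lebesgue_integral_def
        by (rule integral_cong_AE) (use int in \<open>auto simp: indicator_def intro!: AE_I[where N="{0}"]\<close>)
      moreover have "(LINT t:{..0}\<union>{0<..}|lborel. g t) = G 0 + (LINT t:{0<..}|lborel. g t)"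
        unfolding G_def by (rule set_integral_Un) (auto simp: si)
      moreover have "{..0}\<union>{0<..} = (UNIV::real set)" by auto
      ultimately show ?thesis by (simp add: set_lebesgue_integral_def)
    qed
    moreover have "\<forall>\<^sub>F y in at_top. G 0 + (LINT t:{0..y}|lborel. g t) = G y"
      using eventually_ge_at_top[of 0]
    proof eventually_elim
      case (elim y)
      have "(LINT t:{0..y}|lborel. g t) = integral {0..y} g"
        by (rule set_borel_integral_eq_integral) (simp add: si)
      then show ?case using eq[OF elim] by simp
    qed
    ultimately show ?thesis by (simp add: tendsto_cong)
  qed
  show "(G \<longlongrightarrow> 0) at_bot"
  proof -
    have *: "((\<lambda>y. LINT t:{y..0}|lborel. g t) \<longlongrightarrow> (LINT t:{..0}|lborel. g t)) at_bot"
      by (rule tendsto_set_lebesgue_integral_at_bot) (auto simp: si)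
    have "((\<lambda>y. G 0 - (LINT t:{y..0}|lborel. g t)) \<longlongrightarrow> G 0 - (LINT t:{..0}|lborel. g t)) at_bot"
      by (intro tendsto_intros *)
    moreover have "\<forall>\<^sub>F y in at_bot. G 0 - (LINT t:{y..0}|lborel. g t) = G y"
      using eventually_le_at_bot[of 0]
    proof eventually_elim
      case (elim y)
      have "(LINT t:{y..0}|lborel. g t) = integral {y..0} g"
        by (rule set_borel_integral_eq_integral) (simp add: si)
      then show ?case using eq[OF elim] by simp
    qed
    ultimately show ?thesis by (simp add: G_def tendsto_cong)
  qed
qed

lemma whole_line_antiderivative:
  fixes g :: "real \<Rightarrow> real"
  assumes "continuous_on UNIV g" "integrable lborel g"
  obtains G where "\<And>x. (G has_real_derivative g x) (at x)" "(G \<longlongrightarrow> 0) at_bot"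
    "(G \<longlongrightarrow> (LBINT x. g x)) at_top"
  using lower_integral_antiderivative[OF assms] that by blast

lemma integral_derivative_eq_0:
  fixes F f :: "real \<Rightarrow> real"
  assumes F: "\<And>x. (F has_real_derivative f x) (at x)" and cont: "continuous_on UNIV f"
    and int: "integrable lborel f"
    and top: "(F \<longlongrightarrow> 0) at_top" and bot: "(F \<longlongrightarrow> 0) at_bot"
  shows "(LBINT x. f x) = 0"
proof -
  obtain G where G: "\<And>x. (G has_real_derivative f x) (at x)" "(G \<longlongrightarrow> 0) at_bot"
    "(G \<longlongrightarrow> (LBINT x. f x)) at_top"
    using whole_line_antiderivative[OF cont int] by blast
  have "((\<lambda>x. F x - G x) has_real_derivative 0) (at x)" for x
    using DERIV_diff[OF F G(1)] by simp
  then have "F x - G x = F 0 - G 0" for x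
    using DERIV_isconst_all[of "\<lambda>x. F x - G x" x 0] by blast
  then obtain c where c: "F x - G x = c" for x by blast
  have Gc: "G = (\<lambda>x. F x - c)" using c by (auto simp: fun_eq_iff algebra_simps)
  have "(G \<longlongrightarrow> 0 - c) at_bot" "(G \<longlongrightarrow> 0 - c) at_top"
    unfolding Gc by (intro tendsto_intros top bot)+
  then show ?thesis
    using G(2,3) tendsto_unique[of "at_bot::real filter"] tendsto_unique[of "at_top::real filter"]
    by (metis trivial_limit_at_bot_linorder trivial_limit_at_top_linorder)
qed

text \<open>A nonzero limit would bound \<open>\<bar>f\<bar>\<close> below by a positive constant on
  a half-line; this contains intervals of every length and so has infinite measure.\<close>

lemma tendsto_0_of_integrable:
  fixes f :: "real \<Rightarrow> real"
  assumes int: "integrable lborel f"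
  shows "(f \<longlongrightarrow> L) at_top \<Longrightarrow> L = 0" "(f \<longlongrightarrow> L) at_bot \<Longrightarrow> L = 0"
proof -
  have key: False if L: "L \<noteq> 0" and ev: "\<And>x. x \<in> A \<Longrightarrow> \<bar>L\<bar>/2 \<le> \<bar>f x\<bar>"
    and A: "A \<in> sets borel" "\<And>n. \<exists>c. {c..c + real n} \<subseteq> A" for A
  proof -
    have "integrable lborel (\<lambda>x. indicator A x *\<^sub>R (\<bar>L\<bar>/2))"
    proof (rule Bochner_Integration.integrable_bound[OF int])
      show "AE x in lborel. norm (indicator A x *\<^sub>R (\<bar>L\<bar> / 2)) \<le> norm (f x)"
        using ev by (auto simp: indicator_def)
    qed (use A in auto)
    then have "integrable lborel (\<lambda>x. indicator A x *\<^sub>R (\<bar>L\<bar>/2) * (2/\<bar>L\<bar>))" by (rule integrable_mult_left)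
    then have "integrable lborel (indicator A :: real \<Rightarrow> real)"
      using L by (simp add: field_simps)
    then have fin: "emeasure lborel A < \<infinity>" using A by (simp add: integrable_indicator_iff)
    then obtain n where n: "emeasure lborel A < of_nat n"
      by (metis ennreal_Ex_less_of_nat infinity_ennreal_def)
    obtain c where "{c..c + real n} \<subseteq> A" using A(2) by blast
    then have "emeasure lborel {c..c + real n} \<le> emeasure lborel A"
      by (rule emeasure_mono) (use A in auto)
    then show False using n by (simp add: ennreal_of_nat_eq_real_of_nat)
  qed
  show "L = 0" if lim: "(f \<longlongrightarrow> L) at_top"
  proof (rule ccontr)
    assume L: "L \<noteq> 0"
    have "((\<lambda>x. \<bar>f x\<bar>) \<longlongrightarrow> \<bar>L\<bar>) at_top" by (intro tendsto_intros lim)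
    then have "\<forall>\<^sub>F x in at_top. \<bar>f x\<bar> > \<bar>L\<bar>/2" by (rule order_tendstoD) (use L in auto)
    then obtain N where "\<And>x. x \<ge> N \<Longrightarrow> \<bar>f x\<bar> > \<bar>L\<bar>/2" by (auto simp: eventually_at_top_linorder)
    then show False using L
      by (intro key[of "{N..}"]) (auto intro!: exI[of _ N] less_imp_le)
  qed
  show "L = 0" if lim: "(f \<longlongrightarrow> L) at_bot"
  proof (rule ccontr)
    assume L: "L \<noteq> 0"
    have "((\<lambda>x. \<bar>f x\<bar>) \<longlongrightarrow> \<bar>L\<bar>) at_bot" by (intro tendsto_intros lim)
    then have "\<forall>\<^sub>F x in at_bot. \<bar>f x\<bar> > \<bar>L\<bar>/2" by (rule order_tendstoD) (use L in auto)
    then obtain N where "\<And>x. x \<le> N \<Longrightarrow> \<bar>f x\<bar> > \<bar>L\<bar>/2" by (auto simp: eventually_at_bot_linorder)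
    moreover have "\<exists>c. {c..c + real n} \<subseteq> {..N}" for n
      by (rule exI[of _ "N - real n"]) auto
    ultimately show False using L
      by (intro key[of "{..N}"]) (auto intro!: less_imp_le)
  qed
qed

lemma integrable_mult_of_squares:
  fixes f g :: "real \<Rightarrow> real"
  assumes [measurable]: "f \<in> borel_measurable lborel" "g \<in> borel_measurable lborel"
    and "integrable lborel (\<lambda>x. (f x)\<^sup>2)" "integrable lborel (\<lambda>x. (g x)\<^sup>2)"
  shows "integrable lborel (\<lambda>x. f x * g x)"
proof (rule Bochner_Integration.integrable_bound)
  show "integrable lborel (\<lambda>x. (f x)\<^sup>2 + (g x)\<^sup>2)" using assms by auto
  have "\<bar>f x * g x\<bar> \<le> (f x)\<^sup>2 + (g x)\<^sup>2" for x
  proof -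
    have "2 * \<bar>f x * g x\<bar> \<le> (f x)\<^sup>2 + (g x)\<^sup>2"
      using sum_squares_bound[of "\<bar>f x\<bar>" "\<bar>g x\<bar>"] by (simp add: abs_mult mult.assoc)
    then show ?thesis using abs_ge_zero[of "f x * g x"] by linarith
  qed
  then show "AE x in lborel. norm (f x * g x) \<le> norm ((f x)\<^sup>2 + (g x)\<^sup>2)"
    by simp
qed measurable

section \<open>Twice differentiable functions with square-integrable derivatives\<close>

text \<open>The classical counterpart of \<open>H2\<close>: eigenfunctions turn out to have a
  continuous second derivative. The derivatives are arguments, so that forms and equations can name
  them without \<open>deriv\<close>.\<close>

definition sobolev2 :: "(real \<Rightarrow> real) \<Rightarrow> (real \<Rightarrow> real) \<Rightarrow> (real \<Rightarrow> real) \<Rightarrow> bool" where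
  "sobolev2 f f' f'' \<longleftrightarrow>
     (\<forall>x. (f has_real_derivative f' x) (at x)) \<and> (\<forall>x. (f' has_real_derivative f'' x) (at x)) \<and>
     continuous_on UNIV f'' \<and> integrable lborel (\<lambda>x. (f x)\<^sup>2) \<and>
     integrable lborel (\<lambda>x. (f' x)\<^sup>2) \<and> integrable lborel (\<lambda>x. (f'' x)\<^sup>2)"

lemma sobolev2_cont:
  assumes "sobolev2 f f' f''"
  shows "continuous_on UNIV f" "continuous_on UNIV f'" "continuous_on UNIV f''"
proof -
  show "continuous_on UNIV f" "continuous_on UNIV f'"
    by (rule continuous_on_of_DERIV; use assms in \<open>auto simp: sobolev2_def\<close>)+
  show "continuous_on UNIV f''" using assms by (auto simp: sobolev2_def)
qed

lemma continuous_square_integrable_add: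
  fixes f g :: "real \<Rightarrow> real"
  assumes "continuous_on UNIV f" "continuous_on UNIV g"
    and "integrable lborel (\<lambda>x. (f x)\<^sup>2)" "integrable lborel (\<lambda>x. (g x)\<^sup>2)"
  shows "integrable lborel (\<lambda>x. (c * f x + d * g x)\<^sup>2)"
proof -
  have m: "f \<in> borel_measurable lborel" "g \<in> borel_measurable lborel"
    using assms by (auto intro: borel_measurable_continuous_onI)
  have "integrable lborel (\<lambda>x. c^2 * (f x)\<^sup>2 + 2*c*d * (f x * g x) + d^2 * (g x)\<^sup>2)"
    by (intro Bochner_Integration.integrable_add integrable_mult_right assms integrable_mult_of_squares m)
  then show ?thesis by (simp add: power2_eq_square algebra_simps)
qed

lemma sobolev2_lincomb:
  assumes "sobolev2 f f' f''" "sobolev2 g g' g''"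
  shows "sobolev2 (\<lambda>x. c * f x + d * g x) (\<lambda>x. c * f' x + d * g' x) (\<lambda>x. c * f'' x + d * g'' x)"
proof -
  note c = sobolev2_cont[OF assms(1)] sobolev2_cont[OF assms(2)]
  have d: "(f has_real_derivative f' x) (at x)" "(f' has_real_derivative f'' x) (at x)"
    "(g has_real_derivative g' x) (at x)" "(g' has_real_derivative g'' x) (at x)" for x
    using assms by (auto simp: sobolev2_def)
  have i: "integrable lborel (\<lambda>x. (c * f x + d * g x)\<^sup>2)"
    "integrable lborel (\<lambda>x. (c * f' x + d * g' x)\<^sup>2)"
    "integrable lborel (\<lambda>x. (c * f'' x + d * g'' x)\<^sup>2)"
    by (rule continuous_square_integrable_add; use assms c in \<open>auto simp: sobolev2_def\<close>)+
  show ?thesis unfolding sobolev2_def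
    by (intro conjI allI i DERIV_add DERIV_cmult d continuous_intros c)
qed

text \<open>The derivative \<open>2 f f'\<close> of \<open>f\<^sup>2\<close> is integrable, so
  \<open>f\<^sup>2\<close> has limits at both ends, and a limit of an integrable function is
  0.\<close>

lemma tendsto_0_of_square_integrable_deriv:
  fixes f f' :: "real \<Rightarrow> real"
  assumes d: "\<And>x. (f has_real_derivative f' x) (at x)" and c: "continuous_on UNIV f'"
    and i: "integrable lborel (\<lambda>x. (f x)\<^sup>2)" "integrable lborel (\<lambda>x. (f' x)\<^sup>2)"
  shows "(f \<longlongrightarrow> 0) at_top" "(f \<longlongrightarrow> 0) at_bot"
proof -
  have cf: "continuous_on UNIV f"
    by (rule DERIV_continuous_on) (rule has_field_derivative_at_within[OF d])
  have cc: "continuous_on UNIV (\<lambda>x. 2 * (f x * f' x))" by (intro continuous_intros cf c)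
  have ii: "integrable lborel (\<lambda>x. 2 * (f x * f' x))"
    by (intro integrable_mult_right integrable_mult_of_squares i)
      (auto intro!: borel_measurable_continuous_onI cf c)
  obtain G where G: "\<And>x. (G has_real_derivative 2 * (f x * f' x)) (at x)" "(G \<longlongrightarrow> 0) at_bot"
    "(G \<longlongrightarrow> (LBINT x. 2 * (f x * f' x))) at_top"
    using whole_line_antiderivative[OF cc ii] by blast
  have "((\<lambda>x. (f x)\<^sup>2 - G x) has_real_derivative 0) (at x)" for x
    by (auto intro!: derivative_eq_intros d G(1))
  then have "(f x)\<^sup>2 - G x = (f 0)\<^sup>2 - G 0" for x
    using DERIV_isconst_all[of "\<lambda>x. (f x)\<^sup>2 - G x" x 0] by blast
  then obtain k where k: "(f x)\<^sup>2 - G x = k" for x by blast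
  have Gc: "(\<lambda>x. (f x)\<^sup>2) = (\<lambda>x. G x + k)" using k by (auto simp: fun_eq_iff algebra_simps)
  have sq: "(f \<longlongrightarrow> 0) F" if "((\<lambda>x. (f x)\<^sup>2) \<longlongrightarrow> 0) F" for F
    using tendsto_real_sqrt[OF that] by (simp add: tendsto_rabs_zero_iff)
  have lb: "((\<lambda>x. (f x)\<^sup>2) \<longlongrightarrow> 0 + k) at_bot"
    unfolding Gc by (intro tendsto_intros G)
  then show "(f \<longlongrightarrow> 0) at_bot"
    using tendsto_0_of_integrable(2)[OF i(1) lb] by (intro sq) simp
  have lt: "((\<lambda>x. (f x)\<^sup>2) \<longlongrightarrow> (LBINT x. 2 * (f x * f' x)) + k) at_top"
    unfolding Gc by (intro tendsto_intros G)
  then show "(f \<longlongrightarrow> 0) at_top"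
    using tendsto_0_of_integrable(1)[OF i(1) lt] by (intro sq) simp
qed

lemma sobolev2_tendsto:
  assumes "sobolev2 f f' f''"
  shows "(f \<longlongrightarrow> 0) at_top" "(f \<longlongrightarrow> 0) at_bot" "(f' \<longlongrightarrow> 0) at_top" "(f' \<longlongrightarrow> 0) at_bot"
proof -
  have d: "(f has_real_derivative f' x) (at x)" "(f' has_real_derivative f'' x) (at x)" for x
    using assms by (auto simp: sobolev2_def)
  have i: "integrable lborel (\<lambda>x. (f x)\<^sup>2)" "integrable lborel (\<lambda>x. (f' x)\<^sup>2)"
    "integrable lborel (\<lambda>x. (f'' x)\<^sup>2)"
    using assms by (auto simp: sobolev2_def)
  note c = sobolev2_cont[OF assms]
  show "(f \<longlongrightarrow> 0) at_top" "(f \<longlongrightarrow> 0) at_bot"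
    by (rule tendsto_0_of_square_integrable_deriv[OF d(1) c(2) i(1,2)])+
  show "(f' \<longlongrightarrow> 0) at_top" "(f' \<longlongrightarrow> 0) at_bot"
    by (rule tendsto_0_of_square_integrable_deriv[OF d(2) c(3) i(2,3)])+
qed

lemma sobolev2_integrable_mult:
  assumes "sobolev2 f f' f''" "sobolev2 g g' g''"
  shows "integrable lborel (\<lambda>x. f x * g x)" "integrable lborel (\<lambda>x. f x * g' x)"
    "integrable lborel (\<lambda>x. f x * g'' x)" "integrable lborel (\<lambda>x. f' x * g' x)"
proof -
  note c = sobolev2_cont[OF assms(1)] sobolev2_cont[OF assms(2)]
  have m: "h \<in> borel_measurable lborel" if "continuous_on UNIV h" for h :: "real \<Rightarrow> real"
    using borel_measurable_continuous_onI[OF that] by simp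
  show "integrable lborel (\<lambda>x. f x * g x)" "integrable lborel (\<lambda>x. f x * g' x)"
    "integrable lborel (\<lambda>x. f x * g'' x)" "integrable lborel (\<lambda>x. f' x * g' x)"
    by (rule integrable_mult_of_squares; use assms c m in \<open>auto simp: sobolev2_def\<close>)+
qed

lemma sobolev2_by_parts:
  assumes f: "sobolev2 f f' f''" and g: "sobolev2 g g' g''"
  shows "(LBINT x. f x * g'' x) = - (LBINT x. f' x * g' x)"
proof -
  note I = sobolev2_integrable_mult[OF f g]
  note T = sobolev2_tendsto[OF f] sobolev2_tendsto[OF g]
  note c = sobolev2_cont[OF f] sobolev2_cont[OF g]
  have d: "(f has_real_derivative f' x) (at x)" "(g' has_real_derivative g'' x) (at x)" for x
    using f g by (auto simp: sobolev2_def)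
  have "(LBINT x. f x * g'' x + f' x * g' x) = 0"
  proof (rule integral_derivative_eq_0[where F="\<lambda>x. f x * g' x"])
    show "((\<lambda>x. f x * g' x) \<longlongrightarrow> 0) at_top" "((\<lambda>x. f x * g' x) \<longlongrightarrow> 0) at_bot"
      using tendsto_mult[OF T(1) T(7)] tendsto_mult[OF T(2) T(8)] by simp_all
    show "((\<lambda>x. f x * g' x) has_real_derivative f x * g'' x + f' x * g' x) (at x)" for x
      using DERIV_mult[OF d] by (simp add: algebra_simps)
    show "continuous_on UNIV (\<lambda>x. f x * g'' x + f' x * g' x)" by (intro continuous_intros c)
  qed (intro Bochner_Integration.integrable_add I)
  then show ?thesis using I by simp
qed

lemma sobolev2_integral_deriv_mult:
  assumes f: "sobolev2 f f' f''" and g: "sobolev2 g g' g''"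
  shows "integrable lborel (\<lambda>x. f x * g' x + f' x * g x)" "(LBINT x. f x * g' x + f' x * g x) = 0"
proof -
  have "(\<lambda>x. f' x * g x) = (\<lambda>x. g x * f' x)" by (simp add: mult.commute)
  then have i: "integrable lborel (\<lambda>x. f x * g' x)" "integrable lborel (\<lambda>x. f' x * g x)"
    using sobolev2_integrable_mult(2)[OF f g] sobolev2_integrable_mult(2)[OF g f] by simp_all
  then show I: "integrable lborel (\<lambda>x. f x * g' x + f' x * g x)" by simp
  note T = sobolev2_tendsto[OF f] sobolev2_tendsto[OF g]
  note c = sobolev2_cont[OF f] sobolev2_cont[OF g]
  have d: "(f has_real_derivative f' x) (at x)" "(g has_real_derivative g' x) (at x)" for x
    using f g by (auto simp: sobolev2_def)
  show "(LBINT x. f x * g' x + f' x * g x) = 0"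
  proof (rule integral_derivative_eq_0[where F="\<lambda>x. f x * g x"])
    show "((\<lambda>x. f x * g x) \<longlongrightarrow> 0) at_top" "((\<lambda>x. f x * g x) \<longlongrightarrow> 0) at_bot"
      using tendsto_mult[OF T(1) T(5)] tendsto_mult[OF T(2) T(6)] by simp_all
    show "((\<lambda>x. f x * g x) has_real_derivative f x * g' x + f' x * g x) (at x)" for x
      using DERIV_mult[OF d] by (simp add: algebra_simps)
    show "continuous_on UNIV (\<lambda>x. f x * g' x + f' x * g x)" by (intro continuous_intros c)
  qed (rule I)
qed

lemma sobolev2_symmetric:
  assumes f: "sobolev2 f f' f''" and g: "sobolev2 g g' g''"
  shows "(LBINT x. f x * g'' x) = (LBINT x. f'' x * g x)"
  using sobolev2_by_parts[OF f g] sobolev2_by_parts[OF g f] by (simp add: mult.commute)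

section \<open>Eigenvalues in the gap\<close>

text \<open>Expressed through \<open>tanh\<close>, so that unfolding it turns the identities below
  into polynomial ones in \<open>tanh\<close>.\<close>

definition sech2 :: "real \<Rightarrow> real" where
  "sech2 y = 1 - (tanh y)\<^sup>2"

lemma sech2_pos: "0 < sech2 y" and sech2_le_1: "sech2 y \<le> 1"
proof -
  have "\<bar>tanh y\<bar> < 1" using tanh_real_bounds[of y] by auto
  then show "0 < sech2 y" unfolding sech2_def by (simp add: abs_square_less_1)
qed (simp add: sech2_def)

lemma sech2_minus [simp]: "sech2 (- y) = sech2 y"
  by (simp add: sech2_def)

lemma tanh_mult_self_nonneg: "0 \<le> tanh y * (y::real)"
  by (cases "0 \<le> y") (auto intro: mult_nonneg_nonneg mult_nonpos_nonpos)

lemma has_real_derivative_tanh_sech2: "(tanh has_real_derivative sech2 y) (at y)"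
  unfolding sech2_def by (auto intro!: derivative_eq_intros)

lemma has_real_derivative_sech2: "(sech2 has_real_derivative - 2 * tanh y * sech2 y) (at y)"
  unfolding sech2_def by (auto intro!: derivative_eq_intros simp: sech2_def)

lemma continuous_on_sech2 [continuous_intros]: "continuous_on A sech2"
  by (rule DERIV_continuous_on) (rule has_field_derivative_at_within[OF has_real_derivative_sech2])

lemma continuous_on_tanh_real: "continuous_on A (tanh :: real \<Rightarrow> real)"
  by (rule DERIV_continuous_on) (rule has_field_derivative_at_within[OF has_real_derivative_tanh_sech2])

lemma measurable_sech2 [measurable]: "sech2 \<in> borel_measurable borel"
  by (intro borel_measurable_continuous_onI continuous_on_sech2)

lemma sech2_at_top: "(sech2 \<longlongrightarrow> 0) at_top" and sech2_at_bot: "(sech2 \<longlongrightarrow> 0) at_bot"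
proof -
  have "((\<lambda>y. 1 - (tanh y)\<^sup>2) \<longlongrightarrow> 1 - 1\<^sup>2) (at_top :: real filter)"
    by (intro tendsto_intros tanh_real_at_top)
  then show "(sech2 \<longlongrightarrow> 0) at_top" by (simp add: sech2_def[abs_def])
  have "((\<lambda>y. 1 - (tanh y)\<^sup>2) \<longlongrightarrow> 1 - (- 1)\<^sup>2) (at_bot :: real filter)"
    by (intro tendsto_intros tanh_real_at_bot)
  then show "(sech2 \<longlongrightarrow> 0) at_bot" by (simp add: sech2_def[abs_def])
qed

lemma integrable_sech2_mult:
  assumes "integrable lborel f"
  shows "integrable lborel (\<lambda>x. sech2 x * f x :: real)"
proof (rule Bochner_Integration.integrable_bound[OF assms])
  show "(\<lambda>x. sech2 x * f x) \<in> borel_measurable lborel" using assms by measurable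
  have "\<bar>sech2 x * f x\<bar> \<le> 1 * \<bar>f x\<bar>" for x
    unfolding abs_mult by (rule mult_right_mono) (use sech2_pos[of x] sech2_le_1[of x] in auto)
  then show "AE x in lborel. norm (sech2 x * f x) \<le> norm (f x)" by simp
qed

text \<open>
  Jacobi's factorization with the positive-up-to-sign solution \<open>\<eta> = 3 tanh\<^sup>2 - 1\<close> of
  \<open>\<eta>'' = - 6 sech\<^sup>2 \<eta>\<close>, a Legendre function: the integrand is
  \<open>(h' - \<eta>' h / \<eta>)\<^sup>2 + (\<eta>' h\<^sup>2 / \<eta>)'\<close>. At the two zeros of \<open>\<eta>\<close> the function \<open>h\<close> vanishes as well,
  and division by zero gives the correct value \<open>0\<close> of \<open>\<eta>' h\<^sup>2 / \<eta>\<close>.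
\<close>

lemma hardy_sech2:
  assumes h: "sobolev2 h h' h''" and y0: "y0 > 0" "(tanh y0)\<^sup>2 = 1/3"
    and z: "h y0 = 0" "h (- y0) = 0"
  shows "0 \<le> (LBINT y. (h' y)\<^sup>2 - 6 * (sech2 y * (h y)\<^sup>2))"
proof -
  define \<eta> where "\<eta> = (\<lambda>y. 3 * (tanh y)\<^sup>2 - 1 :: real)"
  define q where "q = (\<lambda>y. 6 * tanh y * sech2 y * ((h y)\<^sup>2 / \<eta> y))"
  define g where "g = (\<lambda>y. (h' y)\<^sup>2 - 6 * (sech2 y * (h y)\<^sup>2))"
  have dh: "(h has_real_derivative h' y) (at y)" for y using h by (simp add: sobolev2_def)
  note ch = sobolev2_cont[OF h]
  have cg: "continuous_on UNIV g" unfolding g_def by (intro continuous_intros ch)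
  have ig: "integrable lborel g" unfolding g_def
    using h by (intro Bochner_Integration.integrable_diff integrable_mult_right integrable_sech2_mult)
      (auto simp: sobolev2_def)
  obtain G where G: "\<And>x. (G has_real_derivative g x) (at x)" "(G \<longlongrightarrow> 0) at_bot"
    "(G \<longlongrightarrow> (LBINT x. g x)) at_top"
    using whole_line_antiderivative[OF cg ig] by blast
  \<comment> \<open>Away from the zeros of \<open>\<eta>\<close> this is an antiderivative of the
    complete square, hence nondecreasing on each of the three intervals that they cut out;
    continuity at the zeros joins the intervals.\<close>
  define B where "B = (\<lambda>y. G y - q y)"
  have d\<eta>: "(\<eta> has_real_derivative 6 * tanh y * sech2 y) (at y)" for y
    unfolding \<eta>_def by (auto intro!: derivative_eq_intros simp: sech2_def)
  have \<eta>0: "\<eta> y = 0 \<longleftrightarrow> y = y0 \<or> y = - y0" for y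
  proof -
    have "\<eta> y = 3 * ((tanh y)\<^sup>2 - (tanh y0)\<^sup>2)" unfolding \<eta>_def y0 by simp
    also have "\<dots> = 0 \<longleftrightarrow> tanh y = tanh y0 \<or> tanh y = tanh (- y0)"
      by (simp add: power2_eq_iff)
    finally show ?thesis by (simp only: tanh_real_eq_iff)
  qed
  have dB: "(B has_real_derivative (h' y - 6 * tanh y * sech2 y / \<eta> y * h y)\<^sup>2) (at y)"
    if "\<eta> y \<noteq> 0" for y
  proof -
    have "(B has_real_derivative g y - (((6 * sech2 y * sech2 y + 6 * tanh y * (- 2 * tanh y * sech2 y)) * ((h y)\<^sup>2 / \<eta> y))
       + 6 * tanh y * sech2 y * ((2 * h y * h' y * \<eta> y - (h y)\<^sup>2 * (6 * tanh y * sech2 y)) / (\<eta> y * \<eta> y)))) (at y)"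
    proof -
      have d1: "((\<lambda>y. 6 * tanh y * sech2 y) has_real_derivative
          6 * sech2 y * sech2 y + 6 * tanh y * (- 2 * tanh y * sech2 y)) (at y)"
        by (auto intro!: derivative_eq_intros has_real_derivative_sech2 has_real_derivative_tanh_sech2
            simp: sech2_def)
      have d2: "((\<lambda>y. (h y)\<^sup>2) has_real_derivative 2 * h y * h' y) (at y)"
        by (auto intro!: derivative_eq_intros dh)
      show ?thesis
        unfolding B_def q_def
        by (rule DERIV_cong[OF DERIV_diff[OF G(1) DERIV_mult[OF d1 DERIV_divide[OF d2 d\<eta> that]]]])
          (simp only: mult.commute)
    qed
    moreover have "6 * sech2 y * sech2 y + 6 * tanh y * (- 2 * tanh y * sech2 y) = - 6 * sech2 y * \<eta> y"
      by (simp add: \<eta>_def sech2_def algebra_simps power2_eq_square)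
    moreover have "g y - ((- 6 * sech2 y * \<eta> y * ((h y)\<^sup>2 / \<eta> y))
       + 6 * tanh y * sech2 y * ((2 * h y * h' y * \<eta> y - (h y)\<^sup>2 * (6 * tanh y * sech2 y)) / (\<eta> y * \<eta> y)))
       = (h' y - 6 * tanh y * sech2 y / \<eta> y * h y)\<^sup>2"
      using that unfolding g_def by (simp add: field_simps power2_eq_square)
    ultimately show ?thesis by simp
  qed
  \<comment> \<open>The zeros of \<open>\<eta>\<close> are simple and \<open>h\<close> vanishes
    there: one factor \<open>h\<close> cancels the zero of the denominator in the limit of the
    difference quotients, the other tends to 0.\<close>
  have tq: "(q \<longlongrightarrow> 0) (at y1)" if y1: "y1 = y0 \<or> y1 = - y0" for y1
  proof -
    have h0: "h y1 = 0" and c0: "\<eta> y1 = 0" and t0: "6 * tanh y1 * sech2 y1 \<noteq> 0"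
      using y1 z \<eta>0 y0 sech2_pos[of y0] by auto
    have l1: "((\<lambda>y. h y / (y - y1)) \<longlongrightarrow> h' y1) (at y1)"
      using dh[of y1] by (simp add: has_field_derivative_iff h0)
    have l2: "((\<lambda>y. \<eta> y / (y - y1)) \<longlongrightarrow> 6 * tanh y1 * sech2 y1) (at y1)"
      using d\<eta>[of y1] by (simp add: has_field_derivative_iff c0)
    have l3: "(h \<longlongrightarrow> 0) (at y1)" using DERIV_isCont[OF dh[of y1]] h0 by (simp add: isCont_def)
    have l4: "((\<lambda>y. 6 * tanh y * sech2 y) \<longlongrightarrow> 6 * tanh y1 * sech2 y1) (at y1)"
      using DERIV_isCont[OF has_real_derivative_tanh_sech2, of y1]
        DERIV_isCont[OF has_real_derivative_sech2, of y1]
      by (intro tendsto_intros) (simp_all add: isCont_def)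
    have "((\<lambda>y. 6 * tanh y * sech2 y * (h y * (h y / (y - y1) / (\<eta> y / (y - y1))))) \<longlongrightarrow>
        6 * tanh y1 * sech2 y1 * (0 * (h' y1 / (6 * tanh y1 * sech2 y1)))) (at y1)"
      by (intro tendsto_mult[OF l4] tendsto_mult[OF l3] tendsto_divide l1 l2 t0)
    moreover have "\<forall>\<^sub>F y in at y1. 6 * tanh y * sech2 y * (h y * (h y / (y - y1) / (\<eta> y / (y - y1)))) = q y"
      unfolding eventually_at_filter by (auto simp: q_def power2_eq_square)
    ultimately show ?thesis by (simp add: tendsto_cong)
  qed
  have cB: "isCont B y" for y
  proof (cases "\<eta> y = 0")
    case True
    then have y1: "y = y0 \<or> y = - y0" by (simp add: \<eta>0)
    have "(B \<longlongrightarrow> G y - 0) (at y)" unfolding B_def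
      using DERIV_isCont[OF G(1)[of y]] by (intro tendsto_intros tq[OF y1]) (simp add: isCont_def)
    then show ?thesis by (simp add: isCont_def B_def q_def True)
  next
    case False
    then show ?thesis using DERIV_isCont[OF dB] by blast
  qed
  have mono: "B x \<le> B y" if "x \<le> y" "\<And>w. x < w \<Longrightarrow> w < y \<Longrightarrow> \<eta> w \<noteq> 0" for x y
  proof (rule DERIV_nonneg_imp_increasing_open[OF that(1)])
    show "continuous_on {x..y} B" using cB by (simp add: continuous_at_imp_continuous_on)
    fix w assume "x < w" "w < y"
    then show "\<exists>l. (B has_real_derivative l) (at w) \<and> 0 \<le> l" using dB[of w] that(2)[of w] by auto
  qed
  have le: "B (- y) \<le> B y" if "y > y0" for y
  proof -
    have "B (- y) \<le> B (- y0)" by (rule mono) (use that y0 in \<open>auto simp: \<eta>0\<close>)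
    also have "\<dots> \<le> B y0" by (rule mono) (use that y0 in \<open>auto simp: \<eta>0\<close>)
    also have "\<dots> \<le> B y" by (rule mono) (use that y0 in \<open>auto simp: \<eta>0\<close>)
    finally show ?thesis .
  qed
  note T = sobolev2_tendsto[OF h]
  have "((\<lambda>y. 6 * tanh y * sech2 y * ((h y)\<^sup>2 / \<eta> y)) \<longlongrightarrow> 6 * 1 * 0 * (0\<^sup>2 / (3 * 1\<^sup>2 - 1))) at_top"
    unfolding \<eta>_def by (intro tendsto_intros T tanh_real_at_top sech2_at_top) simp
  then have "(B \<longlongrightarrow> (LBINT x. g x) - 0) at_top"
    unfolding B_def by (intro tendsto_intros G) (simp add: q_def[abs_def])
  moreover have "((\<lambda>y. 6 * tanh y * sech2 y * ((h y)\<^sup>2 / \<eta> y)) \<longlongrightarrow> 6 * (- 1) * 0 * (0\<^sup>2 / (3 * (- 1)\<^sup>2 - 1))) at_bot"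
    unfolding \<eta>_def by (intro tendsto_intros T tanh_real_at_bot sech2_at_bot) simp
  then have "(B \<longlongrightarrow> 0 - 0) at_bot"
    unfolding B_def by (intro tendsto_intros G) (simp add: q_def[abs_def])
  then have "((\<lambda>y. B (- y)) \<longlongrightarrow> 0) at_top"
    using filterlim_compose[OF _ filterlim_uminus_at_bot_at_top, of B "nhds 0"] by simp
  ultimately have "0 \<le> (LBINT x. g x) - 0"
    by (rule tendsto_le[rotated]) (auto intro: eventually_mono[OF eventually_gt_at_top[of y0] le])
  then show ?thesis by (simp add: g_def)
qed

text \<open>The zero set has full measure and is closed, hence is the whole line.\<close>

lemma continuous_integral_eq_0_imp:
  fixes f :: "real \<Rightarrow> real"
  assumes "continuous_on UNIV f" "integrable lborel f" "\<And>x. 0 \<le> f x" "(LBINT x. f x) \<le> 0"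
  shows "f x = 0"
proof -
  have "(LBINT x. f x) = 0" using assms(3,4) by (simp add: order_antisym)
  then have "AE x in lborel. f x = 0" using assms(2,3) by (simp add: integral_nonneg_eq_0_iff_AE)
  then have "AE x in lebesgue. x \<in> f -` {0}" by (auto intro: AE_completion)
  moreover have "closed (f -` {0})"
    using assms(1) by (intro closed_vimage) (auto simp: continuous_on_eq_continuous_within)
  ultimately show ?thesis using mem_closed_if_AE_lebesgue by blast
qed

text \<open>The second derivative \<open>f''\<close> is a separate argument.\<close>

definition schroedinger :: "real \<Rightarrow> real \<Rightarrow> (real \<Rightarrow> real) \<Rightarrow> (real \<Rightarrow> real) \<Rightarrow> real \<Rightarrow> real" where
  "schroedinger A c f f'' = (\<lambda>y. - f'' y + A * f y - c * (sech2 y * f y))"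

lemma schroedinger_integrable:
  assumes f: "sobolev2 f f' f''" and g: "sobolev2 g g' g''"
  shows "integrable lborel (\<lambda>y. g y * schroedinger A c f f'' y)"
    "integrable lborel (\<lambda>y. schroedinger A c f f'' y * g y)"
proof -
  have "(\<lambda>y. g y * schroedinger A c f f'' y) =
      (\<lambda>y. A * (g y * f y) - g y * f'' y - c * (sech2 y * (g y * f y)))"
    by (simp add: schroedinger_def fun_eq_iff algebra_simps)
  then show "integrable lborel (\<lambda>y. g y * schroedinger A c f f'' y)"
    using sobolev2_integrable_mult[OF g f]
    by (auto intro!: Bochner_Integration.integrable_diff integrable_mult_right integrable_sech2_mult)
  then show "integrable lborel (\<lambda>y. schroedinger A c f f'' y * g y)" by (simp add: mult.commute)
qed

lemma schroedinger_symmetric: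
  assumes f: "sobolev2 f f' f''" and g: "sobolev2 g g' g''"
  shows "(LBINT y. g y * schroedinger A c f f'' y) = (LBINT y. schroedinger A c g g'' y * f y)"
proof -
  have "(LBINT y. g y * schroedinger A c f f'' y) - (LBINT y. schroedinger A c g g'' y * f y)
      = (LBINT y. g y * schroedinger A c f f'' y - schroedinger A c g g'' y * f y)"
    using schroedinger_integrable[OF f g] schroedinger_integrable[OF g f] by simp
  also have "\<dots> = (LBINT y. g'' y * f y - g y * f'' y)"
    by (simp add: schroedinger_def algebra_simps)
  also have "\<dots> = (LBINT y. g'' y * f y) - (LBINT y. g y * f'' y)"
    using sobolev2_integrable_mult[OF f g] sobolev2_integrable_mult[OF g f]
    by (intro Bochner_Integration.integral_diff) (auto simp: mult.commute)
  also have "\<dots> = 0" using sobolev2_symmetric[OF g f] by simp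
  finally show ?thesis by simp
qed

text \<open>Locates the zeros of the Legendre function \<open>3 tanh\<^sup>2 - 1\<close>.\<close>

lemma exists_tanh_squared_third: "\<exists>y>0. (tanh y)\<^sup>2 = (1/3 :: real)"
proof -
  have lt: "sqrt (1/3 :: real) < 1" by (simp add: real_sqrt_divide)
  have "\<forall>\<^sub>F y in at_top. tanh y > sqrt (1/3 :: real)"
    by (rule order_tendstoD(1)[OF tanh_real_at_top lt])
  then obtain N :: real where N: "\<And>y. y \<ge> N \<Longrightarrow> tanh y > sqrt (1/3)"
    by (auto simp: eventually_at_top_linorder)
  have "\<exists>y\<ge>0. y \<le> max 0 N \<and> tanh y = sqrt (1/3 :: real)"
    using N[of "max 0 N"] by (intro IVT') (auto intro: continuous_on_tanh_real)
  then obtain y where y: "y \<ge> 0" "tanh y = sqrt (1/3 :: real)" by blast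
  then have "y \<noteq> 0" by auto
  with y show ?thesis by (intro exI[of _ y]) auto
qed

text \<open>
  The pair \<open>(m, n)\<close> supplies a second direction on which the form of \<open>A\<^sub>- A\<^sub>+ A\<^sub>- - \<mu>\<^sup>2 A\<^sub>-\<close> is
  negative. Together with the eigenfunction it spans a plane of functions \<open>p\<close>; one of them has
  \<open>h = A\<^sub>- p\<close> vanishing at both zeros of the Legendre function, so \<open>\<langle>A\<^sub>+ h, h\<rangle> \<ge> a\<^sup>2 |h|\<^sup>2\<close>,
  while the factorization \<open>A\<^sub>- = S\<^sup>* S\<close> with \<open>S S\<^sup>* \<ge> a\<^sup>2\<close> gives \<open>|h|\<^sup>2 \<ge> a\<^sup>2 \<langle>A\<^sub>- p, p\<rangle>\<close>.
\<close>

lemma no_gap_eigenfunction_of_direction: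
  assumes a: "0 < a" "a < 1" and \<mu>: "0 < \<mu>" "\<mu> \<le> a\<^sup>2"
    and v: "sobolev2 v v' v''" and u: "sobolev2 u u' u''"
    and m: "sobolev2 m m' m''" and n: "sobolev2 n n' n''"
    and eqv: "schroedinger (a\<^sup>2) (a * (a + 1)) v v'' = (\<lambda>y. \<mu> * u y)"
    and equ: "schroedinger (a\<^sup>2) ((a + 1) * (a + 2)) u u'' = (\<lambda>y. \<mu> * v y)"
    and eqm: "schroedinger (a\<^sup>2) (a * (a + 1)) m m'' = n"
    and parity: "\<And>y. u (- y) = \<epsilon> * u y" "\<And>y. n (- y) = \<epsilon> * n y"
    and nk: "(LBINT y. n y * schroedinger (a\<^sup>2) ((a + 1) * (a + 2)) n n'' y) \<le> 0"
    and nm: "0 < (LBINT y. n y * m y)"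
  shows "u y = 0"
proof -
  define k where "k = schroedinger (a\<^sup>2) ((a + 1) * (a + 2)) n n''"
  obtain y0 :: real where y0: "y0 > 0" "(tanh y0)\<^sup>2 = 1/3"
    using exists_tanh_squared_third by blast
  \<comment> \<open>The combination is chosen with \<open>h y0 = 0\<close>; parity then gives the
    zero at \<open>- y0\<close>, so that one condition is enough on a plane. If
    \<open>n y0 = 0\<close> the direction \<open>m\<close> alone is taken, with
    \<open>\<beta> = 1\<close>; hence \<open>\<beta> = 0\<close>, once it is known, forces
    \<open>\<alpha> = 1\<close>.\<close>
  define \<alpha> where "\<alpha> = (if n y0 = 0 then 0 else 1 :: real)"
  define \<beta> where "\<beta> = (if n y0 = 0 then 1 else - \<mu> * u y0 / n y0)"
  have y0z: "\<alpha> * (\<mu> * u y0) + \<beta> * n y0 = 0" by (simp add: \<alpha>_def \<beta>_def)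
  define p where "p = (\<lambda>y. \<alpha> * v y + \<beta> * m y)"
  define p' where "p' = (\<lambda>y. \<alpha> * v' y + \<beta> * m' y)"
  define p'' where "p'' = (\<lambda>y. \<alpha> * v'' y + \<beta> * m'' y)"
  define h where "h = (\<lambda>y. (\<alpha> * \<mu>) * u y + \<beta> * n y)"
  define h' where "h' = (\<lambda>y. (\<alpha> * \<mu>) * u' y + \<beta> * n' y)"
  define h'' where "h'' = (\<lambda>y. (\<alpha> * \<mu>) * u'' y + \<beta> * n'' y)"
  have p: "sobolev2 p p' p''" unfolding p_def p'_def p''_def by (rule sobolev2_lincomb[OF v m])
  have h: "sobolev2 h h' h''" unfolding h_def h'_def h''_def by (rule sobolev2_lincomb[OF u n])
  have hp: "h = schroedinger (a\<^sup>2) (a * (a + 1)) p p''"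
  proof
    fix y
    have "schroedinger (a\<^sup>2) (a * (a + 1)) p p'' y = \<alpha> * schroedinger (a\<^sup>2) (a * (a + 1)) v v'' y
        + \<beta> * schroedinger (a\<^sup>2) (a * (a + 1)) m m'' y"
      by (simp add: p_def p''_def schroedinger_def algebra_simps)
    then show "h y = schroedinger (a\<^sup>2) (a * (a + 1)) p p'' y"
      unfolding eqv eqm by (simp add: h_def)
  qed
  define r where "r = schroedinger (a\<^sup>2) ((a + 1) * (a + 2)) h h''"
  have r: "r y = \<alpha> * (\<mu>\<^sup>2 * v y) + \<beta> * k y" for y
  proof -
    have "r y = \<alpha> * \<mu> * schroedinger (a\<^sup>2) ((a + 1) * (a + 2)) u u'' y + \<beta> * k y"
      by (simp add: r_def h_def h''_def k_def schroedinger_def algebra_simps)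
    then show ?thesis unfolding equ by (simp add: power2_eq_square)
  qed
  note I = sobolev2_integrable_mult[OF h h] sobolev2_integrable_mult[OF p h]
  have sq: "integrable lborel (\<lambda>y. (f y)\<^sup>2)" if "integrable lborel (\<lambda>y. f y * f y)" for f :: "real \<Rightarrow> real"
    using that by (simp add: power2_eq_square)

  have I1: "a\<^sup>2 * (LBINT y. h y * h y) \<le> (LBINT y. h y * r y)"
  proof -
    have ic: "integrable lborel (\<lambda>y. sech2 y * (h y * h y))" by (intro integrable_sech2_mult I)
    have "(LBINT y. h y * r y) = (LBINT y. a\<^sup>2 * (h y * h y) - h y * h'' y
        - (a + 1) * (a + 2) * (sech2 y * (h y * h y)))"
      by (simp add: r_def schroedinger_def algebra_simps)
    also have "\<dots> = a\<^sup>2 * (LBINT y. h y * h y) - (LBINT y. h y * h'' y)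
        - (a + 1) * (a + 2) * (LBINT y. sech2 y * (h y * h y))"
      using I ic by simp
    finally have 1: "(LBINT y. h y * r y) = a\<^sup>2 * (LBINT y. h y * h y) + (LBINT y. h' y * h' y)
        - (a + 1) * (a + 2) * (LBINT y. sech2 y * (h y * h y))"
      using sobolev2_by_parts[OF h h] by simp
    have z: "h y0 = 0" "h (- y0) = 0"
    proof -
      show "h y0 = 0" using y0z by (simp add: h_def)
      have "h (- y0) = \<epsilon> * h y0" unfolding h_def parity by (simp add: algebra_simps)
      then show "h (- y0) = 0" using \<open>h y0 = 0\<close> by simp
    qed
    have "0 \<le> (LBINT y. (h' y)\<^sup>2 - 6 * (sech2 y * (h y)\<^sup>2))"
      by (rule hardy_sech2[OF h y0 z])
    also have "\<dots> = (LBINT y. h' y * h' y) - 6 * (LBINT y. sech2 y * (h y * h y))"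
      using I ic by (simp add: power2_eq_square)
    finally have 2: "6 * (LBINT y. sech2 y * (h y * h y)) \<le> (LBINT y. h' y * h' y)" by simp
    have 3: "0 \<le> (LBINT y. sech2 y * (h y * h y))"
      by (rule Bochner_Integration.integral_nonneg) (use sech2_pos in \<open>auto intro!: mult_nonneg_nonneg simp: less_imp_le\<close>)
    \<comment> \<open>As \<open>a < 1\<close>, the well of \<open>A\<^sub>+\<close> is no deeper
      than the Legendre potential \<open>6 sech\<^sup>2\<close>.\<close>
    have "(a + 1) * (a + 2) \<le> 2 * 3" by (rule mult_mono) (use a in auto)
    then have "(a + 1) * (a + 2) * (LBINT y. sech2 y * (h y * h y))
        \<le> 6 * (LBINT y. sech2 y * (h y * h y))"
      using 3 by (intro mult_right_mono) auto
    then show ?thesis using 1 2 by linarith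
  qed

  \<comment> \<open>With \<open>S = d + a tanh\<close> this is \<open>z = S p\<close>, and
    \<open>h = S\<^sup>* z\<close> below for \<open>S\<^sup>* = - d + a tanh\<close>. The factors
    \<open>1 *\<close> match the shape of \<open>continuous_square_integrable_add\<close>.\<close>
  define z where "z = (\<lambda>y. 1 * p' y + a * (tanh y * p y))"
  define z' where "z' = (\<lambda>y. 1 * (1 * p'' y + a * (sech2 y * p y)) + a * (tanh y * p' y))"
  have dp: "(p has_real_derivative p' y) (at y)" "(p' has_real_derivative p'' y) (at y)" for y
    using p by (auto simp: sobolev2_def)
  note cp = sobolev2_cont[OF p] continuous_on_tanh_real continuous_on_sech2
  have ip: "integrable lborel (\<lambda>y. (p y)\<^sup>2)" "integrable lborel (\<lambda>y. (p' y)\<^sup>2)" "integrable lborel (\<lambda>y. (p'' y)\<^sup>2)"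
    using p by (auto simp: sobolev2_def)
  have it: "integrable lborel (\<lambda>y. (tanh y * f y)\<^sup>2)" if "integrable lborel (\<lambda>y. (f y)\<^sup>2)" for f :: "real \<Rightarrow> real"
  proof -
    have "integrable lborel (\<lambda>y. (f y)\<^sup>2 - sech2 y * (f y)\<^sup>2)"
      by (intro Bochner_Integration.integrable_diff integrable_sech2_mult that)
    then show ?thesis by (simp add: sech2_def power_mult_distrib algebra_simps)
  qed
  have isq: "integrable lborel (\<lambda>y. (sech2 y * f y)\<^sup>2)" if "integrable lborel (\<lambda>y. (f y)\<^sup>2)" for f :: "real \<Rightarrow> real"
  proof -
    have "integrable lborel (\<lambda>y. sech2 y * (sech2 y * (f y)\<^sup>2))"
      by (intro integrable_sech2_mult that)
    then show ?thesis by (simp add: power2_eq_square algebra_simps)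
  qed
  have cz: "continuous_on UNIV z" "continuous_on UNIV z'"
    unfolding z_def z'_def by (intro continuous_intros cp)+
  have iz: "integrable lborel (\<lambda>y. (z y)\<^sup>2)" "integrable lborel (\<lambda>y. (z' y)\<^sup>2)"
    unfolding z_def z'_def
    by (intro continuous_square_integrable_add continuous_intros cp it isq ip)+
  have dz: "(z has_real_derivative z' y) (at y)" for y
    unfolding z_def z'_def
    by (auto intro!: derivative_eq_intros dp has_real_derivative_tanh_sech2 simp: sech2_def algebra_simps)
  note Tz = tendsto_0_of_square_integrable_deriv[OF dz cz(2) iz]
  have hz: "h y = a * (tanh y * z y) - z' y" for y
    unfolding hp schroedinger_def z_def z'_def sech2_def by (simp add: algebra_simps power2_eq_square)
  have mz: "z \<in> borel_measurable lborel" "z' \<in> borel_measurable lborel" "p \<in> borel_measurable lborel"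
    "p' \<in> borel_measurable lborel" "(\<lambda>y. tanh y * z y) \<in> borel_measurable lborel"
    using cz cp by (auto intro!: borel_measurable_continuous_onI continuous_intros)

  \<comment> \<open>This is the form of \<open>S S\<^sup>* = - d\<^sup>2 + a\<^sup>2 + a (1 - a)
    sech\<^sup>2\<close> at \<open>z\<close>. The partner potential is repulsive because
    \<open>a < 1\<close>, and its strictly positive surplus is what finally forces
    \<open>z = 0\<close>.\<close>
  have I2: "(LBINT y. h y * h y) = (LBINT y. (z' y)\<^sup>2) + a\<^sup>2 * (LBINT y. (z y)\<^sup>2)
      + a * (1 - a) * (LBINT y. sech2 y * (z y)\<^sup>2)"
  proof -
    define F' where "F' = (\<lambda>y. - a * (sech2 y * (z y)\<^sup>2) - 2 * a * (tanh y * z y * z' y))"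
    have iF: "integrable lborel F'" unfolding F'_def
      by (intro Bochner_Integration.integrable_diff integrable_mult_right integrable_sech2_mult
          integrable_mult_of_squares iz it mz)
    have 0: "(LBINT y. F' y) = 0"
    proof (rule integral_derivative_eq_0[OF _ _ iF])
      show "((\<lambda>y. - a * (tanh y * (z y)\<^sup>2)) has_real_derivative F' y) (at y)" for y
        unfolding F'_def
        by (auto intro!: derivative_eq_intros dz has_real_derivative_tanh_sech2 simp: sech2_def algebra_simps)
      show "continuous_on UNIV F'" unfolding F'_def by (intro continuous_intros cz continuous_on_tanh_real)
      have "((\<lambda>y. - a * (tanh y * (z y)\<^sup>2)) \<longlongrightarrow> - a * (1 * 0\<^sup>2)) at_top"
        by (intro tendsto_intros Tz tanh_real_at_top)
      then show "((\<lambda>y. - a * (tanh y * (z y)\<^sup>2)) \<longlongrightarrow> 0) at_top" by simp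
      have "((\<lambda>y. - a * (tanh y * (z y)\<^sup>2)) \<longlongrightarrow> - a * (- 1 * 0\<^sup>2)) at_bot"
        by (intro tendsto_intros Tz tanh_real_at_bot)
      then show "((\<lambda>y. - a * (tanh y * (z y)\<^sup>2)) \<longlongrightarrow> 0) at_bot" by simp
    qed
    have "(\<lambda>y. h y * h y) = (\<lambda>y. ((z' y)\<^sup>2 + a\<^sup>2 * (z y)\<^sup>2 + a * (1 - a) * (sech2 y * (z y)\<^sup>2)) + F' y)"
      unfolding hz F'_def fun_eq_iff by (simp add: sech2_def power2_eq_square algebra_simps)
    then show ?thesis using 0 iF iz by (simp add: integrable_sech2_mult)
  qed
  have I3: "(LBINT y. p y * h y) = (LBINT y. (z y)\<^sup>2)"
  proof -
    have iF: "integrable lborel (\<lambda>y. p' y * z y + p y * z' y)"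
      by (intro Bochner_Integration.integrable_add integrable_mult_of_squares iz ip mz)
    have 0: "(LBINT y. p' y * z y + p y * z' y) = 0"
    proof (rule integral_derivative_eq_0[OF _ _ iF])
      show "((\<lambda>y. p y * z y) has_real_derivative p' y * z y + p y * z' y) (at y)" for y
        by (auto intro!: derivative_eq_intros dz dp)
      show "continuous_on UNIV (\<lambda>y. p' y * z y + p y * z' y)" by (intro continuous_intros cz cp)
      show "((\<lambda>y. p y * z y) \<longlongrightarrow> 0) at_top" "((\<lambda>y. p y * z y) \<longlongrightarrow> 0) at_bot"
        using tendsto_mult[OF sobolev2_tendsto(1)[OF p] Tz(1)]
          tendsto_mult[OF sobolev2_tendsto(2)[OF p] Tz(2)] by simp_all
    qed
    have "(\<lambda>y. p y * h y) = (\<lambda>y. (z y)\<^sup>2 - (p' y * z y + p y * z' y))"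
      unfolding hz fun_eq_iff by (simp add: z_def power2_eq_square algebra_simps)
    then show ?thesis using 0 iF iz by simp
  qed

  define D where "D = (LBINT y. n y * k y) - \<mu>\<^sup>2 * (LBINT y. n y * m y)"
  have D: "D < 0"
  proof -
    have "0 < \<mu>\<^sup>2 * (LBINT y. n y * m y)" using nm \<mu> by simp
    then show ?thesis using nk unfolding D_def k_def by linarith
  qed
  \<comment> \<open>Since \<open>A\<^sub>+ A\<^sub>- v = \<mu>\<^sup>2 v\<close>, the eigenfunction
    lies in the kernel of the form: its own term and the mixed terms vanish, and only the value
    \<open>D\<close> at \<open>m\<close> survives.\<close>
  have I4: "(LBINT y. h y * r y) - \<mu>\<^sup>2 * (LBINT y. p y * h y) = \<beta>\<^sup>2 * D"
  proof -
    have iuk: "integrable lborel (\<lambda>y. u y * k y)" "integrable lborel (\<lambda>y. n y * k y)"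
      unfolding k_def by (rule schroedinger_integrable[OF n u] schroedinger_integrable[OF n n])+
    note J = iuk sobolev2_integrable_mult(1)[OF u m] sobolev2_integrable_mult(1)[OF n m]
    have ihr: "integrable lborel (\<lambda>y. h y * r y)"
      unfolding r_def by (rule schroedinger_integrable[OF h h])
    have "(LBINT y. h y * r y) - \<mu>\<^sup>2 * (LBINT y. p y * h y)
        = (LBINT y. h y * r y - \<mu>\<^sup>2 * (p y * h y))"
      using ihr I by simp
    also have "(\<lambda>y. h y * r y - \<mu>\<^sup>2 * (p y * h y)) = (\<lambda>y. \<alpha> * \<mu> * \<beta> * (u y * k y - \<mu>\<^sup>2 * (u y * m y))
        + \<beta>\<^sup>2 * (n y * k y - \<mu>\<^sup>2 * (n y * m y)))"
      unfolding r h_def p_def fun_eq_iff by (simp add: algebra_simps power2_eq_square)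
    also have "(LBINT y. \<alpha> * \<mu> * \<beta> * (u y * k y - \<mu>\<^sup>2 * (u y * m y))
        + \<beta>\<^sup>2 * (n y * k y - \<mu>\<^sup>2 * (n y * m y))) =
        \<alpha> * \<mu> * \<beta> * ((LBINT y. u y * k y) - \<mu>\<^sup>2 * (LBINT y. u y * m y)) + \<beta>\<^sup>2 * D"
      using J by (simp add: D_def)
    also have "(LBINT y. u y * k y) = \<mu> * (LBINT y. v y * n y)"
      unfolding k_def schroedinger_symmetric[OF n u] equ by (simp add: mult.assoc)
    also have "(LBINT y. v y * n y) = \<mu> * (LBINT y. u y * m y)"
      unfolding eqm[symmetric] schroedinger_symmetric[OF m v] eqv by (simp add: mult.assoc)
    finally show ?thesis by (simp add: power2_eq_square)
  qed

  \<comment> \<open>\<open>Z\<close> is the form of \<open>A\<^sub>-\<close> at \<open>p\<close>.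
    The bounds for \<open>A\<^sub>+\<close> and for \<open>S S\<^sup>*\<close> leave
    \<open>a\<^sup>2 * (a\<^sup>2 * Z)\<close> against \<open>\<mu>\<^sup>2 * Z\<close>; this is
    where \<open>\<mu> \<le> a\<^sup>2\<close> enters.\<close>
  define Z where "Z = (LBINT y. (z y)\<^sup>2)"
  have Z: "0 \<le> Z" "0 \<le> (LBINT y. (z' y)\<^sup>2)" unfolding Z_def by (auto intro: Bochner_Integration.integral_nonneg)
  have ZW: "0 \<le> (LBINT y. sech2 y * (z y)\<^sup>2)"
    by (rule Bochner_Integration.integral_nonneg) (use sech2_pos in \<open>auto intro!: mult_nonneg_nonneg simp: less_imp_le\<close>)
  have "\<mu>\<^sup>2 \<le> (a\<^sup>2)\<^sup>2" using \<mu> by (intro power_mono) auto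
  then have "\<mu>\<^sup>2 * Z \<le> a\<^sup>2 * (a\<^sup>2 * Z)" using Z by (simp add: mult_right_mono power2_eq_square mult.assoc[symmetric])
  moreover have "a\<^sup>2 * ((LBINT y. (z' y)\<^sup>2) + a\<^sup>2 * Z + a * (1 - a) * (LBINT y. sech2 y * (z y)\<^sup>2))
      \<le> \<mu>\<^sup>2 * Z + \<beta>\<^sup>2 * D"
    using I1 I4[unfolded I3] unfolding Z_def I2[symmetric] by linarith
  ultimately have fin: "a\<^sup>2 * (LBINT y. (z' y)\<^sup>2) + a\<^sup>2 * (a * (1 - a) * (LBINT y. sech2 y * (z y)\<^sup>2)) \<le> \<beta>\<^sup>2 * D"
    by (simp add: algebra_simps)
  have nonneg: "0 \<le> a\<^sup>2 * (LBINT y. (z' y)\<^sup>2)" "0 \<le> a\<^sup>2 * (a * (1 - a) * (LBINT y. sech2 y * (z y)\<^sup>2))"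
    using Z ZW a by (auto intro!: mult_nonneg_nonneg)
  have \<beta>0: "\<beta> = 0"
  proof (rule ccontr)
    assume "\<beta> \<noteq> 0"
    then have "\<beta>\<^sup>2 * D < 0" using D by (simp add: mult_pos_neg)
    then show False using fin nonneg by linarith
  qed
  then have \<alpha>1: "\<alpha> = 1" by (auto simp: \<alpha>_def \<beta>_def split: if_splits)
  have "a\<^sup>2 * (a * (1 - a)) * (LBINT y. sech2 y * (z y)\<^sup>2) \<le> 0"
  proof -
    have "\<beta>\<^sup>2 * D = 0" using \<beta>0 by simp
    then show ?thesis using fin nonneg(1) unfolding mult.assoc by linarith
  qed
  then have "(LBINT y. sech2 y * (z y)\<^sup>2) \<le> 0"
    using a by (simp add: mult_le_0_iff zero_less_mult_iff)
  then have "sech2 y * (z y)\<^sup>2 = 0" for y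
    by (rule continuous_integral_eq_0_imp[rotated 3])
      (use sech2_pos in \<open>auto intro!: continuous_intros cz integrable_sech2_mult iz mult_nonneg_nonneg simp: less_imp_le\<close>)
  then have z0: "z y = 0" for y using sech2_pos[of y] by (metis less_irrefl mult_eq_0_iff power2_eq_square)
  then have "z = (\<lambda>_. 0)" by auto
  then have z'0: "z' y = 0" for y using dz[of y] DERIV_unique[OF _ DERIV_const] by metis
  have "h y = 0" using hz[of y] z0 z'0 by simp
  then show ?thesis using \<alpha>1 \<beta>0 \<mu> by (simp add: h_def)
qed

section \<open>Negative directions built from the ground state\<close>

text \<open>Of the three powers of \<open>1 + y\<^sup>2\<close>, two absorb the square of a
  quadratic factor and the third leaves the integrable majorant
  \<open>inverse (1 + y\<^sup>2)\<close>.\<close>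

lemma sech_powr_decay:
  assumes a: "0 < a" "a < 1"
  shows "\<exists>K>0. \<forall>y. (1 + y\<^sup>2) ^ 3 * (cosh y powr (- a))\<^sup>2 \<le> (K::real)"
proof -
  \<comment> \<open>The sixth power of \<open>exp (c * \<bar>y\<bar>)\<close> is then
    \<open>exp (2 * a * \<bar>y\<bar>)\<close>, the growth that \<open>sech\<close> to the power
    \<open>2 * a\<close> cancels.\<close>
  define c where "c = a / 3"
  have c: "0 < c" "c \<le> 1" using a by (auto simp: c_def)
  have "(1 + y\<^sup>2) ^ 3 * (cosh y powr (- a))\<^sup>2 \<le> 2 powr (2 * a) / c ^ 6" for y :: real
  proof -
    have "c * (1 + \<bar>y\<bar>) \<le> 1 + c * \<bar>y\<bar>" using c by (simp add: algebra_simps)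
    also have "\<dots> \<le> exp (c * \<bar>y\<bar>)" by (rule exp_ge_add_one_self)
    finally have e: "1 + \<bar>y\<bar> \<le> exp (c * \<bar>y\<bar>) / c" using c by (simp add: field_simps)
    have "1 + y\<^sup>2 \<le> (1 + \<bar>y\<bar>)\<^sup>2" by (simp add: power2_eq_square algebra_simps)
    then have "(1 + y\<^sup>2) ^ 3 \<le> ((1 + \<bar>y\<bar>)\<^sup>2) ^ 3" by (intro power_mono) auto
    also have "\<dots> = (1 + \<bar>y\<bar>) ^ 6" by (simp flip: power_mult)
    also have "\<dots> \<le> (exp (c * \<bar>y\<bar>) / c) ^ 6" by (rule power_mono[OF e]) simp
    also have "\<dots> = exp (2 * a * \<bar>y\<bar>) / c ^ 6"
      by (simp add: power_divide c_def flip: exp_of_nat_mult)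
    finally have 1: "(1 + y\<^sup>2) ^ 3 \<le> exp (2 * a * \<bar>y\<bar>) / c ^ 6" .
    have "exp x / 2 \<le> cosh x" for x :: real by (simp add: cosh_def)
    from this[of "\<bar>y\<bar>"] have ch: "exp \<bar>y\<bar> / 2 \<le> cosh y" by simp
    have "(cosh y powr (- a))\<^sup>2 = cosh y powr (- (2 * a))"
      by (simp add: power2_eq_square flip: powr_add)
    also have "\<dots> \<le> (exp \<bar>y\<bar> / 2) powr (- (2 * a))"
      by (rule powr_mono2') (use a ch in auto)
    also have "\<dots> = 2 powr (2 * a) * exp (- (2 * a * \<bar>y\<bar>))"
      by (simp add: powr_def ln_div algebra_simps flip: exp_add)
    finally have 2: "(cosh y powr (- a))\<^sup>2 \<le> 2 powr (2 * a) * exp (- (2 * a * \<bar>y\<bar>))" .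
    have "(1 + y\<^sup>2) ^ 3 * (cosh y powr (- a))\<^sup>2 \<le>
        (exp (2 * a * \<bar>y\<bar>) / c ^ 6) * (2 powr (2 * a) * exp (- (2 * a * \<bar>y\<bar>)))"
      by (rule mult_mono[OF 1 2]) (use c in auto)
    also have "\<dots> = 2 powr (2 * a) / c ^ 6" by (simp add: exp_minus field_simps)
    finally show ?thesis .
  qed
  then show ?thesis using c by (intro exI[of _ "2 powr (2 * a) / c ^ 6"]) auto
qed

lemma integrable_inverse_one_plus_square: "integrable lborel (\<lambda>x::real. inverse (1 + x\<^sup>2))"
proof -
  have "set_integrable lborel (einterval (-\<infinity>) \<infinity>) (\<lambda>x::real. inverse (1 + x\<^sup>2))"
  proof (rule interval_integral_FTC_nonneg(1)[where F=arctan and A="- (pi / 2)" and B="pi / 2"])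
    show "DERIV arctan x :> inverse (1 + x\<^sup>2)" for x by (rule DERIV_arctan)
    show "isCont (\<lambda>x. inverse (1 + x\<^sup>2)) x" for x :: real
      by (intro continuous_intros) (auto simp: add_nonneg_eq_0_iff)
    show "((arctan \<circ> real_of_ereal) \<longlongrightarrow> - (pi / 2)) (at_right (-\<infinity>))"
      using tendsto_arctan_at_bot by (simp add: ereal_tendsto_simps)
    show "((arctan \<circ> real_of_ereal) \<longlongrightarrow> pi / 2) (at_left \<infinity>)"
      using tendsto_arctan_at_top by (simp add: ereal_tendsto_simps)
  qed auto
  then show ?thesis by (simp add: set_integrable_def einterval_def)
qed

lemma integrable_square_of_sech_powr_bound:
  fixes f :: "real \<Rightarrow> real"
  assumes a: "0 < a" "a < 1" and c: "continuous_on UNIV f"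
    and b: "\<And>y. \<bar>f y\<bar> \<le> C * (1 + y\<^sup>2) * cosh y powr (- a)"
  shows "integrable lborel (\<lambda>y. (f y)\<^sup>2)"
proof -
  obtain K where K: "K > 0" "\<And>y. (1 + y\<^sup>2) ^ 3 * (cosh y powr (- a))\<^sup>2 \<le> K"
    using sech_powr_decay[OF a] by blast
  show ?thesis
  proof (rule Bochner_Integration.integrable_bound)
    show "integrable lborel (\<lambda>y::real. C\<^sup>2 * K * inverse (1 + y\<^sup>2))"
      by (intro integrable_mult_right integrable_inverse_one_plus_square)
    have "(f y)\<^sup>2 \<le> C\<^sup>2 * K * inverse (1 + y\<^sup>2)" for y
    proof -
      have p: "0 < 1 + y\<^sup>2" by (simp add: add_pos_nonneg)
      have "(f y)\<^sup>2 \<le> (C * (1 + y\<^sup>2) * cosh y powr (- a))\<^sup>2"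
        using b[of y] by (simp add: abs_le_square_iff[symmetric])
      also have "\<dots> = C\<^sup>2 * ((1 + y\<^sup>2) ^ 3 * (cosh y powr (- a))\<^sup>2) * inverse (1 + y\<^sup>2)"
        using p by (simp add: power2_eq_square power3_eq_cube field_simps)
      also have "\<dots> \<le> C\<^sup>2 * K * inverse (1 + y\<^sup>2)"
        using p K by (intro mult_right_mono mult_left_mono) auto
      finally show ?thesis .
    qed
    then show "AE y in lborel. norm ((f y)\<^sup>2) \<le> norm (C\<^sup>2 * K * inverse (1 + y\<^sup>2))"
      using K by (auto intro: order_trans[OF _ abs_ge_self])
    show "(\<lambda>y. (f y)\<^sup>2) \<in> borel_measurable lborel"
      using c by (auto intro!: borel_measurable_continuous_onI continuous_intros)
  qed
qed

locale sech_ground_state =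
  fixes a :: real
  assumes a: "0 < a" "a < 1/2"
begin

abbreviation Q :: "real \<Rightarrow> real" where "Q y \<equiv> cosh y powr (- a)"
abbreviation t :: "real \<Rightarrow> real" where "t \<equiv> tanh"

lemma dQ: "(Q has_real_derivative - a * t y * Q y) (at y)"
  by (auto intro!: derivative_eq_intros simp: tanh_def powr_diff field_simps)

lemma dQ':
  "(f has_real_derivative f') (at y) \<Longrightarrow> ((\<lambda>y. f y * Q y) has_real_derivative (f' - a * t y * f y) * Q y) (at y)"
  by (rule DERIV_cong[OF DERIV_mult[OF _ dQ]]) (auto simp: algebra_simps)

text \<open>
  As \<open>sech\<^sup>2 = 1 - tanh\<^sup>2\<close>, the functions \<open>(c\<^sub>0(tanh) + c\<^sub>1(tanh) y + c\<^sub>2(tanh) y\<^sup>2) Q\<close> with polynomials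
  \<open>c\<^sub>i\<close> are closed under differentiation.
\<close>

definition poly_Q :: "real poly \<Rightarrow> real poly \<Rightarrow> real poly \<Rightarrow> real \<Rightarrow> real" where
  "poly_Q c0 c1 c2 y = (poly c0 (t y) + poly c1 (t y) * y + poly c2 (t y) * y\<^sup>2) * Q y"

text \<open>In the variable \<open>t = tanh y\<close> differentiation is
  \<open>(1 - t\<^sup>2) d/dt\<close>, and \<open>Q' = - a t Q\<close>.\<close>

definition deriv_coeff :: "real poly \<Rightarrow> real poly" where
  "deriv_coeff c = [:1, 0, - 1:] * pderiv c - smult a (pCons 0 c)"

lemma poly_Q_deriv:
  "(poly_Q c0 c1 c2 has_real_derivative
     poly_Q (deriv_coeff c0 + c1) (deriv_coeff c1 + smult 2 c2) (deriv_coeff c2) y) (at y)"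
proof -
  have p: "((\<lambda>y. poly c (t y)) has_real_derivative poly (pderiv c) (t y) * sech2 y) (at y)" for c
    by (rule DERIV_chain2[OF poly_DERIV has_real_derivative_tanh_sech2])
  have "((\<lambda>y. poly c0 (t y) + poly c1 (t y) * y + poly c2 (t y) * y\<^sup>2) has_real_derivative
     poly (pderiv c0) (t y) * sech2 y + (poly (pderiv c1) (t y) * sech2 y * y + poly c1 (t y))
     + (poly (pderiv c2) (t y) * sech2 y * y\<^sup>2 + poly c2 (t y) * (2 * y))) (at y)"
    by (auto intro!: derivative_eq_intros p simp: sech2_def)
  from dQ'[OF this] show ?thesis
    unfolding poly_Q_def[abs_def]
    by (rule DERIV_cong) (simp add: deriv_coeff_def sech2_def algebra_simps power2_eq_square)
qed

lemma poly_Q_continuous: "continuous_on UNIV (poly_Q c0 c1 c2)"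
  by (rule DERIV_continuous_on) (rule has_field_derivative_at_within[OF poly_Q_deriv])

lemma poly_tanh_bounded: "\<exists>C. \<forall>y. \<bar>poly c (t y)\<bar> \<le> C"
proof -
  have "compact (poly c ` {-1..1})" by (intro compact_continuous_image continuous_on_poly) auto
  then obtain C where "\<And>x. x \<in> {-1..1} \<Longrightarrow> norm (poly c x) \<le> C"
    using compact_imp_bounded bounded_iff by (metis (no_types, lifting) imageI)
  then show ?thesis using tanh_real_bounds by (intro exI[of _ C]) (auto simp: less_imp_le)
qed

lemma poly_Q_square_integrable: "integrable lborel (\<lambda>y. (poly_Q c0 c1 c2 y)\<^sup>2)"
proof -
  obtain C0 C1 C2 where b: "\<And>y. \<bar>poly c0 (t y)\<bar> \<le> C0" "\<And>y. \<bar>poly c1 (t y)\<bar> \<le> C1"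
    "\<And>y. \<bar>poly c2 (t y)\<bar> \<le> C2" using poly_tanh_bounded by meson
  show ?thesis
  proof (rule integrable_square_of_sech_powr_bound[where a=a and C="C0 + C1 + C2"])
    fix y :: real
    let ?f = "poly c0 (t y) + poly c1 (t y) * y + poly c2 (t y) * y\<^sup>2"
    have "0 \<le> (\<bar>y\<bar> - 1)\<^sup>2" by simp
    then have y: "\<bar>y\<bar> \<le> 1 + y\<^sup>2" using abs_ge_zero[of y]
      by (simp add: power2_eq_square algebra_simps)
    have C: "0 \<le> C0" "0 \<le> C1" "0 \<le> C2" using b[of 0] by linarith+
    have "\<bar>poly c0 (t y)\<bar> * 1 \<le> C0 * (1 + y\<^sup>2)" by (rule mult_mono) (use b C in auto)
    moreover have "\<bar>poly c1 (t y)\<bar> * \<bar>y\<bar> \<le> C1 * (1 + y\<^sup>2)" by (rule mult_mono) (use b C y in auto)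
    moreover have "\<bar>poly c2 (t y)\<bar> * \<bar>y\<^sup>2\<bar> \<le> C2 * (1 + y\<^sup>2)" by (rule mult_mono) (use b C in auto)
    ultimately have "\<bar>?f\<bar> \<le> (C0 + C1 + C2) * (1 + y\<^sup>2)"
      unfolding abs_mult[symmetric] distrib_right by linarith
    then have "\<bar>?f\<bar> * Q y \<le> (C0 + C1 + C2) * (1 + y\<^sup>2) * Q y"
      by (intro mult_right_mono) auto
    then show "\<bar>poly_Q c0 c1 c2 y\<bar> \<le> (C0 + C1 + C2) * (1 + y\<^sup>2) * Q y"
      by (simp add: poly_Q_def abs_mult)
  qed (use a poly_Q_continuous in auto)
qed

lemma sobolev2_poly_Q:
  obtains f' f'' where "sobolev2 (poly_Q c0 c1 c2) f' f''"
    "f' = poly_Q (deriv_coeff c0 + c1) (deriv_coeff c1 + smult 2 c2) (deriv_coeff c2)"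
    "f'' = poly_Q (deriv_coeff (deriv_coeff c0 + c1) + (deriv_coeff c1 + smult 2 c2))
      (deriv_coeff (deriv_coeff c1 + smult 2 c2) + smult 2 (deriv_coeff c2)) (deriv_coeff (deriv_coeff c2))"
proof (rule that)
  show "sobolev2 (poly_Q c0 c1 c2)
    (poly_Q (deriv_coeff c0 + c1) (deriv_coeff c1 + smult 2 c2) (deriv_coeff c2))
    (poly_Q (deriv_coeff (deriv_coeff c0 + c1) + (deriv_coeff c1 + smult 2 c2))
      (deriv_coeff (deriv_coeff c1 + smult 2 c2) + smult 2 (deriv_coeff c2)) (deriv_coeff (deriv_coeff c2)))"
    unfolding sobolev2_def
    by (intro conjI allI poly_Q_deriv poly_Q_continuous poly_Q_square_integrable)
qed auto

text \<open>\<open>A\<^sub>- (y Q) = - 2 Q'\<close> since \<open>A\<^sub>- Q = 0\<close>, and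
  \<open>A\<^sub>+ Q' = 0\<close> by translation invariance of the soliton equation. So one of the
  two terms of the form vanishes.\<close>

lemma odd_direction:
  obtains m' m'' n' n'' where
    "sobolev2 (poly_Q 0 1 0) m' m''" "sobolev2 (poly_Q [:0, 2 * a:] 0 0) n' n''"
    "schroedinger (a\<^sup>2) (a * (a + 1)) (poly_Q 0 1 0) m'' = poly_Q [:0, 2 * a:] 0 0"
    "schroedinger (a\<^sup>2) ((a + 1) * (a + 2)) (poly_Q [:0, 2 * a:] 0 0) n'' = (\<lambda>_. 0)"
proof -
  obtain m' m'' where m: "sobolev2 (poly_Q 0 1 0) m' m''"
    "m'' = poly_Q (deriv_coeff (deriv_coeff 0 + 1) + (deriv_coeff 1 + smult 2 0))
      (deriv_coeff (deriv_coeff 1 + smult 2 0) + smult 2 (deriv_coeff 0)) (deriv_coeff (deriv_coeff 0))"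
    by (rule sobolev2_poly_Q)
  obtain n' n'' where n: "sobolev2 (poly_Q [:0, 2 * a:] 0 0) n' n''"
    "n'' = poly_Q (deriv_coeff (deriv_coeff [:0, 2 * a:] + 0) + (deriv_coeff 0 + smult 2 0))
      (deriv_coeff (deriv_coeff 0 + smult 2 0) + smult 2 (deriv_coeff 0)) (deriv_coeff (deriv_coeff 0))"
    by (rule sobolev2_poly_Q)
  show ?thesis
  proof (rule that[OF m(1) n(1)])
    show "schroedinger (a\<^sup>2) (a * (a + 1)) (poly_Q 0 1 0) m'' = poly_Q [:0, 2 * a:] 0 0"
      unfolding m(2) schroedinger_def fun_eq_iff
      by (simp add: poly_Q_def deriv_coeff_def pderiv_pCons sech2_def algebra_simps power2_eq_square)
    show "schroedinger (a\<^sup>2) ((a + 1) * (a + 2)) (poly_Q [:0, 2 * a:] 0 0) n'' = (\<lambda>_. 0)"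
      unfolding n(2) schroedinger_def fun_eq_iff
      by (simp add: poly_Q_def deriv_coeff_def pderiv_pCons sech2_def algebra_simps power2_eq_square)
  qed
qed

text \<open>\<open>A\<^sub>- (y\<^sup>2 Q) = - 2 Q - 4 y Q'\<close>, which is
  \<open>- 4 (a Q + y Q') - 2 (1 - 2 a) Q\<close>. On the scaling mode
  \<open>A\<^sub>+ (a Q + y Q') = - 2 a\<^sup>2 Q\<close>, and
  \<open>A\<^sub>+ Q = - 2 (a + 1) sech\<^sup>2 Q\<close>; this is the origin of both
  coefficients.\<close>

lemma even_direction:
  obtains m' m'' n' n'' where
    "sobolev2 (poly_Q 0 0 1) m' m''" "sobolev2 (poly_Q [:-2:] [:0, 4 * a:] 0) n' n''"
    "schroedinger (a\<^sup>2) (a * (a + 1)) (poly_Q 0 0 1) m'' = poly_Q [:-2:] [:0, 4 * a:] 0"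
    "schroedinger (a\<^sup>2) ((a + 1) * (a + 2)) (poly_Q [:-2:] [:0, 4 * a:] 0) n'' =
       (\<lambda>y. (8 * a\<^sup>2 + 4 * (a + 1) * (1 - 2 * a) * sech2 y) * Q y)"
proof -
  obtain m' m'' where m: "sobolev2 (poly_Q 0 0 1) m' m''"
    "m'' = poly_Q (deriv_coeff (deriv_coeff 0 + 0) + (deriv_coeff 0 + smult 2 1))
      (deriv_coeff (deriv_coeff 0 + smult 2 1) + smult 2 (deriv_coeff 1)) (deriv_coeff (deriv_coeff 1))"
    by (rule sobolev2_poly_Q)
  obtain n' n'' where n: "sobolev2 (poly_Q [:-2:] [:0, 4 * a:] 0) n' n''"
    "n'' = poly_Q (deriv_coeff (deriv_coeff [:-2:] + [:0, 4 * a:]) + (deriv_coeff [:0, 4 * a:] + smult 2 0))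
      (deriv_coeff (deriv_coeff [:0, 4 * a:] + smult 2 0) + smult 2 (deriv_coeff 0)) (deriv_coeff (deriv_coeff 0))"
    by (rule sobolev2_poly_Q)
  show ?thesis
  proof (rule that[OF m(1) n(1)])
    show "schroedinger (a\<^sup>2) (a * (a + 1)) (poly_Q 0 0 1) m'' = poly_Q [:-2:] [:0, 4 * a:] 0"
      unfolding m(2) schroedinger_def fun_eq_iff
      by (simp add: poly_Q_def deriv_coeff_def pderiv_pCons sech2_def algebra_simps power2_eq_square)
    show "schroedinger (a\<^sup>2) ((a + 1) * (a + 2)) (poly_Q [:-2:] [:0, 4 * a:] 0) n'' =
       (\<lambda>y. (8 * a\<^sup>2 + 4 * (a + 1) * (1 - 2 * a) * sech2 y) * Q y)"
      unfolding n(2) schroedinger_def fun_eq_iff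
      by (simp add: poly_Q_def deriv_coeff_def pderiv_pCons sech2_def algebra_simps power2_eq_square)
  qed
qed

text \<open>Let \<open>n\<close> be the first factor of both integrands;
  \<open>n Q = - 2 (y Q\<^sup>2)'\<close>. Integration by parts moves the derivative onto
  \<open>8 a\<^sup>2 + \<kappa> sech\<^sup>2\<close>, whose derivative has the sign opposite to
  \<open>y\<close> as soon as \<open>\<kappa> \<ge> 0\<close>, that is for
  \<open>a \<le> 1/2\<close>. Likewise the second integrand is a derivative plus
  \<open>4 y\<^sup>2 Q\<^sup>2\<close>.\<close>

lemma even_direction_integrals:
  shows "(LBINT y. poly_Q [:-2:] [:0, 4 * a:] 0 y * ((8 * a\<^sup>2 + 4 * (a + 1) * (1 - 2 * a) * sech2 y) * Q y)) \<le> 0"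
    and "0 < (LBINT y. poly_Q [:-2:] [:0, 4 * a:] 0 y * poly_Q 0 0 1 y)"
proof -
  define \<kappa> where "\<kappa> = 4 * (a + 1) * (1 - 2 * a)"
  \<comment> \<open>As a polynomial in \<open>tanh\<close> this is
    \<open>- 2 (8 a\<^sup>2 + \<kappa> sech\<^sup>2)\<close>; the boundary term of the integration
    by parts is \<open>c y Q\<^sup>2\<close>.\<close>
  define c where "c = [: - 16 * a\<^sup>2 - 2 * \<kappa>, 0, 2 * \<kappa> :]"
  obtain f' f'' where f: "sobolev2 (poly_Q 0 c 0) f' f''"
    "f' = poly_Q (deriv_coeff 0 + c) (deriv_coeff c + smult 2 0) (deriv_coeff 0)"
    by (rule sobolev2_poly_Q)
  obtain g' g'' where g: "sobolev2 (poly_Q 1 0 0) g' g''"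
    "g' = poly_Q (deriv_coeff 1 + 0) (deriv_coeff 0 + smult 2 0) (deriv_coeff 0)"
    by (rule sobolev2_poly_Q)
  obtain e' e'' where e: "sobolev2 (poly_Q 0 [:0, 1:] 0) e' e''" by (rule sobolev2_poly_Q)
  let ?w = "\<lambda>y. sech2 y * (poly_Q 0 [:0, 1:] 0 y * poly_Q 1 0 0 y)"
  have iw: "integrable lborel ?w"
    by (intro integrable_sech2_mult sobolev2_integrable_mult[OF e g(1)])
  have "(\<lambda>y. poly_Q [:-2:] [:0, 4 * a:] 0 y * ((8 * a\<^sup>2 + \<kappa> * sech2 y) * Q y)) =
      (\<lambda>y. (poly_Q 0 c 0 y * g' y + f' y * poly_Q 1 0 0 y) - 4 * \<kappa> * ?w y)"
    unfolding f g fun_eq_iff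
    by (simp add: poly_Q_def deriv_coeff_def pderiv_pCons c_def sech2_def algebra_simps power2_eq_square)
  moreover have "(LBINT y. (poly_Q 0 c 0 y * g' y + f' y * poly_Q 1 0 0 y) - 4 * \<kappa> * ?w y)
      = - 4 * \<kappa> * (LBINT y. ?w y)"
    using sobolev2_integral_deriv_mult[OF f(1) g(1)] iw
    by (subst Bochner_Integration.integral_diff) auto
  moreover have "0 \<le> ?w y" for y
  proof -
    have "?w y = sech2 y * ((t y * y) * (Q y)\<^sup>2)" by (simp add: poly_Q_def power2_eq_square)
    then show ?thesis using sech2_pos[of y] tanh_mult_self_nonneg[of y] by simp
  qed
  then have "0 \<le> (LBINT y. ?w y)" by (intro Bochner_Integration.integral_nonneg)
  moreover have "0 \<le> \<kappa>" using a by (simp add: \<kappa>_def)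
  ultimately show "(LBINT y. poly_Q [:-2:] [:0, 4 * a:] 0 y *
      ((8 * a\<^sup>2 + 4 * (a + 1) * (1 - 2 * a) * sech2 y) * Q y)) \<le> 0"
    unfolding \<kappa>_def[symmetric] by simp
next
  obtain f' f'' where f: "sobolev2 (poly_Q 0 0 1) f' f''"
    "f' = poly_Q (deriv_coeff 0 + 0) (deriv_coeff 0 + smult 2 1) (deriv_coeff 1)"
    by (rule sobolev2_poly_Q)
  obtain g' g'' where g: "sobolev2 (poly_Q 0 [:-2:] 0) g' g''"
    "g' = poly_Q (deriv_coeff 0 + [:-2:]) (deriv_coeff [:-2:] + smult 2 0) (deriv_coeff 0)"
    by (rule sobolev2_poly_Q)
  have iy: "integrable lborel (\<lambda>y. (poly_Q 0 1 0 y)\<^sup>2)" by (rule poly_Q_square_integrable)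
  have "(\<lambda>y. poly_Q [:-2:] [:0, 4 * a:] 0 y * poly_Q 0 0 1 y) =
      (\<lambda>y. (poly_Q 0 0 1 y * g' y + f' y * poly_Q 0 [:-2:] 0 y) + 4 * (poly_Q 0 1 0 y)\<^sup>2)"
    unfolding f g fun_eq_iff
    by (simp add: poly_Q_def deriv_coeff_def pderiv_pCons algebra_simps power2_eq_square)
  moreover have "(LBINT y. (poly_Q 0 0 1 y * g' y + f' y * poly_Q 0 [:-2:] 0 y) + 4 * (poly_Q 0 1 0 y)\<^sup>2)
      = 4 * (LBINT y. (poly_Q 0 1 0 y)\<^sup>2)"
    using sobolev2_integral_deriv_mult[OF f(1) g(1)] iy
    by (subst Bochner_Integration.integral_add) auto
  moreover have "0 < (LBINT y. (poly_Q 0 1 0 y)\<^sup>2)"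
  proof (rule ccontr)
    assume "\<not> ?thesis"
    then have "(poly_Q 0 1 0 1)\<^sup>2 = 0"
      by (intro continuous_integral_eq_0_imp[where f="\<lambda>y. (poly_Q 0 1 0 y)\<^sup>2"] iy)
        (auto intro!: continuous_intros poly_Q_continuous)
    then show False by (simp add: poly_Q_def)
  qed
  ultimately show "0 < (LBINT y. poly_Q [:-2:] [:0, 4 * a:] 0 y * poly_Q 0 0 1 y)" by simp
qed

lemma odd_direction_integral: "0 < (LBINT y. poly_Q [:0, 2 * a:] 0 0 y * poly_Q 0 1 0 y)"
proof (rule ccontr)
  assume "\<not> ?thesis"
  moreover have "0 \<le> poly_Q [:0, 2 * a:] 0 0 y * poly_Q 0 1 0 y" for y
  proof -
    have "poly_Q [:0, 2 * a:] 0 0 y * poly_Q 0 1 0 y = 2 * a * ((t y * y) * (Q y)\<^sup>2)"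
      by (simp add: poly_Q_def power2_eq_square)
    then show ?thesis using a tanh_mult_self_nonneg[of y] by simp
  qed
  moreover have "integrable lborel (\<lambda>y. poly_Q [:0, 2 * a:] 0 0 y * poly_Q 0 1 0 y)"
    using sobolev2_poly_Q sobolev2_integrable_mult(1) by metis
  ultimately have "poly_Q [:0, 2 * a:] 0 0 1 * poly_Q 0 1 0 1 = 0"
    by (intro continuous_integral_eq_0_imp[where f="\<lambda>y. poly_Q [:0, 2 * a:] 0 0 y * poly_Q 0 1 0 y"])
      (auto intro!: continuous_intros poly_Q_continuous)
  then show False using a by (simp add: poly_Q_def)
qed

lemma no_gap_eigenfunction:
  assumes \<mu>: "0 < \<mu>" "\<mu> \<le> a\<^sup>2"
    and v: "sobolev2 v v' v''" and u: "sobolev2 u u' u''"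
    and eqv: "schroedinger (a\<^sup>2) (a * (a + 1)) v v'' = (\<lambda>y. \<mu> * u y)"
    and equ: "schroedinger (a\<^sup>2) ((a + 1) * (a + 2)) u u'' = (\<lambda>y. \<mu> * v y)"
    and parity: "\<epsilon> = 1 \<or> \<epsilon> = - 1" "\<And>y. u (- y) = \<epsilon> * u y"
  shows "u y = 0"
  using parity(1)
proof
  assume e: "\<epsilon> = 1"
  obtain m' m'' n' n'' where
    mn: "sobolev2 (poly_Q 0 0 1) m' m''" "sobolev2 (poly_Q [:-2:] [:0, 4 * a:] 0) n' n''"
    "schroedinger (a\<^sup>2) (a * (a + 1)) (poly_Q 0 0 1) m'' = poly_Q [:-2:] [:0, 4 * a:] 0"
    "schroedinger (a\<^sup>2) ((a + 1) * (a + 2)) (poly_Q [:-2:] [:0, 4 * a:] 0) n'' =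
       (\<lambda>y. (8 * a\<^sup>2 + 4 * (a + 1) * (1 - 2 * a) * sech2 y) * Q y)"
    by (rule even_direction)
  show ?thesis
  proof (rule no_gap_eigenfunction_of_direction[OF _ _ \<mu> v u mn(1,2) eqv equ mn(3), where \<epsilon>=\<epsilon>])
    show "poly_Q [:-2:] [:0, 4 * a:] 0 (- y) = \<epsilon> * poly_Q [:-2:] [:0, 4 * a:] 0 y" for y
      by (simp add: poly_Q_def e)
  qed (use a parity mn(4) even_direction_integrals in auto)
next
  assume e: "\<epsilon> = - 1"
  obtain m' m'' n' n'' where
    mn: "sobolev2 (poly_Q 0 1 0) m' m''" "sobolev2 (poly_Q [:0, 2 * a:] 0 0) n' n''"
    "schroedinger (a\<^sup>2) (a * (a + 1)) (poly_Q 0 1 0) m'' = poly_Q [:0, 2 * a:] 0 0"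
    "schroedinger (a\<^sup>2) ((a + 1) * (a + 2)) (poly_Q [:0, 2 * a:] 0 0) n'' = (\<lambda>_. 0)"
    by (rule odd_direction)
  show ?thesis
  proof (rule no_gap_eigenfunction_of_direction[OF _ _ \<mu> v u mn(1,2) eqv equ mn(3), where \<epsilon>=\<epsilon>])
    show "poly_Q [:0, 2 * a:] 0 0 (- y) = \<epsilon> * poly_Q [:0, 2 * a:] 0 0 y" for y
      by (simp add: poly_Q_def e)
  qed (use a parity mn(4) odd_direction_integral in auto)
qed

end

section \<open>Embedded eigenvalues\<close>

lemma sech2_mono: "0 \<le> x \<Longrightarrow> x \<le> y \<Longrightarrow> sech2 y \<le> sech2 x"
  unfolding sech2_def by (auto intro!: power_mono)

lemma attains_sup_of_decaying:
  fixes \<phi> :: "real \<Rightarrow> real"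
  assumes c: "continuous_on {y1..} \<phi>" and nn: "\<And>y. y \<ge> y1 \<Longrightarrow> 0 \<le> \<phi> y"
    and lim: "(\<phi> \<longlongrightarrow> 0) at_top"
  obtains x where "x \<ge> y1" "\<And>y. y \<ge> y1 \<Longrightarrow> \<phi> y \<le> \<phi> x"
proof (cases "\<exists>y2\<ge>y1. 0 < \<phi> y2")
  case False
  then have "\<phi> y = 0" if "y \<ge> y1" for y using nn[OF that] that by (meson not_less order_antisym)
  then show ?thesis using that[of y1] by simp
next
  case True
  then obtain y2 where y2: "y2 \<ge> y1" "0 < \<phi> y2" by blast
  have "\<forall>\<^sub>F y in at_top. \<phi> y < \<phi> y2" by (rule order_tendstoD(2)[OF lim y2(2)])
  then obtain T where T: "\<And>y. y \<ge> T \<Longrightarrow> \<phi> y < \<phi> y2" by (auto simp: eventually_at_top_linorder)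
  have "\<exists>x\<in>{y1..max T y2}. \<forall>y\<in>{y1..max T y2}. \<phi> y \<le> \<phi> x"
    by (rule continuous_attains_sup) (use y2 in \<open>auto intro: continuous_on_subset[OF c]\<close>)
  then obtain x where x: "x \<ge> y1" "\<And>y. y \<ge> y1 \<Longrightarrow> y \<le> max T y2 \<Longrightarrow> \<phi> y \<le> \<phi> x" by auto
  show ?thesis
  proof (rule that[OF x(1)])
    fix y assume "y \<ge> y1"
    show "\<phi> y \<le> \<phi> x"
    proof (cases "y \<le> max T y2")
      case False
      then have "\<phi> y < \<phi> y2" by (intro T) auto
      also have "\<phi> y2 \<le> \<phi> x" by (rule x(2)) (use y2 in auto)
      finally show ?thesis by simp
    qed (use x \<open>y \<ge> y1\<close> in auto)
  qed
qed

lemma local_max_second_deriv: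
  fixes g :: "real \<Rightarrow> real"
  assumes d: "\<And>y. y > y1 \<Longrightarrow> (g has_real_derivative g' y) (at y)"
    and d2: "(g' has_real_derivative D) (at x)" and x: "x > y1"
    and max: "\<And>y. y > y1 \<Longrightarrow> g y \<le> g x"
  shows "D \<le> 0"
proof (rule ccontr)
  assume "\<not> ?thesis"
  then have D: "D > 0" by simp
  have g0: "g' x = 0"
    by (rule DERIV_local_max[OF d[OF x], of "x - y1"]) (use x max in auto)
  obtain e where e: "e > 0" "\<And>h. 0 < h \<Longrightarrow> h < e \<Longrightarrow> g' x < g' (x + h)"
    using DERIV_pos_inc_right[OF d2 D] by blast
  have "g x < g (x + e/2)"
  proof (rule DERIV_pos_imp_increasing_open[where f=g])
    show "continuous_on {x..x + e/2} g"
      by (rule continuous_on_of_DERIV, rule d) (use x in auto)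
    fix w assume "x < w" "w < x + e/2"
    then show "\<exists>l. (g has_real_derivative l) (at w) \<and> 0 < l"
      using d[of w] e(2)[of "w - x"] g0 x e(1) by (intro exI[of _ "g' w"]) auto
  qed (use e in auto)
  then show False using max[of "x + e/2"] x e by simp
qed

locale coupled_system =
  fixes b \<kappa> \<rho> :: real
  assumes b: "b > 0" and \<kappa>: "\<kappa> > 0" and \<rho>: "\<rho> > 0"
begin

text \<open>The equations for \<open>f = v + u\<close> and \<open>g = v - u\<close> with
  \<open>\<kappa> = \<mu> - a\<^sup>2\<close>, \<open>\<rho>\<^sup>2 = \<mu> + a\<^sup>2\<close> and
  \<open>b = a + 1\<close>. At infinity they decouple into an oscillator for \<open>f\<close> and an
  exponential equation for \<open>g\<close>. Only \<open>y > 0\<close> is asked for, because the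
  Frobenius series need not converge at the origin.\<close>

definition solves :: "(real \<Rightarrow> real) \<Rightarrow> (real \<Rightarrow> real) \<Rightarrow> (real \<Rightarrow> real) \<Rightarrow> (real \<Rightarrow> real) \<Rightarrow> bool" where
  "solves f f' g g' \<longleftrightarrow> (\<forall>y>0.
     (f has_real_derivative f' y) (at y) \<and>
     (f' has_real_derivative - \<kappa> * f y - b * sech2 y * (b * f y - g y)) (at y) \<and>
     (g has_real_derivative g' y) (at y) \<and>
     (g' has_real_derivative \<rho>\<^sup>2 * g y - b * sech2 y * (b * g y - f y)) (at y))"

lemma solvesD:
  assumes "solves f f' g g'" "y > 0"
  shows "(f has_real_derivative f' y) (at y)"
     "(f' has_real_derivative - \<kappa> * f y - b * sech2 y * (b * f y - g y)) (at y)"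
     "(g has_real_derivative g' y) (at y)"
     "(g' has_real_derivative \<rho>\<^sup>2 * g y - b * sech2 y * (b * g y - f y)) (at y)"
  using assms unfolding solves_def by blast+

lemma solves_lincomb:
  assumes "solves f1 f1' g1 g1'" "solves f2 f2' g2 g2'"
  shows "solves (\<lambda>y. f1 y - c * f2 y) (\<lambda>y. f1' y - c * f2' y) (\<lambda>y. g1 y - c * g2 y) (\<lambda>y. g1' y - c * g2' y)"
  unfolding solves_def
proof (intro allI impI conjI)
  fix y :: real assume y: "y > 0"
  note d = solvesD[OF assms(1) y] solvesD[OF assms(2) y]
  show "((\<lambda>y. f1 y - c * f2 y) has_real_derivative f1' y - c * f2' y) (at y)"
    "((\<lambda>y. g1 y - c * g2 y) has_real_derivative g1' y - c * g2' y) (at y)"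
    by (intro DERIV_diff DERIV_cmult d)+
  show "((\<lambda>y. f1' y - c * f2' y) has_real_derivative - \<kappa> * (f1 y - c * f2 y)
      - b * sech2 y * (b * (f1 y - c * f2 y) - (g1 y - c * g2 y))) (at y)"
    by (rule DERIV_cong[OF DERIV_diff[OF d(2) DERIV_cmult[OF d(6)]]]) (simp add: algebra_simps)
  show "((\<lambda>y. g1' y - c * g2' y) has_real_derivative \<rho>\<^sup>2 * (g1 y - c * g2 y)
      - b * sech2 y * (b * (g1 y - c * g2 y) - (f1 y - c * f2 y))) (at y)"
    by (rule DERIV_cong[OF DERIV_diff[OF d(4) DERIV_cmult[OF d(8)]]]) (simp add: algebra_simps)
qed

text \<open>
  Near infinity the coupling is a small perturbation: the maximum principle controls \<open>g\<close>, and the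
  energy \<open>f'\<^sup>2 + \<kappa> f\<^sup>2\<close>, corrected by a multiple of \<open>tanh\<close> to make it monotone, controls \<open>f\<close>.
\<close>

lemma decaying_solution_vanishes_near_infinity:
  assumes s: "solves f f' g g'" and y1: "y1 > 0" "g y1 = 0"
    and lim: "(f \<longlongrightarrow> 0) at_top" "(f' \<longlongrightarrow> 0) at_top" "(g \<longlongrightarrow> 0) at_top"
    and small: "b * (b + 1) * sech2 y1 < \<rho>\<^sup>2" "(2 * b * (b + 1) * (1 - tanh y1))\<^sup>2 < \<kappa>"
    and y: "y \<ge> y1"
  shows "f y = 0 \<and> g y = 0"
proof -
  note d = solvesD[OF s]
  have c: "continuous_on {y1..} f" "continuous_on {y1..} f'" "continuous_on {y1..} g"
    by (rule continuous_on_of_DERIV, rule d, use y1 in simp)+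
  define \<phi> where "\<phi> = (\<lambda>y. max \<bar>f y\<bar> \<bar>g y\<bar>)"
  have "(\<phi> \<longlongrightarrow> max \<bar>0\<bar> \<bar>0\<bar>) at_top" unfolding \<phi>_def by (intro tendsto_intros lim)
  then have "(\<phi> \<longlongrightarrow> 0) at_top" by simp
  moreover have "continuous_on {y1..} \<phi>" unfolding \<phi>_def by (intro continuous_intros c)
  moreover have "0 \<le> \<phi> y" for y by (simp add: \<phi>_def)
  ultimately obtain x where x: "x \<ge> y1" "\<And>y. y \<ge> y1 \<Longrightarrow> \<phi> y \<le> \<phi> x"
    using attains_sup_of_decaying[of y1 \<phi>] by blast
  \<comment> \<open>A positive \<open>N\<close> is attained by \<open>\<bar>g\<bar>\<close> or by
    \<open>\<bar>f\<bar>\<close> at \<open>x\<close>. The first alternative fails by the maximum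
    principle and the first smallness assumption, the second by the energy estimate and the second
    one.\<close>
  define N where "N = \<phi> x"
  have fN: "\<bar>f y\<bar> \<le> N" and gN: "\<bar>g y\<bar> \<le> N" if "y \<ge> y1" for y
    using x(2)[OF that] unfolding N_def[symmetric] by (auto simp: \<phi>_def)
  have N0: "N \<ge> 0" unfolding N_def \<phi>_def by simp
  have W: "0 < sech2 y" "sech2 y \<le> sech2 y1" if "y \<ge> y1" for y
    using sech2_pos sech2_mono[OF _ that] y1 by auto
  have "N = 0"
  proof (rule ccontr)
    assume "N \<noteq> 0"
    then have Np: "N > 0" using N0 by simp
    consider (g) "\<bar>g x\<bar> = N" | (f) "\<bar>f x\<bar> = N" unfolding N_def \<phi>_def by linarith
    then show False
    proof cases
      case g
      \<comment> \<open>The normalization \<open>g y1 = 0\<close> keeps the maximum off the boundary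
        point.\<close>
      then have "x \<noteq> y1" using y1 Np by auto
      then have xy: "x > y1" using x by simp
      define r where "r = sgn (g x)"
      have r: "r * g x = N" "\<bar>r\<bar> = 1" using g Np by (auto simp: r_def abs_sgn sgn_if)
      have le: "r * z \<le> \<bar>z\<bar>" for z using r(2) by (metis abs_ge_self abs_mult mult_1)
      have "r * (\<rho>\<^sup>2 * g x - b * sech2 x * (b * g x - f x)) \<le> 0"
      proof (rule local_max_second_deriv[where g="\<lambda>y. r * g y" and g'="\<lambda>y. r * g' y"])
        show "((\<lambda>y. r * g y) has_real_derivative r * g' y) (at y)" if "y > y1" for y
          by (intro DERIV_cmult d) (use that y1 in auto)
        show "((\<lambda>y. r * g' y) has_real_derivative r * (\<rho>\<^sup>2 * g x - b * sech2 x * (b * g x - f x))) (at x)"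
          by (intro DERIV_cmult d) (use xy y1 in auto)
        show "r * g y \<le> r * g x" if "y > y1" for y
          using le[of "g y"] gN[of y] that unfolding r(1) by simp
      qed (rule xy)
      moreover have "r * (\<rho>\<^sup>2 * g x - b * sech2 x * (b * g x - f x)) =
          \<rho>\<^sup>2 * N - b * sech2 x * (b * N - r * f x)"
        unfolding r(1)[symmetric] by (simp add: algebra_simps)
      moreover have "b * sech2 x * (b * N - r * f x) \<le> b * sech2 x * ((b + 1) * N)"
      proof (rule mult_left_mono)
        have "- (r * f x) \<le> N" using le[of "- f x"] fN[OF x(1)] by simp
        then show "b * N - r * f x \<le> (b + 1) * N" by (simp add: algebra_simps)
      qed (use b W[OF x(1)] in auto)
      moreover have "b * sech2 x * ((b + 1) * N) \<le> b * sech2 y1 * ((b + 1) * N)"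
        using b W[OF x(1)] Np by (intro mult_right_mono mult_left_mono) auto
      moreover have "b * sech2 y1 * ((b + 1) * N) < \<rho>\<^sup>2 * N"
        using mult_strict_right_mono[OF small(1) Np] by (simp add: mult_ac)
      ultimately show False by linarith
    next
      case f
      define E where "E = (\<lambda>y. (f' y)\<^sup>2 + \<kappa> * (f y)\<^sup>2)"
      have Enn: "0 \<le> E y" for y using \<kappa> by (simp add: E_def)
      have "(E \<longlongrightarrow> 0\<^sup>2 + \<kappa> * 0\<^sup>2) at_top" unfolding E_def by (intro tendsto_intros lim)
      then have E0: "(E \<longlongrightarrow> 0) at_top" by simp
      moreover have cE: "continuous_on {y1..} E" unfolding E_def by (intro continuous_intros c)
      ultimately obtain w where w: "w \<ge> y1" "\<And>y. y \<ge> y1 \<Longrightarrow> E y \<le> E w"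
        using attains_sup_of_decaying[of y1 E] Enn by blast
      define e where "e = sqrt (E w)"
      have e: "e \<ge> 0" "e\<^sup>2 = E w" using Enn by (auto simp: e_def)
      have f'e: "\<bar>f' y\<bar> \<le> e" if "y \<ge> y1" for y
      proof (rule abs_le_square_iff[THEN iffD2, of _ e, simplified abs_of_nonneg[OF e(1)]])
        have "(f' y)\<^sup>2 \<le> E y" using \<kappa> by (simp add: E_def)
        then show "(f' y)\<^sup>2 \<le> e\<^sup>2" using w(2)[OF that] e by simp
      qed
      \<comment> \<open>The coupling contributes at most
        \<open>2 * e * b * sech2 y * (b + 1) * N\<close> to the derivative of the energy; adding
        \<open>K * tanh\<close> compensates this exactly, as \<open>tanh' = sech2\<close>.\<close>
      define K where "K = 2 * e * b * (b + 1) * N"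
      have K: "K \<ge> 0" using e b Np by (simp add: K_def)
      have dE: "((\<lambda>y. E y + K * tanh y) has_real_derivative
          2 * f' y * (- b * sech2 y * (b * f y - g y)) + K * sech2 y) (at y)" if "y > 0" for y
        unfolding E_def
        by (rule derivative_eq_intros d[OF that] has_real_derivative_tanh_sech2 refl)+ (simp add: algebra_simps)
      have mono: "E u + K * tanh u \<le> E v + K * tanh v" if uv: "y1 \<le> u" "u \<le> v" for u v
      proof (rule DERIV_nonneg_imp_nondecreasing[OF uv(2)])
        fix y assume "u \<le> y" "y \<le> v"
        then have y: "y \<ge> y1" "y > 0" using uv y1 by auto
        have "\<bar>b * f y - g y\<bar> \<le> b * N + N"
        proof -
          have "b * \<bar>f y\<bar> \<le> b * N" by (rule mult_left_mono) (use fN[OF y(1)] b in auto)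
          moreover have "\<bar>b * f y - g y\<bar> \<le> b * \<bar>f y\<bar> + \<bar>g y\<bar>"
            using abs_triangle_ineq4[of "b * f y" "g y"] b by (simp add: abs_mult)
          ultimately show ?thesis using gN[OF y(1)] by linarith
        qed
        then have "\<bar>f' y\<bar> * \<bar>b * f y - g y\<bar> \<le> e * (b * N + N)"
          using f'e[OF y(1)] e by (intro mult_mono) auto
        then have "2 * (b * sech2 y) * (\<bar>f' y\<bar> * \<bar>b * f y - g y\<bar>) \<le> 2 * (b * sech2 y) * (e * (b * N + N))"
          using b W[OF y(1)] by (intro mult_left_mono) auto
        moreover have "\<bar>2 * f' y * (- b * sech2 y * (b * f y - g y))\<bar>
            = 2 * (b * sech2 y) * (\<bar>f' y\<bar> * \<bar>b * f y - g y\<bar>)"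
          using b W[OF y(1)] by (simp add: abs_mult)
        ultimately have "0 \<le> 2 * f' y * (- b * sech2 y * (b * f y - g y)) + K * sech2 y"
          by (simp add: K_def algebra_simps)
        then show "\<exists>D. ((\<lambda>y. E y + K * tanh y) has_real_derivative D) (at y) \<and> 0 \<le> D"
          using dE[OF y(2)] by blast
      qed
      have El: "E u \<le> K * (1 - tanh y1)" if u: "u \<ge> y1" for u
      proof -
        have "((\<lambda>v. E v + K * tanh v) \<longlongrightarrow> 0 + K * 1) at_top"
          by (intro tendsto_intros E0 tanh_real_at_top)
        then have "E u + K * tanh u \<le> 0 + K * 1"
          by (rule tendsto_lowerbound) (use mono[OF u] in \<open>auto intro: eventually_mono[OF eventually_ge_at_top[of u]]\<close>)
        moreover have "K * tanh y1 \<le> K * tanh u" using K u by (intro mult_left_mono) auto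
        ultimately show ?thesis by (simp add: algebra_simps)
      qed
      define \<delta> where "\<delta> = 1 - tanh y1"
      have \<delta>: "\<delta> \<ge> 0" using tanh_real_lt_1[of y1] by (simp add: \<delta>_def)
      \<comment> \<open>\<open>K\<close> itself carries the factor \<open>e\<close>, so one power
        cancels and the supremum of the energy is bounded by a small multiple of
        \<open>N\<^sup>2\<close>.\<close>
      have "e * e \<le> e * (2 * b * (b + 1) * \<delta> * N)"
        using El[OF w(1)] e(2) by (simp add: K_def \<delta>_def power2_eq_square mult_ac)
      then have "e \<le> 2 * b * (b + 1) * \<delta> * N"
        using e(1) b \<delta> Np by (cases "e = 0") auto
      then have "e\<^sup>2 \<le> (2 * b * (b + 1) * \<delta> * N)\<^sup>2" using e by (intro power_mono)
      also have "\<dots> = (2 * b * (b + 1) * \<delta>)\<^sup>2 * N\<^sup>2" by (simp add: power_mult_distrib)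
      also have "\<dots> < \<kappa> * N\<^sup>2" using small(2) Np unfolding \<delta>_def by (intro mult_strict_right_mono) auto
      also have "\<kappa> * N\<^sup>2 \<le> E x" using f unfolding E_def by (simp flip: f)
      also have "\<dots> \<le> e\<^sup>2" using w(2)[OF x(1)] e by simp
      finally show False by simp
    qed
  qed
  then show ?thesis using fN[OF y] gN[OF y] by simp
qed

text \<open>Gronwall's argument run downwards from \<open>y1\<close>: \<open>E * exp (C * y)\<close>
  is nondecreasing, nonnegative, and zero at \<open>y1\<close>. Here \<open>C\<close> bounds the
  coefficients of all products occurring in \<open>E'\<close>.\<close>

lemma vanishing_solution_extends:
  assumes s: "solves f f' g g'" and z: "f y1 = 0" "f' y1 = 0" "g y1 = 0" "g' y1 = 0"
    and y: "0 < y" "y \<le> y1"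
  shows "f y = 0 \<and> g y = 0"
proof -
  note d = solvesD[OF s]
  define M where "M = \<kappa> + \<rho>\<^sup>2 + b\<^sup>2 + b"
  define C where "C = 1 + 4 * M"
  have M: "0 \<le> M" "\<kappa> \<le> M" "\<rho>\<^sup>2 \<le> M" unfolding M_def using b \<kappa> by auto
  define E where "E = (\<lambda>y. (f y)\<^sup>2 + (f' y)\<^sup>2 + (g y)\<^sup>2 + (g' y)\<^sup>2)"
  define E' where "E' = (\<lambda>y. 2 * f y * f' y + 2 * f' y * (- \<kappa> * f y - b * sech2 y * (b * f y - g y))
     + 2 * g y * g' y + 2 * g' y * (\<rho>\<^sup>2 * g y - b * sech2 y * (b * g y - f y)))"
  have dE: "(E has_real_derivative E' y) (at y)" if "y > 0" for y
    unfolding E_def E'_def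
    by (rule derivative_eq_intros d[OF that] refl)+ simp
  have lower: "0 \<le> E' y + C * E y" if "y > 0" for y
  proof -
    have t: "2 * \<bar>p * q\<bar> \<le> p\<^sup>2 + q\<^sup>2" for p q :: real
      using sum_squares_bound[of "\<bar>p\<bar>" "\<bar>q\<bar>"] by (simp add: abs_mult mult.assoc)
    have W: "\<bar>b * sech2 y * b\<bar> \<le> b\<^sup>2" "\<bar>b * sech2 y\<bar> \<le> b"
      using sech2_pos[of y] sech2_le_1[of y] b
      by (auto simp: abs_mult power2_eq_square intro: mult_left_le)
    have c: "\<bar>k * (2 * (p * q))\<bar> \<le> m * (p\<^sup>2 + q\<^sup>2)" if "\<bar>k\<bar> \<le> m" for k m p q :: real
    proof -
      have "\<bar>k\<bar> * (2 * \<bar>p * q\<bar>) \<le> m * (p\<^sup>2 + q\<^sup>2)"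
        by (rule mult_mono) (use that t[of p q] in auto)
      then show ?thesis by (simp add: abs_mult)
    qed
    have sum8: "- (u1 + u2 + u3 + u4 + u5 + u6 + u7 + u8) \<le> t1 - t2 - t3 + t4 + t5 + t6 - t7 + t8"
      if "\<bar>t1\<bar> \<le> u1" "\<bar>t2\<bar> \<le> u2" "\<bar>t3\<bar> \<le> u3" "\<bar>t4\<bar> \<le> u4" "\<bar>t5\<bar> \<le> u5" "\<bar>t6\<bar> \<le> u6" "\<bar>t7\<bar> \<le> u7" "\<bar>t8\<bar> \<le> u8"
      for t1 t2 t3 t4 t5 t6 t7 t8 u1 u2 u3 u4 u5 u6 u7 u8 :: real
      using that by linarith
    have "E' y = 1 * (2 * (f y * f' y)) - \<kappa> * (2 * (f' y * f y)) - (b * sech2 y * b) * (2 * (f' y * f y))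
      + (b * sech2 y) * (2 * (f' y * g y)) + 1 * (2 * (g y * g' y)) + \<rho>\<^sup>2 * (2 * (g' y * g y))
      - (b * sech2 y * b) * (2 * (g' y * g y)) + (b * sech2 y) * (2 * (g' y * f y))"
      unfolding E'_def by (simp add: algebra_simps)
    also have "- (1 * ((f y)\<^sup>2 + (f' y)\<^sup>2) + \<kappa> * ((f' y)\<^sup>2 + (f y)\<^sup>2) + b\<^sup>2 * ((f' y)\<^sup>2 + (f y)\<^sup>2)
        + b * ((f' y)\<^sup>2 + (g y)\<^sup>2) + 1 * ((g y)\<^sup>2 + (g' y)\<^sup>2) + \<rho>\<^sup>2 * ((g' y)\<^sup>2 + (g y)\<^sup>2)
        + b\<^sup>2 * ((g' y)\<^sup>2 + (g y)\<^sup>2) + b * ((g' y)\<^sup>2 + (f y)\<^sup>2)) \<le> \<dots>"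
      by (rule sum8; rule c) (use \<kappa> W in auto)
    finally have "- (1 * ((f y)\<^sup>2 + (f' y)\<^sup>2) + \<kappa> * ((f' y)\<^sup>2 + (f y)\<^sup>2) + b\<^sup>2 * ((f' y)\<^sup>2 + (f y)\<^sup>2)
        + b * ((f' y)\<^sup>2 + (g y)\<^sup>2) + 1 * ((g y)\<^sup>2 + (g' y)\<^sup>2) + \<rho>\<^sup>2 * ((g' y)\<^sup>2 + (g y)\<^sup>2)
        + b\<^sup>2 * ((g' y)\<^sup>2 + (g y)\<^sup>2) + b * ((g' y)\<^sup>2 + (f y)\<^sup>2)) \<le> E' y" .
    moreover have "1 * ((f y)\<^sup>2 + (f' y)\<^sup>2) + \<kappa> * ((f' y)\<^sup>2 + (f y)\<^sup>2) + b\<^sup>2 * ((f' y)\<^sup>2 + (f y)\<^sup>2)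
        + b * ((f' y)\<^sup>2 + (g y)\<^sup>2) + 1 * ((g y)\<^sup>2 + (g' y)\<^sup>2) + \<rho>\<^sup>2 * ((g' y)\<^sup>2 + (g y)\<^sup>2)
        + b\<^sup>2 * ((g' y)\<^sup>2 + (g y)\<^sup>2) + b * ((g' y)\<^sup>2 + (f y)\<^sup>2)
       \<le> E y + \<kappa> * E y + b\<^sup>2 * E y + b * E y + \<rho>\<^sup>2 * E y + b\<^sup>2 * E y + b * E y"
    proof -
      have "\<kappa> * ((f' y)\<^sup>2 + (f y)\<^sup>2) \<le> \<kappa> * E y" "b\<^sup>2 * ((f' y)\<^sup>2 + (f y)\<^sup>2) \<le> b\<^sup>2 * E y"
        "b * ((f' y)\<^sup>2 + (g y)\<^sup>2) \<le> b * E y" "\<rho>\<^sup>2 * ((g' y)\<^sup>2 + (g y)\<^sup>2) \<le> \<rho>\<^sup>2 * E y"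
        "b\<^sup>2 * ((g' y)\<^sup>2 + (g y)\<^sup>2) \<le> b\<^sup>2 * E y" "b * ((g' y)\<^sup>2 + (f y)\<^sup>2) \<le> b * E y"
        by (intro mult_left_mono; use b \<kappa> in \<open>simp add: E_def\<close>)+
      moreover have "1 * ((f y)\<^sup>2 + (f' y)\<^sup>2) + 1 * ((g y)\<^sup>2 + (g' y)\<^sup>2) = E y" by (simp add: E_def)
      ultimately show ?thesis by linarith
    qed
    moreover have "E y + \<kappa> * E y + b\<^sup>2 * E y + b * E y + \<rho>\<^sup>2 * E y + b\<^sup>2 * E y + b * E y \<le> C * E y"
    proof -
      have "E y \<ge> 0" by (simp add: E_def)
      moreover have "1 + \<kappa> + b\<^sup>2 + b + \<rho>\<^sup>2 + b\<^sup>2 + b \<le> C" unfolding C_def M_def using b \<kappa> by simp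
      ultimately have "(1 + \<kappa> + b\<^sup>2 + b + \<rho>\<^sup>2 + b\<^sup>2 + b) * E y \<le> C * E y" by (intro mult_right_mono)
      then show ?thesis by (simp add: algebra_simps)
    qed
    ultimately show ?thesis by linarith
  qed
  have "E y * exp (C * y) \<le> E y1 * exp (C * y1)"
  proof (rule DERIV_nonneg_imp_nondecreasing[OF y(2)])
    fix w assume "y \<le> w" "w \<le> y1"
    then have w: "w > 0" using y by simp
    have "((\<lambda>y. E y * exp (C * y)) has_real_derivative (E' w + C * E w) * exp (C * w)) (at w)"
      by (rule derivative_eq_intros dE[OF w] refl)+ (simp add: algebra_simps)
    then show "\<exists>D. ((\<lambda>y. E y * exp (C * y)) has_real_derivative D) (at w) \<and> 0 \<le> D"
      using lower[OF w] by (intro exI[of _ "(E' w + C * E w) * exp (C * w)"]) simp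
  qed
  also have "E y1 = 0" using z by (simp add: E_def)
  finally have "E y \<le> 0" by (simp add: mult_le_0_iff)
  then have "(f y)\<^sup>2 \<le> 0" "(g y)\<^sup>2 \<le> 0"
    unfolding E_def using zero_le_power2[of "f y"] zero_le_power2[of "g y"]
      zero_le_power2[of "f' y"] zero_le_power2[of "g' y"] by linarith+
  then show ?thesis by simp
qed

end

section \<open>Power series in sech^2\<close>

text \<open>The open unit disc is the right domain: \<open>sech2\<close> maps \<open>y > 0\<close>
  into it and the origin to its boundary point 1, where convergence is the question.\<close>

definition converges_on_disc :: "(nat \<Rightarrow> real) \<Rightarrow> bool" where
  "converges_on_disc x \<longleftrightarrow> (\<forall>q. \<bar>q\<bar> < 1 \<longrightarrow> summable (\<lambda>n. x n * q ^ n))"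

lemma converges_on_discD: "converges_on_disc x \<Longrightarrow> \<bar>q\<bar> < 1 \<Longrightarrow> summable (\<lambda>n. x n * q ^ n)"
  by (simp add: converges_on_disc_def)

lemma converges_on_disc_bounded:
  assumes "\<And>n. \<bar>x n\<bar> \<le> B"
  shows "converges_on_disc x"
  unfolding converges_on_disc_def
proof (intro allI impI)
  fix q :: real assume q: "\<bar>q\<bar> < 1"
  show "summable (\<lambda>n. x n * q ^ n)"
  proof (rule summable_comparison_test'[where N=0])
    show "summable (\<lambda>n. B * \<bar>q\<bar> ^ n)" using q by (intro summable_mult summable_geometric) auto
    show "norm (x n * q ^ n) \<le> B * \<bar>q\<bar> ^ n" for n
      using assms[of n] by (simp add: abs_mult power_abs mult_right_mono)
  qed
qed

lemma converges_on_disc_deriv: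
  assumes x: "converges_on_disc x" and q: "\<bar>q\<bar> < 1"
  shows "((\<lambda>q. \<Sum>n. x n * q ^ n) has_real_derivative (\<Sum>n. diffs x n * q ^ n)) (at q)"
    and "summable (\<lambda>n. real n * x n * q ^ n)"
    and "(\<Sum>n. diffs x n * q ^ n) * q = (\<Sum>n. real n * x n * q ^ n)"
proof -
  define K where "K = (1 + \<bar>q\<bar>) / 2"
  have K: "\<bar>q\<bar> < K" "\<bar>K\<bar> < 1" using q by (auto simp: K_def)
  have s: "summable (\<lambda>n. x n * K ^ n)" by (rule converges_on_discD[OF x K(2)])
  show "((\<lambda>q. \<Sum>n. x n * q ^ n) has_real_derivative (\<Sum>n. diffs x n * q ^ n)) (at q)"
    by (rule termdiffs_strong[OF s]) (use K in auto)
  have sd: "summable (\<lambda>n. diffs x n * q ^ n)"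
    by (rule termdiff_converges[of q 1]) (use q x in \<open>auto simp: converges_on_disc_def\<close>)
  then have "(\<lambda>n. real n * x n * q ^ (n - Suc 0)) sums (\<Sum>n. diffs x n * q ^ n)"
    by (intro diffs_equiv) (simp add: diffs_def)
  then have "(\<lambda>n. real n * x n * q ^ (n - Suc 0) * q) sums ((\<Sum>n. diffs x n * q ^ n) * q)"
    by (rule sums_mult2)
  moreover have "real n * x n * q ^ (n - Suc 0) * q = real n * x n * q ^ n" for n
    by (cases n) auto
  ultimately have "(\<lambda>n. real n * x n * q ^ n) sums ((\<Sum>n. diffs x n * q ^ n) * q)" by simp
  then show "summable (\<lambda>n. real n * x n * q ^ n)"
    "(\<Sum>n. diffs x n * q ^ n) * q = (\<Sum>n. real n * x n * q ^ n)"
    by (auto simp: sums_iff)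
qed

lemma converges_on_disc_lincomb:
  assumes "converges_on_disc x" "converges_on_disc y"
  shows "converges_on_disc (\<lambda>n. c * x n + d * y n)"
  unfolding converges_on_disc_def
proof (intro allI impI)
  fix q :: real assume q: "\<bar>q\<bar> < 1"
  have "summable (\<lambda>n. c * (x n * q ^ n) + d * (y n * q ^ n))"
    by (intro summable_add summable_mult converges_on_discD q assms)
  then show "summable (\<lambda>n. (c * x n + d * y n) * q ^ n)" by (simp add: algebra_simps)
qed

lemma converges_on_disc_exponent:
  assumes "converges_on_disc x"
  shows "converges_on_disc (\<lambda>n. (\<rho> + 2 * real n) * x n)"
proof -
  have "converges_on_disc (\<lambda>n. real n * x n)"
    using converges_on_disc_deriv(2)[OF assms] by (simp add: converges_on_disc_def)
  from converges_on_disc_lincomb[OF assms this, of \<rho> 2] show ?thesis by (simp add: algebra_simps)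
qed

text \<open>\<open>sech_series \<rho> x\<close> is \<open>\<Sum>n. x n * sech ^ (\<rho> + 2 n)\<close>.\<close>

definition sech_series :: "real \<Rightarrow> (nat \<Rightarrow> real) \<Rightarrow> real \<Rightarrow> real" where
  "sech_series \<rho> x y = sech2 y powr (\<rho> / 2) * (\<Sum>n. x n * sech2 y ^ n)"

lemma sech2_less_1: "y > 0 \<Longrightarrow> \<bar>sech2 y\<bar> < 1"
  using sech2_pos[of y] by (simp add: sech2_def)

text \<open>Termwise, the derivative of \<open>sech\<close> to the power \<open>s\<close> is
  \<open>- s * tanh\<close> times that power: up to a common factor, differentiation multiplies the
  coefficients by their exponents.\<close>

lemma sech_series_deriv:
  assumes x: "converges_on_disc x" and y: "y > 0"
  shows "(sech_series \<rho> x has_real_derivative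
    - tanh y * sech_series \<rho> (\<lambda>n. (\<rho> + 2 * real n) * x n) y) (at y)"
proof -
  note q = sech2_less_1[OF y]
  note D = converges_on_disc_deriv[OF x q]
  have d1: "((\<lambda>y. sech2 y powr (\<rho> / 2)) has_real_derivative - \<rho> * tanh y * sech2 y powr (\<rho> / 2)) (at y)"
    by (rule derivative_eq_intros has_real_derivative_sech2 refl sech2_pos)+
      (use sech2_pos[of y] in \<open>simp add: powr_diff\<close>)
  have d2: "((\<lambda>y. \<Sum>n. x n * sech2 y ^ n) has_real_derivative
      (\<Sum>n. diffs x n * sech2 y ^ n) * (- 2 * tanh y * sech2 y)) (at y)"
    by (rule DERIV_chain2[OF D(1) has_real_derivative_sech2])
  have e: "(\<Sum>n. diffs x n * sech2 y ^ n) * (- 2 * tanh y * sech2 y)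
      = - 2 * tanh y * (\<Sum>n. real n * x n * sech2 y ^ n)"
    unfolding D(3)[symmetric] by simp
  have "(\<Sum>n. (\<rho> + 2 * real n) * x n * sech2 y ^ n) =
      (\<Sum>n. \<rho> * (x n * sech2 y ^ n) + 2 * (real n * x n * sech2 y ^ n))"
    by (simp add: algebra_simps)
  also have "\<dots> = \<rho> * (\<Sum>n. x n * sech2 y ^ n) + 2 * (\<Sum>n. real n * x n * sech2 y ^ n)"
    using converges_on_discD[OF x q] D(2)
    by (subst suminf_add[symmetric]) (auto intro: summable_mult simp: suminf_mult)
  finally have f: "(\<Sum>n. (\<rho> + 2 * real n) * x n * sech2 y ^ n) =
      \<rho> * (\<Sum>n. x n * sech2 y ^ n) + 2 * (\<Sum>n. real n * x n * sech2 y ^ n)" .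
  show ?thesis
    unfolding sech_series_def[abs_def] f
    by (rule DERIV_cong[OF DERIV_mult[OF d1 d2[unfolded e]]]) (simp add: algebra_simps)
qed

lemma sech_series_lincomb:
  assumes "converges_on_disc x" "converges_on_disc z" "y > 0"
  shows "sech_series \<rho> (\<lambda>n. c * x n + d * z n) y = c * sech_series \<rho> x y + d * sech_series \<rho> z y"
proof -
  note q = sech2_less_1[OF assms(3)]
  have "(\<Sum>n. (c * x n + d * z n) * sech2 y ^ n) = (\<Sum>n. c * (x n * sech2 y ^ n) + d * (z n * sech2 y ^ n))"
    by (simp add: algebra_simps)
  also have "\<dots> = c * (\<Sum>n. x n * sech2 y ^ n) + d * (\<Sum>n. z n * sech2 y ^ n)"
    using converges_on_discD[OF assms(1) q] converges_on_discD[OF assms(2) q]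
    by (subst suminf_add[symmetric]) (auto intro: summable_mult simp: suminf_mult)
  finally show ?thesis unfolding sech_series_def by (simp add: algebra_simps)
qed

lemma sech_series_shift:
  assumes x: "converges_on_disc x" and x0: "x 0 = 0" and y: "y > 0"
  shows "sech2 y * sech_series \<rho> (\<lambda>n. x (Suc n)) y = sech_series \<rho> x y"
proof -
  note s = converges_on_discD[OF x sech2_less_1[OF y]]
  have "(\<Sum>n. x n * sech2 y ^ n) = (\<Sum>n. x (Suc n) * sech2 y ^ n) * sech2 y"
    using powser_split_head(1)[OF s] x0 by simp
  then show ?thesis unfolding sech_series_def by simp
qed

lemma sech_series_leading:
  assumes x: "converges_on_disc x"
  shows "((\<lambda>y. \<Sum>n. x n * sech2 y ^ n) \<longlongrightarrow> x 0) at_top"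
proof -
  have "isCont (\<lambda>q. \<Sum>n. x n * q ^ n) 0"
    by (rule DERIV_isCont[OF converges_on_disc_deriv(1)[OF x]]) simp
  then have "((\<lambda>y. \<Sum>n. x n * sech2 y ^ n) \<longlongrightarrow> (\<Sum>n. x n * 0 ^ n)) at_top"
    by (rule isCont_tendsto_compose[OF _ sech2_at_top])
  then show ?thesis by (simp add: powser_zero)
qed

lemma sech_series_tendsto_0:
  assumes x: "converges_on_disc x" and \<rho>: "\<rho> > 0"
  shows "(sech_series \<rho> x \<longlongrightarrow> 0) at_top"
proof -
  have "((\<lambda>y. sech2 y powr (\<rho> / 2)) \<longlongrightarrow> 0) at_top"
    using \<rho> by (intro tendsto_zero_powrI[OF sech2_at_top tendsto_const]) (auto simp: less_imp_le[OF sech2_pos])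
  from tendsto_mult[OF this sech_series_leading[OF x]] show ?thesis
    by (simp add: sech_series_def[abs_def])
qed

text \<open>A converse of Abel's theorem for eventually nonnegative coefficients: at each point of
  the disc in \<open>sech2 y\<close> a long partial sum is below the full sum, and letting
  \<open>y\<close> tend to 0 bounds the partial sums of \<open>x\<close> by
  \<open>L\<close>.\<close>

lemma summable_of_bounded_sech_series:
  assumes x: "converges_on_disc x" and pos: "\<And>n. n \<ge> N \<Longrightarrow> 0 \<le> x n"
    and lim: "(sech_series \<rho> x \<longlongrightarrow> L) (at_right 0)"
  shows "summable x"
proof -
  have c: "(sech2 \<longlongrightarrow> 1) (at_right 0)"
    using DERIV_isCont[OF has_real_derivative_sech2, of 0]
    by (auto simp: isCont_def sech2_def filterlim_at_split)
  have "((\<lambda>y. sech_series \<rho> x y / sech2 y powr (\<rho> / 2)) \<longlongrightarrow> L / 1 powr (\<rho> / 2)) (at_right 0)"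
    by (intro tendsto_intros lim c) auto
  moreover have "sech_series \<rho> x y / sech2 y powr (\<rho> / 2) = (\<Sum>n. x n * sech2 y ^ n)" for y
    using sech2_pos[of y] by (simp add: sech_series_def)
  ultimately have L: "((\<lambda>y. \<Sum>n. x n * sech2 y ^ n) \<longlongrightarrow> L) (at_right 0)" by simp
  have bd: "(\<Sum>n<M. x n) \<le> L" if "M \<ge> N" for M
  proof (rule tendsto_le[OF _ L])
    have "((\<lambda>y. \<Sum>n<M. x n * sech2 y ^ n) \<longlongrightarrow> (\<Sum>n<M. x n * 1 ^ n)) (at_right 0)"
      by (intro tendsto_intros c)
    then show "((\<lambda>y. \<Sum>n<M. x n * sech2 y ^ n) \<longlongrightarrow> (\<Sum>n<M. x n)) (at_right 0)" by simp
    have "(\<Sum>n<M. x n * sech2 y ^ n) \<le> (\<Sum>n. x n * sech2 y ^ n)" if y: "y > 0" for y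
      by (rule sum_le_suminf[OF converges_on_discD[OF x sech2_less_1[OF y]]])
        (use pos \<open>M \<ge> N\<close> sech2_pos[of y] in \<open>auto intro!: mult_nonneg_nonneg\<close>)
    then show "\<forall>\<^sub>F y in at_right 0. (\<Sum>n<M. x n * sech2 y ^ n) \<le> (\<Sum>n. x n * sech2 y ^ n)"
      by (auto simp: eventually_at_filter)
  qed auto
  have "summable (\<lambda>n. x (n + N))"
  proof (rule summableI_nonneg_bounded)
    fix M
    have "(\<Sum>n<M + N. x n) = (\<Sum>n<N. x n) + (\<Sum>n<M. x (n + N))"
      by (induction M) auto
    then show "(\<Sum>n<M. x (n + N)) \<le> L - (\<Sum>n<N. x n)" using bd[of "M + N"] by simp
  qed (use pos in auto)
  then show ?thesis by (simp add: summable_iff_shift)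
qed

section \<open>The Frobenius recurrence\<close>

text \<open>The parameter \<open>\<epsilon>\<close> selects the parity, 0 for even and 1 for odd:
  the ansatz is a series in \<open>sech\<^sup>2\<close>, times \<open>tanh\<close> in the odd case.
  A solution of that parity, regular at the origin, then forces the series (or, in the even case,
  its derived series) to stay bounded there.\<close>

locale frobenius = coupled_system +
  fixes a \<epsilon> :: real
  assumes a: "0 < a" "a < 1" "b = a + 1" "a < \<rho>" and \<epsilon>: "\<epsilon> = 0 \<or> \<epsilon> = 1"
begin

abbreviation s :: "nat \<Rightarrow> real" where "s n \<equiv> \<rho> + 2 * real n"

text \<open>For \<open>\<epsilon> \<in> {0, 1}\<close>, the second derivative of
  \<open>tanh ^ \<epsilon> * sech ^ s\<close> is \<open>tanh ^ \<epsilon> * (s\<^sup>2 * sech ^ s -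
  (s + \<epsilon>) * (s + 1 + \<epsilon>) * sech ^ (s + 2))\<close>; the term
  \<open>b\<^sup>2\<close> comes from the potential.\<close>

definition c :: "nat \<Rightarrow> real" where "c n = (s n + \<epsilon>) * (s n + 1 + \<epsilon>) - b\<^sup>2"

text \<open>The components belong to \<open>f\<close> and \<open>g\<close>. The leading exponent
  \<open>\<rho>\<close> solves the indicial equation \<open>s\<^sup>2 - \<rho>\<^sup>2 = 0\<close>
  of \<open>g\<close> but not \<open>s\<^sup>2 + \<kappa> = 0\<close> of \<open>f\<close>, whence
  the start \<open>(0, 1)\<close>.\<close>

primrec coeffs :: "nat \<Rightarrow> real \<times> real" where
  "coeffs 0 = (0, 1)"
| "coeffs (Suc n) =
    ((c n * fst (coeffs n) + b * snd (coeffs n)) / ((s (Suc n))\<^sup>2 + \<kappa>),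
     (c n * snd (coeffs n) + b * fst (coeffs n)) / ((s (Suc n))\<^sup>2 - \<rho>\<^sup>2))"

definition x :: "nat \<Rightarrow> real" where "x n = fst (coeffs n)"
definition z :: "nat \<Rightarrow> real" where "z n = snd (coeffs n)"

lemma x_0: "x 0 = 0" and z_0: "z 0 = 1" by (auto simp: x_def z_def)

lemma s_pos: "s n > 0" using \<rho> by simp

lemma denom_pos: "(s n)\<^sup>2 + \<kappa> > 0" "(s (Suc n))\<^sup>2 - \<rho>\<^sup>2 > 0"
proof -
  show "(s n)\<^sup>2 + \<kappa> > 0" using \<kappa> by (simp add: add_nonneg_pos)
  have "\<rho>\<^sup>2 < (s (Suc n))\<^sup>2" using \<rho> by (intro power_strict_mono) auto
  then show "(s (Suc n))\<^sup>2 - \<rho>\<^sup>2 > 0" by simp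
qed

lemma denom_le: "(s (Suc n))\<^sup>2 - \<rho>\<^sup>2 \<le> (s (Suc n))\<^sup>2 + \<kappa>"
  using \<kappa> zero_le_power2[of \<rho>] by linarith

lemma x_Suc: "x (Suc n) * ((s (Suc n))\<^sup>2 + \<kappa>) = c n * x n + b * z n"
  and z_Suc: "z (Suc n) * ((s (Suc n))\<^sup>2 - \<rho>\<^sup>2) = c n * z n + b * x n"
  using denom_pos(1)[of "Suc n"] denom_pos(2)[of n] by (simp_all add: x_def z_def)

text \<open>The recurrence matrix, before division, is symmetric with eigenvalues
  \<open>c n + b\<close> and \<open>c n - b\<close>; this makes it invertible. The factorization
  uses that \<open>s = b\<close> solves \<open>s * (s + 1) = b\<^sup>2 + b\<close>. At
  \<open>n = 0\<close> the inequality may fail, as only \<open>a < \<rho>\<close> is known.\<close>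

lemma c_gt_b: "n \<ge> 1 \<Longrightarrow> b < c n"
proof -
  assume "n \<ge> 1"
  then have "real n \<ge> 1" by simp
  then have s: "a + 2 < s n" using a by linarith
  have e: "\<epsilon> \<ge> 0" using \<epsilon> by auto
  have "c n - b = (s n + \<epsilon> - a - 1) * (s n + \<epsilon> + a + 2)"
    unfolding c_def unfolding a(3) by (simp add: algebra_simps power2_eq_square)
  also have "\<dots> > 0" using s e a by (intro mult_pos_pos) linarith+
  finally show ?thesis by simp
qed

lemma x_1_pos: "x 1 > 0"
  using b denom_pos(1)[of 1] by (simp add: x_def)

text \<open>The reverse triangle inequality in each component shows that the matrix shrinks the sum
  norm by a factor no smaller than \<open>c n - b\<close>. For a common lower bound both
  denominators are replaced by the larger one.\<close>

lemma coeff_sum_lower: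
  assumes "n \<ge> 1"
  shows "(c n - b) * (\<bar>x n\<bar> + \<bar>z n\<bar>) \<le> ((s (Suc n))\<^sup>2 + \<kappa>) * (\<bar>x (Suc n)\<bar> + \<bar>z (Suc n)\<bar>)"
proof -
  note cb = c_gt_b[OF assms]
  have "c n * \<bar>x n\<bar> \<le> \<bar>c n * x n + b * z n\<bar> + b * \<bar>z n\<bar>"
    using abs_triangle_ineq4[of "c n * x n + b * z n" "b * z n"] b cb by (simp add: abs_mult)
  moreover have "c n * \<bar>z n\<bar> \<le> \<bar>c n * z n + b * x n\<bar> + b * \<bar>x n\<bar>"
    using abs_triangle_ineq4[of "c n * z n + b * x n" "b * x n"] b cb by (simp add: abs_mult)
  moreover have "\<bar>c n * x n + b * z n\<bar> = ((s (Suc n))\<^sup>2 + \<kappa>) * \<bar>x (Suc n)\<bar>"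
    unfolding x_Suc[symmetric] using denom_pos(1)[of "Suc n"] by (simp add: abs_mult mult.commute)
  moreover have "\<bar>c n * z n + b * x n\<bar> \<le> ((s (Suc n))\<^sup>2 + \<kappa>) * \<bar>z (Suc n)\<bar>"
  proof -
    have "\<bar>c n * z n + b * x n\<bar> = ((s (Suc n))\<^sup>2 - \<rho>\<^sup>2) * \<bar>z (Suc n)\<bar>"
      unfolding z_Suc[symmetric] using denom_pos(2)[of n] by (simp add: abs_mult mult.commute)
    also have "\<dots> \<le> ((s (Suc n))\<^sup>2 + \<kappa>) * \<bar>z (Suc n)\<bar>"
      by (rule mult_right_mono[OF denom_le]) simp
    finally show ?thesis .
  qed
  ultimately show ?thesis unfolding distrib_left left_diff_distrib by linarith
qed

text \<open>For large \<open>n\<close> the norm \<open>c n + b\<close> of the matrix stays below the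
  smaller denominator, because the difference grows linearly in \<open>s n\<close> with slope
  \<open>3 - 2 * \<epsilon> \<ge> 1\<close>. So the coefficients are bounded, which gives
  convergence on the unit disc.\<close>

lemma coeff_sum_upper:
  assumes n: "n \<ge> 1" "b + \<rho>\<^sup>2 \<le> s n"
  shows "\<bar>x (Suc n)\<bar> + \<bar>z (Suc n)\<bar> \<le> \<bar>x n\<bar> + \<bar>z n\<bar>"
proof -
  note cb = c_gt_b[OF n(1)]
  define D where "D = (s (Suc n))\<^sup>2 - \<rho>\<^sup>2"
  have D: "D > 0" unfolding D_def by (rule denom_pos)
  have "D * \<bar>x (Suc n)\<bar> \<le> ((s (Suc n))\<^sup>2 + \<kappa>) * \<bar>x (Suc n)\<bar>"
    unfolding D_def by (rule mult_right_mono[OF denom_le]) simp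
  also have "\<dots> = \<bar>c n * x n + b * z n\<bar>"
    unfolding x_Suc[symmetric] using denom_pos(1)[of "Suc n"] by (simp add: abs_mult mult.commute)
  also have "\<dots> \<le> c n * \<bar>x n\<bar> + b * \<bar>z n\<bar>"
    using abs_triangle_ineq[of "c n * x n" "b * z n"] b cb by (simp add: abs_mult)
  finally have 1: "D * \<bar>x (Suc n)\<bar> \<le> c n * \<bar>x n\<bar> + b * \<bar>z n\<bar>" .
  have "D * \<bar>z (Suc n)\<bar> = \<bar>c n * z n + b * x n\<bar>"
    unfolding z_Suc[symmetric] using D by (simp add: abs_mult mult.commute D_def)
  also have "\<dots> \<le> c n * \<bar>z n\<bar> + b * \<bar>x n\<bar>"
    using abs_triangle_ineq[of "c n * z n" "b * x n"] b cb by (simp add: abs_mult)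
  finally have 2: "D * (\<bar>x (Suc n)\<bar> + \<bar>z (Suc n)\<bar>) \<le> (c n + b) * (\<bar>x n\<bar> + \<bar>z n\<bar>)"
    using 1 by (simp add: algebra_simps)
  have "c n + b \<le> D"
  proof -
    have "D - (c n + b) = (3 - 2 * \<epsilon>) * s n + 4 - \<epsilon> - \<epsilon>\<^sup>2 + b\<^sup>2 - b - \<rho>\<^sup>2"
      unfolding D_def c_def by (simp add: algebra_simps power2_eq_square)
    moreover have "s n \<le> (3 - 2 * \<epsilon>) * s n" "\<epsilon> + \<epsilon>\<^sup>2 \<le> 2" using \<epsilon> s_pos[of n] by auto
    ultimately show ?thesis using n(2) zero_le_power2[of b] by linarith
  qed
  then have "(c n + b) * (\<bar>x n\<bar> + \<bar>z n\<bar>) \<le> D * (\<bar>x n\<bar> + \<bar>z n\<bar>)" by (intro mult_right_mono) auto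
  with 2 have "D * (\<bar>x (Suc n)\<bar> + \<bar>z (Suc n)\<bar>) \<le> D * (\<bar>x n\<bar> + \<bar>z n\<bar>)" by linarith
  then show ?thesis using D by simp
qed

lemma coeffs_converge: "converges_on_disc x" "converges_on_disc z"
proof -
  define A where "A n = \<bar>x n\<bar> + \<bar>z n\<bar>" for n
  obtain N :: nat where N: "b + \<rho>\<^sup>2 < real N" using reals_Archimedean2 by blast
  define M where "M = Suc N"
  have dec: "A n \<le> A M" if "n \<ge> M" for n
    using that
  proof (induction n rule: dec_induct)
    case (step n)
    have "b + \<rho>\<^sup>2 \<le> s n" using N step \<rho> by (simp add: M_def)
    then have "A (Suc n) \<le> A n" unfolding A_def by (intro coeff_sum_upper) (use step in \<open>auto simp: M_def\<close>)
    then show ?case using step by simp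
  qed simp
  define B where "B = Max (A ` {..M})"
  have "A n \<le> B" for n
  proof (cases "n \<le> M")
    case False
    then have "A n \<le> A M" by (intro dec) simp
    also have "\<dots> \<le> B" unfolding B_def by (intro Max_ge) auto
    finally show ?thesis .
  qed (auto simp: B_def intro!: Max_ge)
  then have AB: "\<bar>x n\<bar> + \<bar>z n\<bar> \<le> B" for n unfolding A_def .
  have "\<bar>x n\<bar> \<le> B" "\<bar>z n\<bar> \<le> B" for n using AB[of n] by linarith+
  then show "converges_on_disc x" "converges_on_disc z" by (auto intro: converges_on_disc_bounded)
qed

text \<open>For \<open>n \<ge> 1\<close> the matrix has positive entries, so a pair of weakly equal
  signs keeps its quadrant. If no such pair ever occurs, the signs are opposite throughout; they
  cannot swap, because \<open>c n > b\<close> preserves the sign of the difference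
  \<open>x n - z n\<close>.\<close>

lemma coeff_signs:
  "\<exists>N r r'. \<bar>r\<bar> = (1::real) \<and> \<bar>r'\<bar> = (1::real) \<and> (\<forall>n\<ge>N. 0 \<le> r * x n \<and> 0 \<le> r' * z n)"
proof -
  have pos_iff: "0 \<le> r * x (Suc n) \<longleftrightarrow> 0 \<le> r * (c n * x n + b * z n)"
    "0 \<le> r * z (Suc n) \<longleftrightarrow> 0 \<le> r * (c n * z n + b * x n)" for r n
    unfolding x_Suc[symmetric] z_Suc[symmetric] using denom_pos(1)[of "Suc n"] denom_pos(2)[of n]
    by (simp_all add: zero_le_mult_iff mult.assoc[symmetric] not_less[symmetric] mult_less_0_iff)
  show ?thesis
  proof (cases "\<exists>n\<ge>1. 0 \<le> x n * z n")
    case True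
    then obtain N where N: "N \<ge> 1" "0 \<le> x N * z N" by blast
    then obtain r where r: "\<bar>r\<bar> = (1::real)" "0 \<le> r * x N" "0 \<le> r * z N"
    proof (cases "0 \<le> x N \<and> 0 \<le> z N")
      case True
      then show ?thesis using that[of 1] by simp
    next
      case False
      then have "x N \<le> 0 \<and> z N \<le> 0" using N(2) by (auto simp: zero_le_mult_iff)
      then show ?thesis using that[of "-1"] by simp
    qed
    have "0 \<le> r * x n \<and> 0 \<le> r * z n" if "n \<ge> N" for n
      using that
    proof (induction n rule: dec_induct)
      case (step n)
      have "0 \<le> c n * (r * x n) + b * (r * z n)" "0 \<le> c n * (r * z n) + b * (r * x n)"
        using step c_gt_b[of n] b N by (auto intro!: add_nonneg_nonneg mult_nonneg_nonneg)
      then show ?case unfolding pos_iff by (simp add: algebra_simps)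
    qed (use r in auto)
    then show ?thesis using r by blast
  next
    case False
    then have neg: "x n * z n < 0" if "n \<ge> 1" for n using that by auto
    have "0 < x n \<and> z n < 0" if "n \<ge> 1" for n
      using that
    proof (induction n rule: dec_induct)
      case base
      then show ?case using x_1_pos neg[of 1] by (simp add: mult_less_0_iff)
    next
      case (step n)
      have cb: "c n > b" using c_gt_b step by simp
      have "\<not> (x (Suc n) < 0 \<and> 0 < z (Suc n))"
      proof
        assume *: "x (Suc n) < 0 \<and> 0 < z (Suc n)"
        have "c n * x n + b * z n < 0"
          unfolding x_Suc[symmetric] using * denom_pos(1)[of "Suc n"] by (intro mult_neg_pos) auto
        moreover have "0 < c n * z n + b * x n"
          unfolding z_Suc[symmetric] using * denom_pos(2)[of n] by (intro mult_pos_pos) auto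
        ultimately have "(c n - b) * (x n - z n) < 0" by (simp add: algebra_simps)
        moreover have "0 < (c n - b) * (x n - z n)" using cb step by (intro mult_pos_pos) auto
        ultimately show False by simp
      qed
      then show ?case using neg[of "Suc n"] by (auto simp: mult_less_0_iff)
    qed
    then show ?thesis by (intro exI[of _ 1] exI[of _ "-1"] conjI allI impI) (auto simp: less_imp_le)
  qed
qed

text \<open>The factor \<open>(c n - b) / ((s (Suc n))\<^sup>2 + \<kappa>)\<close> is about
  \<open>1 - 3 / s n\<close> for \<open>\<epsilon> = 0\<close> and \<open>1 - 1 / s n\<close> for
  \<open>\<epsilon> = 1\<close>. As \<open>s\<close> advances by 2, this means decay no faster than
  about the powers -3/2 and -1/2 of \<open>s n\<close>. The weights \<open>w\<close>, of degree 2
  and 1, grow a little faster than needed and make \<open>w n * A n\<close> eventually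
  nondecreasing.\<close>

lemma coeff_growth:
  "\<exists>C>0. \<exists>N. \<forall>n\<ge>N. C / s n \<le> (if \<epsilon> = 0 then s n else 1) * (\<bar>x n\<bar> + \<bar>z n\<bar>)"
proof -
  define w where "w n = (if \<epsilon> = 0 then s n else 1) * s n" for n
  define A where "A n = \<bar>x n\<bar> + \<bar>z n\<bar>" for n
  have wpos: "w n > 0" for n using s_pos[of n] by (auto simp: w_def)
  have Apos: "A n > 0" if "n \<ge> 1" for n
    using that
  proof (induction n rule: dec_induct)
    case base
    then show ?case using x_1_pos by (simp add: A_def)
  next
    case (step n)
    have "0 < (c n - b) * A n" using step c_gt_b[of n] by (intro mult_pos_pos) auto
    also have "\<dots> \<le> ((s (Suc n))\<^sup>2 + \<kappa>) * A (Suc n)" unfolding A_def by (rule coeff_sum_lower) (use step in simp)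
    finally show ?case using denom_pos(1)[of "Suc n"] by (simp add: zero_less_mult_iff)
  qed
  obtain N :: nat where N: "b\<^sup>2 + b + \<kappa> < real N" using reals_Archimedean2 by blast
  define M where "M = Suc N"
  have inc: "w n * A n \<le> w (Suc n) * A (Suc n)" if n: "n \<ge> M" for n
  proof -
    define S where "S = s (Suc n)"
    have S: "S = s n + 2" "s n > 0" "b\<^sup>2 + b + \<kappa> \<le> s n" using N n s_pos[of n] \<rho> by (auto simp: S_def M_def)
    have "w n * (S\<^sup>2 + \<kappa>) \<le> w (Suc n) * (c n - b)"
    proof (cases "\<epsilon> = 0")
      case True
      have "w (Suc n) * (c n - b) - w n * (S\<^sup>2 + \<kappa>) = S\<^sup>2 * (s n - b\<^sup>2 - b) - (s n)\<^sup>2 * \<kappa>"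
        unfolding c_def unfolding w_def S_def[symmetric] True by (simp add: algebra_simps power2_eq_square)
      moreover have "(s n)\<^sup>2 * \<kappa> \<le> S\<^sup>2 * (s n - b\<^sup>2 - b)"
        using S \<kappa> by (intro mult_mono power_mono) auto
      ultimately show ?thesis by linarith
    next
      case False
      then have e: "\<epsilon> = 1" using \<epsilon> by simp
      have "w (Suc n) * (c n - b) - w n * (S\<^sup>2 + \<kappa>) = S * (s n + 2 - b\<^sup>2 - b) - s n * \<kappa>"
        unfolding c_def unfolding w_def S_def[symmetric] e S(1) by (simp add: algebra_simps power2_eq_square)
      moreover have "s n * \<kappa> \<le> S * (s n + 2 - b\<^sup>2 - b)"
        using S \<kappa> by (intro mult_mono) auto
      ultimately show ?thesis by linarith
    qed
    then have "w n * (S\<^sup>2 + \<kappa>) * A n \<le> w (Suc n) * (c n - b) * A n"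
      by (intro mult_right_mono) (auto simp: A_def)
    also have "\<dots> \<le> w (Suc n) * ((S\<^sup>2 + \<kappa>) * A (Suc n))"
      using coeff_sum_lower[of n] wpos[of "Suc n"] n unfolding A_def S_def M_def mult.assoc
      by (intro mult_left_mono) auto
    finally have "(S\<^sup>2 + \<kappa>) * (w n * A n) \<le> (S\<^sup>2 + \<kappa>) * (w (Suc n) * A (Suc n))" by (simp add: mult_ac)
    then show ?thesis using denom_pos(1)[of "Suc n"] unfolding S_def by simp
  qed
  define C where "C = w M * A M"
  have "C > 0" unfolding C_def using wpos Apos[of M] by (simp add: M_def)
  moreover have "C / s n \<le> (if \<epsilon> = 0 then s n else 1) * (\<bar>x n\<bar> + \<bar>z n\<bar>)" if "n \<ge> M" for n
  proof -
    have "C \<le> w n * A n"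
      using that by (induction n rule: dec_induct) (use inc in \<open>force simp: C_def\<close>)+
    then show ?thesis using s_pos[of n] by (simp add: w_def A_def field_simps)
  qed
  ultimately show ?thesis by blast
qed

text \<open>With eventually constant signs the two series combine, after sign changes, into one
  whose terms are \<open>\<theta> n * (\<bar>x n\<bar> + \<bar>z n\<bar>)\<close>; these dominate a
  harmonic series.\<close>

lemma coeffs_not_summable:
  defines "\<theta> \<equiv> (\<lambda>n. if \<epsilon> = 0 then s n else 1)"
  shows "\<not> (summable (\<lambda>n. \<theta> n * x n) \<and> summable (\<lambda>n. \<theta> n * z n))"
proof
  assume S: "summable (\<lambda>n. \<theta> n * x n) \<and> summable (\<lambda>n. \<theta> n * z n)"
  obtain r r' N where r: "\<bar>r\<bar> = 1" "\<bar>r'\<bar> = (1::real)" "\<And>n. n \<ge> N \<Longrightarrow> 0 \<le> r * x n" "\<And>n. n \<ge> N \<Longrightarrow> 0 \<le> r' * z n"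
    using coeff_signs by auto
  obtain C N' where C: "C > 0" "\<And>n. n \<ge> N' \<Longrightarrow> C / s n \<le> \<theta> n * (\<bar>x n\<bar> + \<bar>z n\<bar>)"
    using coeff_growth unfolding \<theta>_def by auto
  have sm: "summable (\<lambda>n. r * (\<theta> n * x n) + r' * (\<theta> n * z n))"
    using S by (intro summable_add summable_mult) auto
  have "summable (\<lambda>n. C / s n)"
  proof (rule summable_comparison_test'[OF sm, of "max N N'"])
    fix n assume n: "n \<ge> max N N'"
    have "\<bar>x n\<bar> = r * x n" "\<bar>z n\<bar> = r' * z n"
      using r(3)[of n] r(4)[of n] r(1,2) n by (metis abs_mult abs_of_nonneg max.boundedE mult_1)+
    then have "\<theta> n * (\<bar>x n\<bar> + \<bar>z n\<bar>) = r * (\<theta> n * x n) + r' * (\<theta> n * z n)" by (simp add: algebra_simps)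
    then show "norm (C / s n) \<le> r * (\<theta> n * x n) + r' * (\<theta> n * z n)"
      using C(2)[of n] n C(1) s_pos[of n] by simp
  qed
  then have sC: "summable (\<lambda>n. (\<rho> + 2) / C * (C / s n))" by (rule summable_mult)
  have le: "norm (inverse (real (Suc n))) \<le> (\<rho> + 2) / C * (C / s n)" for n
  proof -
    have "s n \<le> (\<rho> + 2) * real (Suc n)" using \<rho> by (simp add: algebra_simps)
    then have "1 / real (Suc n) \<le> (\<rho> + 2) / s n"
      using s_pos[of n] by (simp add: divide_le_eq le_divide_eq mult.commute)
    then show ?thesis using C(1) by (simp add: inverse_eq_divide)
  qed
  have "summable (\<lambda>n. inverse (real (Suc n)))"
    by (rule summable_comparison_test'[OF sC le])
  then show False using not_summable_harmonic[where 'a=real] summable_Suc_iff[of "\<lambda>n. inverse (real n)"] by simp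
qed

section \<open>The Frobenius solution and its behaviour at the origin\<close>

definition \<tau> :: "real \<Rightarrow> real" where "\<tau> y = (if \<epsilon> = 0 then 1 else tanh y)"

definition F :: "real \<Rightarrow> real" where "F y = \<tau> y * sech_series \<rho> x y"
definition G :: "real \<Rightarrow> real" where "G y = \<tau> y * sech_series \<rho> z y"

definition F_deriv :: "(nat \<Rightarrow> real) \<Rightarrow> real \<Rightarrow> real" where
  "F_deriv u y = (if \<epsilon> = 0 then - tanh y * sech_series \<rho> (\<lambda>n. s n * u n) y
     else sech2 y * sech_series \<rho> u y - (tanh y)\<^sup>2 * sech_series \<rho> (\<lambda>n. s n * u n) y)"

lemma series_derivs:
  assumes u: "converges_on_disc u" and y: "y > 0"
  shows "((\<lambda>y. \<tau> y * sech_series \<rho> u y) has_real_derivative F_deriv u y) (at y)"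
    and "(F_deriv u has_real_derivative \<tau> y * (sech_series \<rho> (\<lambda>n. s n * (s n * u n)) y
      - sech2 y * sech_series \<rho> (\<lambda>n. (s n + \<epsilon>) * (s n + 1 + \<epsilon>) * u n) y)) (at y)"
proof -
  note su = converges_on_disc_exponent[OF u, of \<rho>]
  note ssu = converges_on_disc_exponent[OF su, of \<rho>]
  note d0 = sech_series_deriv[OF u y, of \<rho>] and d1 = sech_series_deriv[OF su y, of \<rho>]
  note dt = has_real_derivative_tanh_sech2[of y] and ds = has_real_derivative_sech2[of y]
  have "(\<lambda>n. (s n + \<epsilon>) * (s n + 1 + \<epsilon>) * u n) =
      (\<lambda>n. 1 * (s n * (s n * u n)) + 1 * ((1 + 2 * \<epsilon>) * (s n * u n) + (\<epsilon> + \<epsilon>\<^sup>2) * u n))"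
    by (simp add: fun_eq_iff algebra_simps power2_eq_square)
  then have e: "sech_series \<rho> (\<lambda>n. (s n + \<epsilon>) * (s n + 1 + \<epsilon>) * u n) y =
      sech_series \<rho> (\<lambda>n. s n * (s n * u n)) y + (1 + 2 * \<epsilon>) * sech_series \<rho> (\<lambda>n. s n * u n) y
      + (\<epsilon> + \<epsilon>\<^sup>2) * sech_series \<rho> u y"
    using sech_series_lincomb[OF ssu converges_on_disc_lincomb[OF su u] y, of \<rho> 1 1 "1 + 2 * \<epsilon>" "\<epsilon> + \<epsilon>\<^sup>2"]
      sech_series_lincomb[OF su u y, of \<rho> "1 + 2 * \<epsilon>" "\<epsilon> + \<epsilon>\<^sup>2"] by simp
  show "((\<lambda>y. \<tau> y * sech_series \<rho> u y) has_real_derivative F_deriv u y) (at y)"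
  proof (cases "\<epsilon> = 0")
    case True
    show ?thesis unfolding \<tau>_def F_deriv_def if_P[OF True] using d0 by simp
  next
    case False
    then show ?thesis unfolding \<tau>_def F_deriv_def
      using DERIV_mult[OF dt d0] by (simp add: algebra_simps power2_eq_square)
  qed
  show "(F_deriv u has_real_derivative \<tau> y * (sech_series \<rho> (\<lambda>n. s n * (s n * u n)) y
      - sech2 y * sech_series \<rho> (\<lambda>n. (s n + \<epsilon>) * (s n + 1 + \<epsilon>) * u n) y)) (at y)"
  proof (cases "\<epsilon> = 0")
    case True
    have "((\<lambda>y. - tanh y * sech_series \<rho> (\<lambda>n. s n * u n) y) has_real_derivative
        - sech2 y * sech_series \<rho> (\<lambda>n. s n * u n) y
        + - tanh y * sech_series \<rho> (\<lambda>n. s n * (s n * u n)) y * - tanh y) (at y)"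
      using DERIV_mult[OF DERIV_minus[OF dt] d1] by (simp add: algebra_simps)
    then show ?thesis unfolding e unfolding \<tau>_def F_deriv_def[abs_def] if_P[OF True]
      by (rule DERIV_cong) (simp add: True sech2_def algebra_simps power2_eq_square)
  next
    case False
    then have e1: "\<epsilon> = 1" using \<epsilon> by simp
    have "((\<lambda>y. sech2 y * sech_series \<rho> u y - (tanh y)\<^sup>2 * sech_series \<rho> (\<lambda>n. s n * u n) y) has_real_derivative
        ((- 2 * tanh y * sech2 y) * sech_series \<rho> u y + - tanh y * sech_series \<rho> (\<lambda>n. s n * u n) y * sech2 y)
        - ((2 * tanh y * sech2 y) * sech_series \<rho> (\<lambda>n. s n * u n) y
           + - tanh y * sech_series \<rho> (\<lambda>n. s n * (s n * u n)) y * (tanh y)\<^sup>2)) (at y)"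
      by (intro DERIV_diff DERIV_mult ds d0 d1 DERIV_cong[OF DERIV_power[OF dt]]) simp
    then show ?thesis unfolding e unfolding \<tau>_def F_deriv_def[abs_def] if_not_P[OF False]
      by (rule DERIV_cong) (simp add: e1 sech2_def algebra_simps power2_eq_square)
  qed
qed

text \<open>Comparison of coefficients in one equation of the system; \<open>k = \<kappa>\<close>
  serves \<open>f\<close> and \<open>k = - \<rho>\<^sup>2\<close> serves \<open>g\<close>. The
  indicial condition \<open>u0\<close> kills the lowest term of \<open>p\<close>, so that a factor
  \<open>sech2\<close> splits off and the index shift of the recurrence matches.\<close>

lemma recurrence_identity:
  assumes u: "converges_on_disc u" and w: "converges_on_disc w" and y: "y > 0"
    and u0: "(s 0 * s 0 + k) * u 0 = 0"
    and rec: "\<And>n. u (Suc n) * ((s (Suc n))\<^sup>2 + k) = c n * u n + b * w n"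
  shows "sech_series \<rho> (\<lambda>n. s n * (s n * u n)) y - sech2 y * sech_series \<rho> (\<lambda>n. (s n + \<epsilon>) * (s n + 1 + \<epsilon>) * u n) y
    = - k * sech_series \<rho> u y - b * sech2 y * (b * sech_series \<rho> u y - sech_series \<rho> w y)"
proof -
  note su = converges_on_disc_exponent[OF u, of \<rho>]
  note ssu = converges_on_disc_exponent[OF su, of \<rho>]
  have eq1: "(\<lambda>n. (s n + \<epsilon>) * (s n + 1 + \<epsilon>) * u n) =
      (\<lambda>n. 1 * (s n * (s n * u n)) + 1 * ((1 + 2 * \<epsilon>) * (s n * u n) + (\<epsilon> + \<epsilon>\<^sup>2) * u n))"
    by (simp add: fun_eq_iff algebra_simps power2_eq_square)
  have cv: "converges_on_disc (\<lambda>n. (s n + \<epsilon>) * (s n + 1 + \<epsilon>) * u n)"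
    unfolding eq1 by (intro converges_on_disc_lincomb ssu su u)
  define p where "p n = 1 * (s n * (s n * u n)) + k * u n" for n
  have cp: "converges_on_disc p" unfolding p_def by (intro converges_on_disc_lincomb ssu u)
  have p_Suc: "p (Suc n) = 1 * ((s n + \<epsilon>) * (s n + 1 + \<epsilon>) * u n) + b * (- b * u n + 1 * w n)" for n
  proof -
    have "p (Suc n) = u (Suc n) * ((s (Suc n))\<^sup>2 + k)" by (simp add: p_def algebra_simps power2_eq_square)
    then show ?thesis unfolding rec c_def by (simp add: algebra_simps power2_eq_square)
  qed
  have "sech_series \<rho> (\<lambda>n. s n * (s n * u n)) y + k * sech_series \<rho> u y = sech_series \<rho> p y"
    using sech_series_lincomb[OF ssu u y, of \<rho> 1 k] by (simp add: p_def[abs_def])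
  also have "\<dots> = sech2 y * sech_series \<rho> (\<lambda>n. p (Suc n)) y"
    by (rule sech_series_shift[OF cp _ y, symmetric]) (use u0 in \<open>simp add: p_def algebra_simps\<close>)
  also have "sech_series \<rho> (\<lambda>n. p (Suc n)) y =
      1 * sech_series \<rho> (\<lambda>n. (s n + \<epsilon>) * (s n + 1 + \<epsilon>) * u n) y
      + b * (- b * sech_series \<rho> u y + 1 * sech_series \<rho> w y)"
    unfolding p_Suc sech_series_lincomb[OF cv converges_on_disc_lincomb[OF u w] y]
      sech_series_lincomb[OF u w y] ..
  finally show ?thesis by (simp add: algebra_simps)
qed

lemma F_solves: "solves F (F_deriv x) G (F_deriv z)"
  unfolding solves_def
proof (intro allI impI conjI)
  fix y :: real assume y: "y > 0"
  note cx = coeffs_converge(1) and cz = coeffs_converge(2)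
  show "(F has_real_derivative F_deriv x y) (at y)" "(G has_real_derivative F_deriv z y) (at y)"
    unfolding F_def[abs_def] G_def[abs_def] by (rule series_derivs[OF cx y] series_derivs[OF cz y])+
  have "sech_series \<rho> (\<lambda>n. s n * (s n * x n)) y - sech2 y * sech_series \<rho> (\<lambda>n. (s n + \<epsilon>) * (s n + 1 + \<epsilon>) * x n) y
    = - \<kappa> * sech_series \<rho> x y - b * sech2 y * (b * sech_series \<rho> x y - sech_series \<rho> z y)"
    by (rule recurrence_identity[OF cx cz y]) (simp add: x_0, rule x_Suc)
  from series_derivs(2)[OF cx y, unfolded this]
  show "(F_deriv x has_real_derivative - \<kappa> * F y - b * sech2 y * (b * F y - G y)) (at y)"
    by (rule DERIV_cong) (simp add: F_def G_def algebra_simps)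
  have "sech_series \<rho> (\<lambda>n. s n * (s n * z n)) y - sech2 y * sech_series \<rho> (\<lambda>n. (s n + \<epsilon>) * (s n + 1 + \<epsilon>) * z n) y
    = - (- \<rho>\<^sup>2) * sech_series \<rho> z y - b * sech2 y * (b * sech_series \<rho> z y - sech_series \<rho> x y)"
    by (rule recurrence_identity[OF cz cx y]) (simp add: power2_eq_square, use z_Suc in simp)
  from series_derivs(2)[OF cz y, unfolded this]
  show "(F_deriv z has_real_derivative \<rho>\<^sup>2 * G y - b * sech2 y * (b * G y - F y)) (at y)"
    by (rule DERIV_cong) (simp add: F_def G_def algebra_simps)
qed

lemma \<tau>_tendsto: "(\<tau> \<longlongrightarrow> 1) at_top"
  unfolding \<tau>_def[abs_def] using tanh_real_at_top by (cases "\<epsilon> = 0") auto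

lemma solution_tendsto: "(F \<longlongrightarrow> 0) at_top" "(G \<longlongrightarrow> 0) at_top" "(F_deriv x \<longlongrightarrow> 0) at_top"
proof -
  note cx = coeffs_converge(1) and cz = coeffs_converge(2)
  note T = sech_series_tendsto_0[OF cx \<rho>] sech_series_tendsto_0[OF cz \<rho>]
    sech_series_tendsto_0[OF converges_on_disc_exponent[OF cx, of \<rho>] \<rho>]
  show "(F \<longlongrightarrow> 0) at_top" "(G \<longlongrightarrow> 0) at_top"
    using tendsto_mult[OF \<tau>_tendsto T(1)] tendsto_mult[OF \<tau>_tendsto T(2)]
    by (simp_all add: F_def[abs_def] G_def[abs_def])
  show "(F_deriv x \<longlongrightarrow> 0) at_top"
  proof (cases "\<epsilon> = 0")
    case True
    show ?thesis unfolding F_deriv_def[abs_def] if_P[OF True]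
      using tendsto_minus[OF tendsto_mult[OF tanh_real_at_top T(3)]] by simp
  next
    case False
    have "((\<lambda>y. sech2 y * sech_series \<rho> x y - (tanh y)\<^sup>2 * sech_series \<rho> (\<lambda>n. s n * x n) y) \<longlongrightarrow> 0 * 0 - 1\<^sup>2 * 0) at_top"
      by (intro tendsto_intros T sech2_at_top tanh_real_at_top)
    then show ?thesis unfolding F_deriv_def[abs_def] if_not_P[OF False] by simp
  qed
qed

lemma G_eventually_nonzero: "\<forall>\<^sub>F y in at_top. G y \<noteq> 0"
proof -
  have "\<forall>\<^sub>F y in at_top. 0 < (\<Sum>n. z n * sech2 y ^ n)"
    by (rule order_tendstoD(1)[OF sech_series_leading[OF coeffs_converge(2)]]) (simp add: z_0)
  then show ?thesis
    using eventually_gt_at_top[of 0]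
  proof eventually_elim
    case (elim y)
    then show ?case using sech2_pos[of y] by (auto simp: G_def \<tau>_def sech_series_def)
  qed
qed

text \<open>Here \<open>j\<close> stands for the derivative of an even solution or for an odd
  solution itself, up to a constant. As it vanishes at 0 and is differentiable there,
  \<open>j y / tanh y\<close> has a limit, which is a limit of the series; the factor
  \<open>r\<close> makes its coefficients eventually nonnegative.\<close>

lemma summable_of_regular_at_0:
  defines "\<theta> \<equiv> (\<lambda>n. if \<epsilon> = 0 then s n else 1)"
  assumes u: "converges_on_disc u" and r: "\<bar>r\<bar> = (1::real)" "\<And>n. n \<ge> N \<Longrightarrow> 0 \<le> r * u n"
    and j: "(j has_real_derivative D) (at 0)" "j 0 = 0"
      "\<And>y. y > 0 \<Longrightarrow> j y = tanh y * sech_series \<rho> (\<lambda>n. \<theta> n * u n) y"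
  shows "summable (\<lambda>n. \<theta> n * u n)"
proof -
  have \<theta>pos: "0 < \<theta> n" for n using s_pos[of n] by (simp add: \<theta>_def)
  have c\<theta>: "converges_on_disc (\<lambda>n. \<theta> n * u n)"
    using converges_on_disc_exponent[OF u, of \<rho>] u by (cases "\<epsilon> = 0") (auto simp: \<theta>_def)
  have c: "converges_on_disc (\<lambda>n. r * (\<theta> n * u n))"
    using converges_on_disc_lincomb[OF c\<theta> c\<theta>, of r 0] by simp
  have lr: "(h \<longlongrightarrow> l) (at_right 0)" if "(h \<longlongrightarrow> l) (at 0)" for h :: "real \<Rightarrow> real" and l
    using that by (simp add: filterlim_at_split)
  have "((\<lambda>y. (j y / y) / (tanh y / y)) \<longlongrightarrow> D / 1) (at 0)"
    using j(1) has_real_derivative_tanh_sech2[of 0]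
    by (intro tendsto_divide) (auto simp: has_field_derivative_iff j(2) sech2_def)
  then have "((\<lambda>y. r * ((j y / y) / (tanh y / y))) \<longlongrightarrow> r * (D / 1)) (at_right 0)"
    by (intro tendsto_mult[OF tendsto_const] lr)
  moreover have "\<forall>\<^sub>F y in at_right 0. r * ((j y / y) / (tanh y / y)) = sech_series \<rho> (\<lambda>n. r * (\<theta> n * u n)) y"
    unfolding eventually_at_filter
  proof (intro always_eventually allI impI)
    fix y :: real assume "y \<in> {0<..}"
    then have y: "y > 0" by simp
    have "sech_series \<rho> (\<lambda>n. r * (\<theta> n * u n)) y = r * sech_series \<rho> (\<lambda>n. \<theta> n * u n) y"
      using sech_series_lincomb[OF c\<theta> c\<theta> y, of \<rho> r 0] by simp
    then show "r * ((j y / y) / (tanh y / y)) = sech_series \<rho> (\<lambda>n. r * (\<theta> n * u n)) y"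
      using y by (simp add: j(3))
  qed
  ultimately have L: "(sech_series \<rho> (\<lambda>n. r * (\<theta> n * u n)) \<longlongrightarrow> r * (D / 1)) (at_right 0)"
    by (rule Lim_transform_eventually)
  have "summable (\<lambda>n. r * (\<theta> n * u n))"
  proof (rule summable_of_bounded_sech_series[OF c _ L])
    fix n assume "n \<ge> N"
    have "0 \<le> \<theta> n * (r * u n)" using r(2)[OF \<open>n \<ge> N\<close>] \<theta>pos[of n] by simp
    then show "0 \<le> r * (\<theta> n * u n)" by (simp add: mult_ac)
  qed
  then have "summable (\<lambda>n. r * (r * (\<theta> n * u n)))" by (rule summable_mult)
  moreover have "r * r = 1" using r(1) by (metis abs_mult_self_eq mult_1)
  ultimately show ?thesis by (simp flip: mult.assoc)
qed

text \<open>On \<open>y > 0\<close> a decaying solution is a multiple of the Frobenius solution. If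
  the multiple were nonzero, regularity at the origin would make both weighted coefficient sequences
  summable, against their growth.\<close>

lemma no_regular_decaying_solution:
  assumes sol: "solves f f' g g'"
    and lim: "(f \<longlongrightarrow> 0) at_top" "(f' \<longlongrightarrow> 0) at_top" "(g \<longlongrightarrow> 0) at_top"
    and reg0: "\<epsilon> = 0 \<Longrightarrow> f' 0 = 0 \<and> g' 0 = 0 \<and> (\<exists>D. (f' has_real_derivative D) (at 0)) \<and> (\<exists>D. (g' has_real_derivative D) (at 0))"
    and reg1: "\<epsilon> = 1 \<Longrightarrow> f 0 = 0 \<and> g 0 = 0 \<and> (\<exists>D. (f has_real_derivative D) (at 0)) \<and> (\<exists>D. (g has_real_derivative D) (at 0))"
    and y: "y > 0"
  shows "f y = 0 \<and> g y = 0"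
proof -
  have "((\<lambda>y. b * (b + 1) * sech2 y) \<longlongrightarrow> b * (b + 1) * 0) at_top"
    by (intro tendsto_intros sech2_at_top)
  then have e1: "\<forall>\<^sub>F y in at_top. b * (b + 1) * sech2 y < \<rho>\<^sup>2"
    by (rule order_tendstoD) (use \<rho> in simp)
  have "((\<lambda>y::real. (2 * b * (b + 1) * (1 - tanh y))\<^sup>2) \<longlongrightarrow> (2 * b * (b + 1) * (1 - 1))\<^sup>2) at_top"
    by (intro tendsto_intros tanh_real_at_top)
  then have e2: "\<forall>\<^sub>F y::real in at_top. (2 * b * (b + 1) * (1 - tanh y))\<^sup>2 < \<kappa>"
    by (rule order_tendstoD) (use \<kappa> in simp)
  have "\<forall>\<^sub>F y::real in at_top. y > 0 \<and> b * (b + 1) * sech2 y < \<rho>\<^sup>2 \<and>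
      (2 * b * (b + 1) * (1 - tanh y))\<^sup>2 < \<kappa> \<and> G y \<noteq> 0"
    using eventually_gt_at_top[of 0] e1 e2 G_eventually_nonzero by eventually_elim auto
  then obtain y1 where y1: "y1 > 0" "b * (b + 1) * sech2 y1 < \<rho>\<^sup>2"
      "(2 * b * (b + 1) * (1 - tanh y1))\<^sup>2 < \<kappa>" "G y1 \<noteq> 0"
    using eventually_happens'[OF trivial_limit_at_top_linorder] by blast
  \<comment> \<open>This makes \<open>g - k * G\<close> vanish at \<open>y1\<close>, the boundary
    condition of the maximum principle.\<close>
  define k where "k = g y1 / G y1"
  note S = solves_lincomb[OF sol F_solves, of k]
  have far: "f w - k * F w = 0 \<and> g w - k * G w = 0" if "w \<ge> y1" for w
  proof (rule decaying_solution_vanishes_near_infinity[OF S y1(1) _ _ _ _ y1(2,3) that])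
    show "g y1 - k * G y1 = 0" using y1(4) by (simp add: k_def)
    show "((\<lambda>y. f y - k * F y) \<longlongrightarrow> 0) at_top" "((\<lambda>y. f' y - k * F_deriv x y) \<longlongrightarrow> 0) at_top"
      "((\<lambda>y. g y - k * G y) \<longlongrightarrow> 0) at_top"
      using tendsto_diff[OF lim(1) tendsto_mult[OF tendsto_const solution_tendsto(1), of k]]
        tendsto_diff[OF lim(2) tendsto_mult[OF tendsto_const solution_tendsto(3), of k]]
        tendsto_diff[OF lim(3) tendsto_mult[OF tendsto_const solution_tendsto(2), of k]] by simp_all
  qed
  have unique: "d = 0" if h: "(h has_real_derivative d) (at w)" and w: "w \<in> U" "open U" "\<And>v. v \<in> U \<Longrightarrow> h v = 0"
    for h :: "real \<Rightarrow> real" and d w U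
  proof -
    have "((\<lambda>_. 0) has_real_derivative d) (at w)"
      by (rule has_field_derivative_transform_within_open[OF h w(2,1)]) (use w in auto)
    then show ?thesis using DERIV_unique[OF _ DERIV_const] by blast
  qed
  have eq: "f w = k * F w \<and> g w = k * G w" if w: "w > 0" for w
  proof (cases "w \<ge> y1")
    case False
    have p: "y1 + 1 > 0" using y1 by simp
    \<comment> \<open>Uniqueness starts from \<open>y1 + 1\<close> rather than \<open>y1\<close>:
      around an interior point of the half-line where the difference vanishes, its derivatives
      vanish too.\<close>
    have "f w - k * F w = 0 \<and> g w - k * G w = 0"
    proof (rule vanishing_solution_extends[OF S, of "y1 + 1"])
      show "f' (y1 + 1) - k * F_deriv x (y1 + 1) = 0"
        by (rule unique[OF solvesD(1)[OF S p], of "{y1<..}"]) (use far in auto)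
      show "g' (y1 + 1) - k * F_deriv z (y1 + 1) = 0"
        by (rule unique[OF solvesD(3)[OF S p], of "{y1<..}"]) (use far in auto)
    qed (use far[of "y1 + 1"] False w in auto)
    then show ?thesis by simp
  qed (use far in auto)
  have eq': "f' w = k * F_deriv x w \<and> g' w = k * F_deriv z w" if w: "w > 0" for w
  proof -
    have "f' w - k * F_deriv x w = 0"
      by (rule unique[OF solvesD(1)[OF S w], of "{0<..}"]) (use eq w in auto)
    moreover have "g' w - k * F_deriv z w = 0"
      by (rule unique[OF solvesD(3)[OF S w], of "{0<..}"]) (use eq w in auto)
    ultimately show ?thesis by simp
  qed
  have "k = 0"
  proof (rule ccontr)
    assume k: "k \<noteq> 0"
    obtain N r r' where r: "\<bar>r\<bar> = (1::real)" "\<bar>r'\<bar> = (1::real)" "\<forall>n\<ge>N. 0 \<le> r * x n \<and> 0 \<le> r' * z n"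
      using coeff_signs by blast
    define \<theta> where "\<theta> = (\<lambda>n. if \<epsilon> = 0 then s n else 1)"
    have "summable (\<lambda>n. \<theta> n * x n) \<and> summable (\<lambda>n. \<theta> n * z n)"
    proof (cases "\<epsilon> = 0")
      case True
      from reg0[OF this] obtain D D' where D: "(f' has_real_derivative D) (at 0)"
        "(g' has_real_derivative D') (at 0)" "f' 0 = 0" "g' 0 = 0" by blast
      have d: "((\<lambda>y. - (f' y / k)) has_real_derivative - (D / k)) (at 0)"
        "((\<lambda>y. - (g' y / k)) has_real_derivative - (D' / k)) (at 0)"
        by (intro DERIV_minus DERIV_cdivide D)+
      have v: "- (f' w / k) = tanh w * sech_series \<rho> (\<lambda>n. (if \<epsilon> = 0 then s n else 1) * x n) w"
        "- (g' w / k) = tanh w * sech_series \<rho> (\<lambda>n. (if \<epsilon> = 0 then s n else 1) * z n) w" if "w > 0" for w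
        unfolding F_deriv_def if_P[OF True] using eq'[OF that] k
        unfolding F_deriv_def if_P[OF True] by simp_all
      show ?thesis unfolding \<theta>_def
        by (intro conjI summable_of_regular_at_0[OF coeffs_converge(1) r(1) _ d(1) _ v(1)]
            summable_of_regular_at_0[OF coeffs_converge(2) r(2) _ d(2) _ v(2)]) (use r(3) D in auto)
    next
      case False
      then have e1: "\<epsilon> = 1" using \<epsilon> by simp
      from reg1[OF this] obtain D D' where D: "(f has_real_derivative D) (at 0)"
        "(g has_real_derivative D') (at 0)" "f 0 = 0" "g 0 = 0" by blast
      have d: "((\<lambda>y. f y / k) has_real_derivative D / k) (at 0)"
        "((\<lambda>y. g y / k) has_real_derivative D' / k) (at 0)"
        by (intro DERIV_cdivide D)+
      have v: "f w / k = tanh w * sech_series \<rho> (\<lambda>n. (if \<epsilon> = 0 then s n else 1) * x n) w"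
        "g w / k = tanh w * sech_series \<rho> (\<lambda>n. (if \<epsilon> = 0 then s n else 1) * z n) w" if "w > 0" for w
        using eq[OF that] k unfolding F_def G_def \<tau>_def if_not_P[OF False] by simp_all
      show ?thesis unfolding \<theta>_def
        by (intro conjI summable_of_regular_at_0[OF coeffs_converge(1) r(1) _ d(1) _ v(1)]
            summable_of_regular_at_0[OF coeffs_converge(2) r(2) _ d(2) _ v(2)]) (use r(3) D in auto)
    qed
    then show False using coeffs_not_summable unfolding \<theta>_def by blast
  qed
  then show ?thesis using eq[OF y] by simp
qed

end

lemma no_embedded_eigenfunction:
  assumes a: "0 < a" "a < 1" and \<mu>: "a\<^sup>2 < \<mu>"
    and v: "sobolev2 v v' v''" and u: "sobolev2 u u' u''"
    and eqv: "schroedinger (a\<^sup>2) (a * (a + 1)) v v'' = (\<lambda>y. \<mu> * u y)"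
    and equ: "schroedinger (a\<^sup>2) ((a + 1) * (a + 2)) u u'' = (\<lambda>y. \<mu> * v y)"
    and e: "e = 1 \<or> e = - (1::real)" and parity: "\<And>y. v (- y) = e * v y" "\<And>y. u (- y) = e * u y"
  shows "v y = 0 \<and> u y = 0"
proof -
  define \<kappa> where "\<kappa> = \<mu> - a\<^sup>2"
  define \<rho> where "\<rho> = sqrt (a\<^sup>2 + \<mu>)"
  define b where "b = a + 1"
  \<comment> \<open>Translates the sign \<open>e = 1\<close> or \<open>e = - 1\<close> of the parity
    into the exponent 0 or 1 of \<open>tanh\<close>.\<close>
  define \<epsilon> where "\<epsilon> = (1 - e) / 2"
  have mp: "\<mu> > 0" using \<mu> zero_le_power2[of a] by linarith
  have \<rho>2: "\<rho>\<^sup>2 = a\<^sup>2 + \<mu>" using mp by (simp add: \<rho>_def add_nonneg_nonneg)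
  have a\<rho>: "a < \<rho>" unfolding \<rho>_def by (rule real_less_rsqrt) (use mp in simp)
  interpret frobenius b \<kappa> \<rho> a \<epsilon>
    by unfold_locales (use a \<mu> a\<rho> e in \<open>auto simp: b_def \<kappa>_def \<epsilon>_def\<close>)
  have d: "(v has_real_derivative v' y) (at y)" "(v' has_real_derivative v'' y) (at y)"
    "(u has_real_derivative u' y) (at y)" "(u' has_real_derivative u'' y) (at y)" for y
    using v u by (auto simp: sobolev2_def)
  have v'': "v'' y = a\<^sup>2 * v y - a * (a + 1) * (sech2 y * v y) - \<mu> * u y" for y
    using fun_cong[OF eqv, of y] by (simp add: schroedinger_def)
  have u'': "u'' y = a\<^sup>2 * u y - (a + 1) * (a + 2) * (sech2 y * u y) - \<mu> * v y" for y
    using fun_cong[OF equ, of y] by (simp add: schroedinger_def)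
  define f where "f = (\<lambda>y. v y + u y)"
  define f' where "f' = (\<lambda>y. v' y + u' y)"
  define g where "g = (\<lambda>y. v y - u y)"
  define g' where "g' = (\<lambda>y. v' y - u' y)"
  have df: "(f has_real_derivative f' y) (at y)" "(g has_real_derivative g' y) (at y)"
    "(f' has_real_derivative v'' y + u'' y) (at y)" "(g' has_real_derivative v'' y - u'' y) (at y)" for y
    unfolding f_def f'_def g_def g'_def by (intro DERIV_add DERIV_diff d)+
  have sol: "solves f f' g g'"
    unfolding solves_def
  proof (intro allI impI conjI df)
    fix y
    have "v'' y + u'' y = - \<kappa> * f y - b * sech2 y * (b * f y - g y)"
      unfolding v'' u'' f_def g_def \<kappa>_def b_def by (simp add: algebra_simps)
    then show "(f' has_real_derivative - \<kappa> * f y - b * sech2 y * (b * f y - g y)) (at y)"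
      using df(3)[of y] by simp
    have "v'' y - u'' y = \<rho>\<^sup>2 * g y - b * sech2 y * (b * g y - f y)"
      unfolding v'' u'' f_def g_def \<rho>2 b_def by (simp add: algebra_simps)
    then show "(g' has_real_derivative \<rho>\<^sup>2 * g y - b * sech2 y * (b * g y - f y)) (at y)"
      using df(4)[of y] by simp
  qed
  note T = sobolev2_tendsto[OF v] sobolev2_tendsto[OF u]
  have lim: "(f \<longlongrightarrow> 0) at_top" "(f' \<longlongrightarrow> 0) at_top" "(g \<longlongrightarrow> 0) at_top"
    unfolding f_def f'_def g_def
    using tendsto_add[OF T(1) T(5)] tendsto_add[OF T(3) T(7)] tendsto_diff[OF T(1) T(5)] by simp_all
  have par: "f (- y) = e * f y" "g (- y) = e * g y" for y
    unfolding f_def g_def parity by (simp_all add: algebra_simps)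
  have pos: "f y = 0 \<and> g y = 0" if "y > 0" for y
  proof (rule no_regular_decaying_solution[OF sol lim _ _ that])
    assume "\<epsilon> = 0"
    then have "e = 1" by (simp add: \<epsilon>_def)
    then have "f' 0 = 0" "g' 0 = 0"
      using even_deriv_0[OF df(1)[of 0]] even_deriv_0[OF df(2)[of 0]] par by simp_all
    then show "f' 0 = 0 \<and> g' 0 = 0 \<and> (\<exists>D. (f' has_real_derivative D) (at 0)) \<and> (\<exists>D. (g' has_real_derivative D) (at 0))"
      using df(3,4)[of 0] by blast
  next
    assume "\<epsilon> = 1"
    then have "e = - 1" by (simp add: \<epsilon>_def)
    then have "f 0 = 0" "g 0 = 0" using par(1)[of 0] par(2)[of 0] by auto
    then show "f 0 = 0 \<and> g 0 = 0 \<and> (\<exists>D. (f has_real_derivative D) (at 0)) \<and> (\<exists>D. (g has_real_derivative D) (at 0))"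
      using df(1,2)[of 0] by blast
  qed
  have "f y = 0 \<and> g y = 0"
  proof (rule linorder_cases[of y 0])
    assume "y < 0"
    then show ?thesis using pos[of "- y"] par(1)[of "- y"] par(2)[of "- y"] by simp
  next
    assume y: "y = 0"
    \<comment> \<open>The system was used only for \<open>y > 0\<close>; the value at the origin
      follows by continuity.\<close>
    have z: "h 0 = 0" if "isCont h 0" "\<And>y. y > 0 \<Longrightarrow> h y = 0" for h :: "real \<Rightarrow> real"
    proof -
      have "(h \<longlongrightarrow> h 0) (at_right 0)" using that(1) by (simp add: isCont_def filterlim_at_split)
      moreover have "(h \<longlongrightarrow> 0) (at_right 0)"
        by (rule tendsto_eventually) (use that(2) in \<open>auto simp: eventually_at_filter\<close>)
      ultimately show ?thesis using tendsto_unique[OF trivial_limit_at_right_real] by blast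
    qed
    have "f 0 = 0" by (rule z[OF DERIV_isCont[OF df(1)]]) (use pos in blast)
    moreover have "g 0 = 0" by (rule z[OF DERIV_isCont[OF df(2)]]) (use pos in blast)
    ultimately show ?thesis by (simp add: y)
  qed (use pos in auto)
  then show ?thesis by (auto simp: f_def g_def)
qed

section \<open>Regularity of weak solutions\<close>

text \<open>The standard flat function \<open>exp (- (1 / x))\<close> with a polynomial in
  \<open>1 / x\<close> in front, which makes the family closed under differentiation.\<close>

definition flat_poly :: "real poly \<Rightarrow> real \<Rightarrow> real" where
  "flat_poly p x = (if x > 0 then poly p (1 / x) * exp (- (1 / x)) else 0)"

lemma poly_exp_tendsto_0: "((\<lambda>x::real. poly p x * exp (- x)) \<longlongrightarrow> 0) at_top"
proof -
  have "((\<lambda>x. \<Sum>i\<le>degree p. coeff p i * (x ^ i / exp x)) \<longlongrightarrow> (\<Sum>i\<le>degree p. coeff p i * 0)) at_top"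
    by (intro tendsto_intros tendsto_power_div_exp_0)
  moreover have "(\<Sum>i\<le>degree p. coeff p i * (x ^ i / exp x)) = poly p x * exp (- x)" for x
    by (simp add: poly_altdef sum_distrib_right exp_minus divide_inverse mult.assoc)
  ultimately show ?thesis by simp
qed

lemma flat_poly_tendsto_0: "(flat_poly p \<longlongrightarrow> 0) (at 0)"
proof -
  have "((\<lambda>x. poly p (inverse x) * exp (- inverse x)) \<longlongrightarrow> 0) (at_right 0)"
    by (rule filterlim_compose[OF poly_exp_tendsto_0 filterlim_inverse_at_top_right])
  then have "(flat_poly p \<longlongrightarrow> 0) (at_right 0)"
    by (rule Lim_transform_eventually) (auto simp: flat_poly_def eventually_at_filter inverse_eq_divide)
  moreover have "(flat_poly p \<longlongrightarrow> 0) (at_left 0)"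
    by (rule tendsto_eventually) (auto simp: flat_poly_def eventually_at_filter)
  ultimately show ?thesis by (simp add: filterlim_at_split)
qed

lemma flat_poly_deriv:
  "(flat_poly p has_real_derivative flat_poly ([:0, 0, 1:] * (p - pderiv p)) x) (at x)"
proof (cases x "0::real" rule: linorder_cases)
  case less
  have "((\<lambda>_. 0) has_real_derivative 0) (at x)" by simp
  then have "(flat_poly p has_real_derivative 0) (at x)"
    by (rule has_field_derivative_transform_within_open[where S="{..<0}"]) (use less in \<open>auto simp: flat_poly_def\<close>)
  then show ?thesis using less by (simp add: flat_poly_def)
next
  case equal
  \<comment> \<open>At the origin the difference quotient is again a member of the family: division
    by \<open>h\<close> raises the power of \<open>1 / h\<close> by one.\<close>
  have "((\<lambda>h. flat_poly ([:0, 1:] * p) h) \<longlongrightarrow> 0) (at 0)" by (rule flat_poly_tendsto_0)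
  moreover have "flat_poly ([:0, 1:] * p) h = (flat_poly p h - flat_poly p 0) / (h - 0)" for h
    by (simp add: flat_poly_def)
  ultimately show ?thesis unfolding equal has_field_derivative_iff by (simp add: flat_poly_def)
next
  case greater
  have "((\<lambda>x. 1 / x) has_real_derivative - (1 / x\<^sup>2)) (at x)"
    using greater by (auto intro!: derivative_eq_intros simp: power2_eq_square)
  note i = this
  have "((\<lambda>x. poly p (1 / x) * exp (- (1 / x))) has_real_derivative
      poly (pderiv p) (1 / x) * - (1 / x\<^sup>2) * exp (- (1 / x)) + exp (- (1 / x)) * (- (- (1 / x\<^sup>2))) * poly p (1 / x)) (at x)"
    by (intro DERIV_mult DERIV_chain2[OF poly_DERIV i] DERIV_fun_exp DERIV_minus i)
  then have "((\<lambda>x. poly p (1 / x) * exp (- (1 / x))) has_real_derivative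
      flat_poly ([:0, 0, 1:] * (p - pderiv p)) x) (at x)"
    by (rule DERIV_cong) (use greater in \<open>simp add: flat_poly_def algebra_simps power2_eq_square\<close>)
  then show ?thesis
    by (rule has_field_derivative_transform_within_open[where S="{0<..}"]) (use greater in \<open>auto simp: flat_poly_def\<close>)
qed

inductive flat_algebra :: "(real \<Rightarrow> real) \<Rightarrow> bool" where
  base: "flat_algebra (\<lambda>x. flat_poly p (c * x + d))"
| add: "flat_algebra f \<Longrightarrow> flat_algebra g \<Longrightarrow> flat_algebra (\<lambda>x. f x + g x)"
| mult: "flat_algebra f \<Longrightarrow> flat_algebra g \<Longrightarrow> flat_algebra (\<lambda>x. f x * g x)"
| scale: "flat_algebra f \<Longrightarrow> flat_algebra (\<lambda>x. c * f x)"

lemma flat_algebra_deriv: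
  "flat_algebra f \<Longrightarrow> \<exists>f'. flat_algebra f' \<and> (\<forall>x. (f has_real_derivative f' x) (at x))"
proof (induction rule: flat_algebra.induct)
  case (base p c d)
  have "((\<lambda>x. flat_poly p (c * x + d)) has_real_derivative c * flat_poly ([:0, 0, 1:] * (p - pderiv p)) (c * x + d)) (at x)" for x
    by (rule DERIV_cong[OF DERIV_chain2[OF flat_poly_deriv]]) (auto intro!: derivative_eq_intros)
  then show ?case by (intro exI[of _ "\<lambda>x. c * flat_poly ([:0, 0, 1:] * (p - pderiv p)) (c * x + d)"])
    (auto intro: flat_algebra.intros)
next
  case (add f g)
  then obtain f' g' where "flat_algebra f'" "\<forall>x. (f has_real_derivative f' x) (at x)"
    "flat_algebra g'" "\<forall>x. (g has_real_derivative g' x) (at x)" by blast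
  then show ?case by (intro exI[of _ "\<lambda>x. f' x + g' x"]) (auto intro: flat_algebra.intros intro!: DERIV_add)
next
  case (mult f g)
  then obtain f' g' where "flat_algebra f'" "\<forall>x. (f has_real_derivative f' x) (at x)"
    "flat_algebra g'" "\<forall>x. (g has_real_derivative g' x) (at x)" by blast
  with mult show ?case
    by (intro exI[of _ "\<lambda>x. f' x * g x + g' x * f x"]) (auto intro: flat_algebra.intros intro!: DERIV_mult)
next
  case (scale f c)
  then obtain f' where "flat_algebra f'" "\<forall>x. (f has_real_derivative f' x) (at x)" by blast
  then show ?case by (intro exI[of _ "\<lambda>x. c * f' x"]) (auto intro: flat_algebra.intros intro!: DERIV_cmult)
qed

lemma flat_algebra_continuous: "flat_algebra f \<Longrightarrow> continuous_on A f"
  using flat_algebra_deriv[of f] by (metis DERIV_isCont continuous_at_imp_continuous_on)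

lemma flat_algebra_smooth: "flat_algebra f \<Longrightarrow> (deriv ^^ n) f differentiable at x"
proof (induction n arbitrary: f)
  case 0
  then obtain f' where "(f has_real_derivative f' x) (at x)" using flat_algebra_deriv by blast
  then show ?case by (auto simp: real_differentiable_def)
next
  case (Suc n)
  then obtain f' where f': "flat_algebra f'" "\<And>x. (f has_real_derivative f' x) (at x)"
    using flat_algebra_deriv by blast
  have "deriv f = f'" using f'(2) by (auto intro: DERIV_imp_deriv)
  then show ?case using Suc.IH[OF f'(1)] by (simp add: funpow_swap1)
qed

text \<open>Only the derivative has to belong to the algebra, as \<open>\<phi>\<close> will be an
  antiderivative and need not be an algebraic expression in flat functions.\<close>

lemma test_function_of_flat_derivative:
  assumes \<eta>: "flat_algebra \<eta>" and d: "\<And>x. (\<phi> has_real_derivative \<eta> x) (at x)"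
    and supp: "\<And>x. x \<notin> {A..B} \<Longrightarrow> \<phi> x = 0"
  shows "\<phi> \<in> test_functions" "deriv \<phi> = \<eta>"
proof -
  show dd: "deriv \<phi> = \<eta>" using d by (auto intro: DERIV_imp_deriv)
  have "(deriv ^^ n) \<phi> differentiable at x" for n x
  proof (cases n)
    case 0
    then show ?thesis using d by (auto simp: real_differentiable_def)
  next
    case (Suc m)
    then show ?thesis using flat_algebra_smooth[OF \<eta>, of m x] by (simp add: funpow_swap1 dd)
  qed
  moreover have "bounded {x. \<phi> x \<noteq> 0}"
    by (rule bounded_subset[OF bounded_closed_interval[of A B]]) (use supp in blast)
  ultimately show "\<phi> \<in> test_functions" by (simp add: test_functions_def compact_closure)
qed

text \<open>A bump on the open interval from \<open>a\<close> to \<open>b\<close> whose exponents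
  \<open>1 / (Suc n * distance)\<close> tend to 0: it stays below the indicator of the interval and
  converges to it off the endpoints.\<close>

definition plateau :: "real \<Rightarrow> real \<Rightarrow> nat \<Rightarrow> real \<Rightarrow> real" where
  "plateau a b n x = flat_poly 1 (real (Suc n) * x + - (real (Suc n) * a)) * flat_poly 1 (- real (Suc n) * x + real (Suc n) * b)"

lemma plateau_flat: "flat_algebra (plateau a b n)"
  unfolding plateau_def[abs_def] by (intro flat_algebra.intros)

lemma plateau_eq:
  "plateau a b n x = (if a < x \<and> x < b then
     exp (- (1 / (real (Suc n) * (x - a)))) * exp (- (1 / (real (Suc n) * (b - x)))) else 0)"
proof -
  have e: "real (Suc n) * x + - (real (Suc n) * a) = real (Suc n) * (x - a)"
    "- real (Suc n) * x + real (Suc n) * b = real (Suc n) * (b - x)"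
    by (simp_all add: algebra_simps)
  have "0 < real (Suc n) * (x - a) \<longleftrightarrow> a < x" "0 < real (Suc n) * (b - x) \<longleftrightarrow> x < b"
    by (simp_all add: zero_less_mult_iff del: of_nat_Suc)
  then show ?thesis unfolding plateau_def flat_poly_def e by (simp del: of_nat_Suc)
qed

lemma plateau_bounds: "0 \<le> plateau a b n x" "plateau a b n x \<le> indicator {a..b} x"
  "\<bar>plateau a b n x\<bar> \<le> indicator {a..b} x"
proof -
  show 0: "0 \<le> plateau a b n x" by (simp add: plateau_eq)
  show 1: "plateau a b n x \<le> indicator {a..b} x"
  proof (cases "a < x \<and> x < b")
    case True
    then have "exp (- (1 / (real (Suc n) * (x - a)))) \<le> 1" "exp (- (1 / (real (Suc n) * (b - x)))) \<le> 1"
      by (simp_all del: of_nat_Suc)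
    then show ?thesis using True by (simp add: plateau_eq mult_le_one del: of_nat_Suc)
  qed (auto simp: plateau_eq)
  show "\<bar>plateau a b n x\<bar> \<le> indicator {a..b} x" using 0 1 by simp
qed

lemma plateau_tendsto:
  assumes "x \<noteq> a" "x \<noteq> b"
  shows "(\<lambda>n. plateau a b n x) \<longlonglongrightarrow> indicator {a..b} x"
proof (cases "a < x \<and> x < b")
  case True
  have *: "(\<lambda>n. exp (- (1 / (real (Suc n) * c)))) \<longlonglongrightarrow> 1" if "c > 0" for c :: real
  proof -
    have "(\<lambda>n. exp (- (inverse c * inverse (real (Suc n))))) \<longlonglongrightarrow> exp (- (inverse c * 0))"
      by (intro tendsto_intros LIMSEQ_inverse_real_of_nat)
    then show ?thesis by (simp add: field_simps)
  qed
  have "(\<lambda>n. exp (- (1 / (real (Suc n) * (x - a)))) * exp (- (1 / (real (Suc n) * (b - x))))) \<longlonglongrightarrow> 1 * 1"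
    by (intro tendsto_mult *) (use True in auto)
  then show ?thesis using True by (simp add: plateau_eq)
next
  case False
  then show ?thesis using assms by (auto simp: plateau_eq indicator_def)
qed

section \<open>Locally integrable functions and their antiderivatives\<close>

definition locally_integrable :: "(real \<Rightarrow> real) \<Rightarrow> bool" where
  "locally_integrable g \<longleftrightarrow> g \<in> borel_measurable borel \<and> (\<forall>A B. set_integrable lborel {A..B} g)"

lemma locally_integrableD: "locally_integrable g \<Longrightarrow> set_integrable lborel {A..B} g"
  by (simp add: locally_integrable_def)

lemma locally_integrable_continuous:
  assumes "continuous_on UNIV g"
  shows "locally_integrable g"
  unfolding locally_integrable_def
  using assms by (auto intro: borel_measurable_continuous_onI borel_integrable_atLeastAtMost'
      continuous_on_subset)

lemma locally_integrable_square_integrable: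
  assumes [measurable]: "g \<in> borel_measurable borel" and i: "integrable lborel (\<lambda>x. (g x)\<^sup>2)"
  shows "locally_integrable g"
  unfolding locally_integrable_def
proof (intro conjI allI assms(1))
  fix A B :: real
  have "set_integrable lborel {A..B} (\<lambda>x. 1 + (g x)\<^sup>2)"
  proof (rule set_integral_add)
    show "set_integrable lborel {A..B} (\<lambda>_. 1 :: real)"
      by (rule locally_integrableD[OF locally_integrable_continuous[OF continuous_on_const]])
    show "set_integrable lborel {A..B} (\<lambda>x. (g x)\<^sup>2)"
      unfolding set_integrable_def by (rule integrable_mult_indicator[OF _ i]) simp
  qed
  then show "set_integrable lborel {A..B} g"
  proof (rule set_integrable_bound)
    have "\<bar>t\<bar> \<le> 1 + t\<^sup>2" for t :: real
    proof -
      have "0 \<le> (\<bar>t\<bar> - 1)\<^sup>2" by simp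
      then show ?thesis using abs_ge_zero[of t] by (simp add: power2_eq_square algebra_simps)
    qed
    then show "AE x in lborel. x \<in> {A..B} \<longrightarrow> norm (g x) \<le> norm (1 + (g x)\<^sup>2)" by simp
  qed (auto simp: set_borel_measurable_def)
qed

lemma locally_integrable_diff:
  assumes "locally_integrable f" "locally_integrable g"
  shows "locally_integrable (\<lambda>x. f x - g x)"
  using assms by (auto simp: locally_integrable_def intro!: set_integral_diff borel_measurable_diff)

lemma locally_integrable_split:
  assumes g: "locally_integrable g" and xyz: "A \<le> x" "x \<le> y"
  shows "(LINT t:{A..y}|lborel. g t) = (LINT t:{A..x}|lborel. g t) + (LINT t:{x..y}|lborel. g t)"
proof -
  have i: "set_integrable lborel {x<..y} g"
    by (rule set_integrable_subset[OF locally_integrableD[OF g, of x y]]) auto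
  have [measurable]: "g \<in> borel_measurable borel" using g by (simp add: locally_integrable_def)
  have "{A..y} = {A..x} \<union> {x<..y}" using xyz by auto
  then have "(LINT t:{A..y}|lborel. g t) = (LINT t:{A..x}|lborel. g t) + (LINT t:{x<..y}|lborel. g t)"
    by (simp only:) (rule set_integral_Un[OF _ locally_integrableD[OF g] i], auto)
  moreover have "(LINT t:{x<..y}|lborel. g t) = (LINT t:{x..y}|lborel. g t)"
    unfolding set_lebesgue_integral_def
    by (rule integral_cong_AE) (auto simp: indicator_def intro!: AE_I[where N="{x}"])
  ultimately show ?thesis by simp
qed

text \<open>After truncation to a bounded interval, the positive and the negative part are densities
  of finite measures that agree on all half-lines, hence agree; densities of a finite measure are
  unique almost everywhere.\<close>

lemma AE_zero_of_interval_integrals: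
  assumes g: "locally_integrable g" and z: "\<And>a b. a < b \<Longrightarrow> (LINT t:{a..b}|lborel. g t) = 0"
  shows "AE x in lborel. g x = 0"
proof -
  have [measurable]: "g \<in> borel_measurable borel" using g by (simp add: locally_integrable_def)
  have *: "AE x in lborel. indicator {- real N..real N} x * g x = 0" for N :: nat
  proof -
    define k where "k = (\<lambda>x. indicator {- real N..real N} x * g x)"
    have [measurable]: "k \<in> borel_measurable borel" unfolding k_def by measurable
    have ik: "integrable lborel k"
      using locally_integrableD[OF g, of "- real N" "real N"] by (simp add: k_def set_integrable_def)
    define kp where "kp = (\<lambda>x. max 0 (k x))"
    define km where "km = (\<lambda>x. max 0 (- k x))"
    have ip: "integrable lborel kp" "integrable lborel km" unfolding kp_def km_def using ik by auto
    have zero: "(LBINT t. indicator {x<..} t * k t) = 0" for x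
    proof -
      let ?m = "max x (- real N)"
      have "(LBINT t. indicator {x<..} t * k t) = (LINT t:{?m..real N}|lborel. g t)"
        unfolding set_lebesgue_integral_def
        by (rule integral_cong_AE) (auto simp: k_def indicator_def intro!: AE_I[where N="{x}"] split: if_splits)
      also have "\<dots> = 0"
      proof (cases "?m < real N")
        case False
        then have "{?m..real N} \<subseteq> {real N}" by auto
        then show ?thesis unfolding set_lebesgue_integral_def
          by (intro integral_eq_zero_AE AE_I[where N="{real N}"]) (auto simp: indicator_def)
      qed (rule z)
      finally show ?thesis .
    qed
    have em: "emeasure (density lborel (\<lambda>x. ennreal (h x))) {x<..} = ennreal (LBINT t. indicator {x<..} t * h t)"
      if "integrable lborel h" "\<And>x. 0 \<le> h x" for h :: "real \<Rightarrow> real" and x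
    proof -
      have [measurable]: "h \<in> borel_measurable borel" using that(1) by auto
      have "emeasure (density lborel (\<lambda>x. ennreal (h x))) {x<..} = (\<integral>\<^sup>+ t. ennreal (indicator {x<..} t * h t) \<partial>lborel)"
        by (subst emeasure_density) (auto intro!: nn_integral_cong simp: indicator_def)
      also have "\<dots> = ennreal (LBINT t. indicator {x<..} t * h t)"
      proof (rule nn_integral_eq_integral)
        show "integrable lborel (\<lambda>t. indicator {x<..} t * h t)"
          using integrable_real_mult_indicator[OF _ that(1), of "{x<..}"] by (simp add: mult.commute)
      qed (use that in auto)
      finally show ?thesis .
    qed
    have "density lborel (\<lambda>x. ennreal (kp x)) = density lborel (\<lambda>x. ennreal (km x))"
    proof (rule measure_eqI_lessThan)
      fix x
      have nn: "0 \<le> kp x" "0 \<le> km x" for x by (auto simp: kp_def km_def)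
      show "emeasure (density lborel (\<lambda>x. ennreal (kp x))) {x<..} < \<infinity>"
        by (simp add: em[OF ip(1) nn(1)])
      have "(LBINT t. indicator {x<..} t * kp t) - (LBINT t. indicator {x<..} t * km t)
          = (LBINT t. indicator {x<..} t * kp t - indicator {x<..} t * km t)"
        using integrable_real_mult_indicator[OF _ ip(1), of "{x<..}"] integrable_real_mult_indicator[OF _ ip(2), of "{x<..}"]
        by (subst Bochner_Integration.integral_diff) (simp_all add: mult.commute)
      also have "\<dots> = (LBINT t. indicator {x<..} t * k t)"
        by (intro Bochner_Integration.integral_cong) (auto simp: kp_def km_def indicator_def)
      finally show "emeasure (density lborel (\<lambda>x. ennreal (kp x))) {x<..} = emeasure (density lborel (\<lambda>x. ennreal (km x))) {x<..}"
        unfolding em[OF ip(1) nn(1)] em[OF ip(2) nn(2)] zero by simp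
    qed simp_all
    then have "AE x in lborel. ennreal (kp x) = ennreal (km x)"
    proof (rule finite_density_unique[THEN iffD1, rotated -1])
      show "(\<integral>\<^sup>+ x. ennreal (kp x) \<partial>lborel) \<noteq> \<infinity>"
        by (subst nn_integral_eq_integral[OF ip(1)]) (auto simp: kp_def)
    qed (use ip in auto)
    then show ?thesis
    proof eventually_elim
      case (elim x)
      then show ?case unfolding kp_def km_def k_def[symmetric] fun_cong[OF k_def, symmetric]
        by (auto simp: max_def split: if_splits)
    qed
  qed
  have "AE x in lborel. \<forall>N::nat. indicator {- real N..real N} x * g x = 0"
    unfolding AE_all_countable by (intro allI *)
  then show ?thesis
  proof eventually_elim
    case (elim x)
    obtain N :: nat where "\<bar>x\<bar> \<le> real N" using real_arch_simple by blast
    then show ?case using spec[OF elim, of N] by (auto simp: indicator_def)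
  qed
qed

lemma lower_integral_outside:
  fixes \<eta> :: "real \<Rightarrow> real"
  assumes "(LBINT s. \<eta> s) = 0" "\<And>s. s \<notin> {A..B} \<Longrightarrow> \<eta> s = 0" "t \<notin> {A..B}"
  shows "(LINT s:{..t}|lborel. \<eta> s) = 0"
proof (cases "t < A")
  case True
  then have "(\<lambda>s. indicator {..t} s *\<^sub>R \<eta> s) = (\<lambda>_. 0)"
    using assms(2) by (auto simp: indicator_def fun_eq_iff)
  then show ?thesis by (simp only: set_lebesgue_integral_def Bochner_Integration.integral_zero)
next
  case False
  then have "(\<lambda>s. indicator {..t} s *\<^sub>R \<eta> s) = \<eta>"
    using assms(2,3) by (auto simp: indicator_def fun_eq_iff)
  then show ?thesis using assms(1) by (simp only: set_lebesgue_integral_def)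
qed

text \<open>As \<open>G\<close> is only absolutely continuous, Fubini's theorem replaces integration by parts.\<close>

lemma fubini_by_parts:
  fixes \<eta> g :: "real \<Rightarrow> real"
  assumes \<eta>: "integrable lborel \<eta>" "(LBINT s. \<eta> s) = 0" "\<And>s. s \<notin> {A..B} \<Longrightarrow> \<eta> s = 0"
    and g: "locally_integrable g"
    and G: "\<And>x y. x \<le> y \<Longrightarrow> G y - G x = (LINT t:{x..y}|lborel. g t)"
  shows "integrable lborel (\<lambda>s. \<eta> s * G s)"
    and "(LBINT t. (LINT s:{..t}|lborel. \<eta> s) * g t) = - (LBINT s. \<eta> s * G s)"
proof -
  have [measurable]: "g \<in> borel_measurable borel" using g by (simp add: locally_integrable_def)
  have [measurable]: "\<eta> \<in> borel_measurable borel" using \<eta>(1) by auto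
  \<comment> \<open>\<open>g\<close> is only locally integrable, so Fubini's theorem is applied to
    its truncation. Nothing is lost, since the lower integral of \<open>\<eta>\<close> vanishes off
    \<open>{A..B}\<close>.\<close>
  define gg where "gg = (\<lambda>t. indicator {A..B} t * g t)"
  have [measurable]: "gg \<in> borel_measurable borel" unfolding gg_def by measurable
  have igg: "integrable lborel gg"
    using locally_integrableD[OF g, of A B] by (simp add: gg_def set_integrable_def)
  define K where "K = (\<lambda>s t. if s \<le> t then \<eta> s * gg t else 0)"
  have iK: "integrable (lborel \<Otimes>\<^sub>M lborel) (\<lambda>(s, t). K s t)"
  proof (rule Bochner_Integration.integrable_bound)
    show "integrable (lborel \<Otimes>\<^sub>M lborel) (\<lambda>(s, t). \<eta> s * gg t)"
    proof (rule lborel_pair.Fubini_integrable)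
      show "integrable lborel (\<lambda>s. LBINT t. norm (case (s, t) of (s, t) \<Rightarrow> \<eta> s * gg t))"
        using \<eta>(1) by (simp add: abs_mult)
      show "AE s in lborel. integrable lborel (\<lambda>t. case (s, t) of (s, t) \<Rightarrow> \<eta> s * gg t)"
        using igg by simp
    qed measurable
    show "(\<lambda>(s, t). K s t) \<in> borel_measurable (lborel \<Otimes>\<^sub>M lborel)" unfolding K_def by measurable
    show "AE p in lborel \<Otimes>\<^sub>M lborel. norm (case p of (s, t) \<Rightarrow> K s t) \<le> norm (case p of (s, t) \<Rightarrow> \<eta> s * gg t)"
      by (auto simp: K_def)
  qed
  note F = lborel_pair.Fubini_integral[OF iK]
  have K1: "(LBINT s. K s t) = (LINT s:{..t}|lborel. \<eta> s) * gg t" for t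
  proof -
    have "(LBINT s. K s t) = (LBINT s. (indicator {..t} s * \<eta> s) * gg t)"
      by (rule Bochner_Integration.integral_cong) (auto simp: K_def indicator_def)
    then show ?thesis by (simp add: set_lebesgue_integral_def)
  qed
  have K2: "(LBINT t. K s t) = \<eta> s * (G B - G s)" for s
  proof (cases "s \<in> {A..B}")
    case True
    have "(LBINT t. K s t) = (LBINT t. \<eta> s * (indicator {s..B} t *\<^sub>R g t))"
      by (rule Bochner_Integration.integral_cong) (use True in \<open>auto simp: K_def gg_def indicator_def\<close>)
    also have "\<dots> = \<eta> s * (LINT t:{s..B}|lborel. g t)" by (simp add: set_lebesgue_integral_def)
    finally show ?thesis using G[of s B] True by simp
  next
    case False
    then have "\<eta> s = 0" by (rule \<eta>(3))
    then have "K s t = 0" for t by (simp add: K_def)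
    then show ?thesis using \<open>\<eta> s = 0\<close> by simp
  qed
  have i2: "integrable lborel (\<lambda>s. \<eta> s * (G B - G s))"
    using lborel_pair.integrable_fst[OF iK] unfolding K2 .
  have "integrable lborel (\<lambda>s. \<eta> s * G B - \<eta> s * (G B - G s))"
    using \<eta>(1) i2 by auto
  then show iG: "integrable lborel (\<lambda>s. \<eta> s * G s)" by (simp add: algebra_simps)
  have out: "(LINT s:{..t}|lborel. \<eta> s) * gg t = (LINT s:{..t}|lborel. \<eta> s) * g t" for t
  proof (cases "t \<in> {A..B}")
    case False
    have "(LINT s:{..t}|lborel. \<eta> s) = 0"
      by (rule lower_integral_outside[OF \<eta>(2) _ False]) (rule \<eta>(3))
    then show ?thesis by simp
  qed (simp add: gg_def)
  have "(LBINT t. (LINT s:{..t}|lborel. \<eta> s) * g t) = (LBINT t. LBINT s. K s t)"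
    unfolding K1 out ..
  also have "\<dots> = (LBINT s. LBINT t. K s t)" using F by simp
  also have "\<dots> = (LBINT s. G B * \<eta> s - \<eta> s * G s)" unfolding K2 by (simp add: algebra_simps)
  also have "\<dots> = - (LBINT s. \<eta> s * G s)" using \<eta> iG by simp
  finally show "(LBINT t. (LINT s:{..t}|lborel. \<eta> s) * g t) = - (LBINT s. \<eta> s * G s)" .
qed

lemma locally_integrable_antiderivative:
  assumes g: "locally_integrable g"
  obtains G where "continuous_on UNIV G" "\<And>x y. x \<le> y \<Longrightarrow> G y - G x = (LINT t:{x..y}|lborel. g t)"
proof -
  \<comment> \<open>The oriented integral from 0 to \<open>x\<close>: one of the two intervals is
    empty, or both are the point 0.\<close>
  define G where "G = (\<lambda>x. (LINT t:{0..x}|lborel. g t) - (LINT t:{x..0}|lborel. g t))"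
  have deg: "(LINT t:{x..y}|lborel. g t) = 0" if "y \<le> x" for x y
  proof (cases "x = y")
    case True
    have [measurable]: "g \<in> borel_measurable borel" using g by (simp add: locally_integrable_def)
    show ?thesis unfolding True set_lebesgue_integral_def
      by (intro integral_eq_zero_AE AE_I[where N="{y}"]) (auto simp: indicator_def)
  qed (use that in \<open>simp add: set_lebesgue_integral_def\<close>)
  have base: "G x = (LINT t:{A..x}|lborel. g t) - (LINT t:{A..0}|lborel. g t)" if "A \<le> x" "A \<le> 0" for A x
  proof (cases "0 \<le> x")
    case True
    then show ?thesis using locally_integrable_split[OF g that(2) True] deg[of 0 x] by (simp add: G_def)
  next
    case False
    then have "x \<le> 0" by simp
    from locally_integrable_split[OF g that(1) this] show ?thesis
      using deg[of x 0] False by (simp add: G_def)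
  qed
  have diff: "G y - G x = (LINT t:{x..y}|lborel. g t)" if "x \<le> y" for x y
    using base[of "min x 0" x] base[of "min x 0" y] locally_integrable_split[OF g, of "min x 0" x y] that
    by simp
  have "continuous_on {-N<..<N} G" for N
  proof -
    have i: "set_integrable lborel {-N..N} g" by (rule locally_integrableD[OF g])
    have "continuous_on {-N..N} (\<lambda>x. integral {-N..x} g)"
      using set_borel_integral_eq_integral(1)[OF i] by (rule indefinite_integral_continuous_1)
    then have "continuous_on {-N..N} (\<lambda>x. G (-N) + integral {-N..x} g)" by (intro continuous_intros)
    moreover have "G (-N) + integral {-N..x} g = G x" if "x \<in> {-N..N}" for x
      using diff[of "-N" x] set_borel_integral_eq_integral(2)[OF locally_integrableD[OF g, of "-N" x]] that by simp
    ultimately have "continuous_on {-N..N} G" by (subst continuous_on_cong[OF refl, symmetric]) auto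
    then show ?thesis by (rule continuous_on_subset) auto
  qed
  then have "isCont G x" for x
    by (rule continuous_on_interior[of "{- (\<bar>x\<bar> + 1)<..<\<bar>x\<bar> + 1}"])
      (auto simp: interior_open simp del: minus_add_distrib)
  then have "continuous_on UNIV G" by (simp add: continuous_at_imp_continuous_on)
  then show ?thesis using diff that by blast
qed

lemma plateau_integral_tendsto:
  assumes g: "locally_integrable g"
  shows "integrable lborel (\<lambda>x. plateau a b n x * g x)"
    and "(\<lambda>n. LBINT x. plateau a b n x * g x) \<longlonglongrightarrow> (LINT t:{a..b}|lborel. g t)"
proof -
  have [measurable]: "g \<in> borel_measurable borel" using g by (simp add: locally_integrable_def)
  have [measurable]: "plateau a b n \<in> borel_measurable borel" for n
    by (intro borel_measurable_continuous_onI flat_algebra_continuous plateau_flat)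
  have i: "integrable lborel (\<lambda>x. indicator {a..b} x * g x)"
    using locally_integrableD[OF g, of a b] by (simp add: set_integrable_def)
  have b: "norm (plateau a b n x * g x) \<le> norm (indicator {a..b} x * g x)" for n x
    using plateau_bounds(3)[of a b n x] by (auto simp: abs_mult intro!: mult_right_mono)
  show "integrable lborel (\<lambda>x. plateau a b n x * g x)"
    by (rule Bochner_Integration.integrable_bound[OF i]) (use b in auto)
  show "(\<lambda>n. LBINT x. plateau a b n x * g x) \<longlonglongrightarrow> (LINT t:{a..b}|lborel. g t)"
    unfolding set_lebesgue_integral_def real_scaleR_def
  proof (rule integral_dominated_convergence[where w="\<lambda>x. norm (indicator {a..b} x * g x)"])
    show "AE x in lborel. (\<lambda>n. plateau a b n x * g x) \<longlonglongrightarrow> indicator {a..b} x * g x"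
    proof (rule AE_I[where N="{a, b}"])
      have "emeasure lborel {a, b} \<le> emeasure lborel {a} + emeasure lborel {b}"
        using emeasure_subadditive[of "{a}" lborel "{b}"] by (simp add: insert_commute)
      then show "emeasure lborel {a, b} = 0" by simp
      show "{x \<in> space lborel. \<not> (\<lambda>n. plateau a b n x * g x) \<longlonglongrightarrow> indicator {a..b} x * g x} \<subseteq> {a, b}"
        using plateau_tendsto[of _ a b] by (auto intro!: tendsto_mult)
    qed simp
    show "integrable lborel (\<lambda>x. norm (indicator {a..b} x * g x))" using i by (rule integrable_norm)
  qed (use b in auto)
qed

text \<open>The lemma of du Bois-Reymond.\<close>

lemma weak_antiderivative:
  assumes f: "locally_integrable f" and g: "locally_integrable g"
    and weak: "\<And>\<eta> \<phi> A B. flat_algebra \<eta> \<Longrightarrow> (\<And>x. (\<phi> has_real_derivative \<eta> x) (at x)) \<Longrightarrow>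
      (\<And>x. x \<notin> {A..B} \<Longrightarrow> \<eta> x = 0) \<Longrightarrow> (\<And>x. x \<notin> {A..B} \<Longrightarrow> \<phi> x = 0) \<Longrightarrow>
      (LBINT x. \<eta> x * f x) = - (LBINT x. \<phi> x * g x)"
  obtains F where "continuous_on UNIV F" "\<And>x y. x \<le> y \<Longrightarrow> F y - F x = (LINT t:{x..y}|lborel. g t)"
    "AE x in lborel. f x = F x"
proof -
  obtain G where G: "continuous_on UNIV G" "\<And>x y. x \<le> y \<Longrightarrow> G y - G x = (LINT t:{x..y}|lborel. g t)"
    by (rule locally_integrable_antiderivative[OF g]) blast
  \<comment> \<open>The aim is that \<open>w\<close> is constant almost everywhere; this follows
    once its mean over every interval equals its mean over \<open>{0..1}\<close>.\<close>
  define w where "w = (\<lambda>x. f x - G x)"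
  have lG: "locally_integrable G" by (rule locally_integrable_continuous[OF G(1)])
  have lw: "locally_integrable w" unfolding w_def by (rule locally_integrable_diff[OF f lG])
  have l1: "locally_integrable (\<lambda>_. 1)" by (rule locally_integrable_continuous) simp
  have meas: "(LINT t:{a..b}|lborel. (1::real)) = b - a" if "a < b" for a b :: real
    using that by (simp add: set_lebesgue_integral_def)
  note P = plateau_integral_tendsto
  have key: "(LINT t:{a..b}|lborel. w t) = (b - a) * (LINT t:{0..1}|lborel. w t)" if ab: "a < b" for a b
  proof -
    define \<alpha> where "\<alpha> n = (LBINT x. plateau a b n x * 1)" for n
    define \<beta> where "\<beta> n = (LBINT x. plateau 0 1 n x * 1)" for n
    have eq: "\<beta> n * (LBINT x. plateau a b n x * w x) = \<alpha> n * (LBINT x. plateau 0 1 n x * w x)" for n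
    proof -
      \<comment> \<open>Weighted with each other's integrals, the two bumps combine to a function of
        mean zero, whose lower integral has compact support and so is an admissible test
        function.\<close>
      define \<eta> where "\<eta> = (\<lambda>x. \<beta> n * plateau a b n x + (- \<alpha> n) * plateau 0 1 n x)"
      have fl: "flat_algebra \<eta>" unfolding \<eta>_def by (intro flat_algebra.intros plateau_flat)
      define A where "A = min a 0"
      define B where "B = max b 1"
      have out: "\<eta> x = 0" if "x \<notin> {A..B}" for x
      proof -
        have "plateau a b n x = 0" "plateau 0 1 n x = 0" using that by (auto simp: plateau_eq A_def B_def)
        then show ?thesis by (simp add: \<eta>_def)
      qed
      have ic: "(LBINT x. \<eta> x * h x) = \<beta> n * (LBINT x. plateau a b n x * h x) - \<alpha> n * (LBINT x. plateau 0 1 n x * h x)"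
        "integrable lborel (\<lambda>x. \<eta> x * h x)" if "locally_integrable h" for h
      proof -
        have e: "(\<lambda>x. \<eta> x * h x) = (\<lambda>x. \<beta> n * (plateau a b n x * h x) - \<alpha> n * (plateau 0 1 n x * h x))"
          by (simp add: \<eta>_def algebra_simps)
        show "(LBINT x. \<eta> x * h x) = \<beta> n * (LBINT x. plateau a b n x * h x) - \<alpha> n * (LBINT x. plateau 0 1 n x * h x)"
          "integrable lborel (\<lambda>x. \<eta> x * h x)"
          unfolding e using P(1)[OF that, of a b n] P(1)[OF that, of 0 1 n] by simp_all
      qed
      have \<eta>0: "(LBINT x. \<eta> x) = 0" using ic(1)[OF l1] by (simp add: \<alpha>_def \<beta>_def)
      have \<eta>i: "integrable lborel \<eta>" using ic(2)[OF l1] by simp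
      have zero: "(LINT s:{..x}|lborel. \<eta> s) = 0" if "x \<notin> {A..B}" for x
        by (rule lower_integral_outside[OF \<eta>0 _ that]) (rule out)
      have "(LBINT x. \<eta> x * f x) = - (LBINT x. (LINT s:{..x}|lborel. \<eta> s) * g x)"
        using weak[OF fl lower_integral_antiderivative(1)[OF flat_algebra_continuous[OF fl] \<eta>i], of A B] out zero
        by blast
      also have "\<dots> = (LBINT x. \<eta> x * G x)"
        using fubini_by_parts(2)[OF \<eta>i \<eta>0 out g G(2)] by simp
      finally have "(LBINT x. \<eta> x * f x) - (LBINT x. \<eta> x * G x) = 0" by simp
      moreover have "(LBINT x. \<eta> x * w x) = (LBINT x. \<eta> x * f x) - (LBINT x. \<eta> x * G x)"
        unfolding w_def right_diff_distrib by (rule Bochner_Integration.integral_diff) (rule ic(2)[OF f] ic(2)[OF lG])+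
      ultimately show ?thesis using ic(1)[OF lw] by simp
    qed
    \<comment> \<open>The bumps now tend to the indicators of the intervals, and their integrals to
      the lengths \<open>1 - 0\<close> and \<open>b - a\<close>.\<close>
    have "(\<lambda>n. \<beta> n * (LBINT x. plateau a b n x * w x)) \<longlonglongrightarrow> (1 - 0) * (LINT t:{a..b}|lborel. w t)"
      unfolding \<beta>_def using P(2)[OF l1, of 0 1] by (intro tendsto_mult P(2)[OF lw]) (simp add: meas)
    moreover have "(\<lambda>n. \<beta> n * (LBINT x. plateau a b n x * w x)) \<longlonglongrightarrow> (b - a) * (LINT t:{0..1}|lborel. w t)"
      unfolding eq \<alpha>_def using P(2)[OF l1, of a b] ab by (intro tendsto_mult P(2)[OF lw]) (simp add: meas)
    ultimately show ?thesis using LIMSEQ_unique by fastforce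
  qed
  define C where "C = (LINT t:{0..1}|lborel. w t)"
  have lC: "locally_integrable (\<lambda>_. C)" by (rule locally_integrable_continuous) simp
  have "AE x in lborel. w x - C = 0"
  proof (rule AE_zero_of_interval_integrals[OF locally_integrable_diff[OF lw lC]])
    fix a b :: real assume ab: "a < b"
    have "(LINT t:{a..b}|lborel. w t - C) = (LINT t:{a..b}|lborel. w t) - (LINT t:{a..b}|lborel. C)"
      by (rule set_integral_diff(2)) (rule locally_integrableD[OF lw] locally_integrableD[OF lC])+
    also have "(LINT t:{a..b}|lborel. C) = (b - a) * C" using ab by (simp add: set_lebesgue_integral_def)
    finally show "(LINT t:{a..b}|lborel. w t - C) = 0" using key[OF ab] by (simp add: C_def)
  qed
  then have "AE x in lborel. f x = G x + C" by eventually_elim (simp add: w_def)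
  moreover have "continuous_on UNIV (\<lambda>x. G x + C)" by (intro continuous_intros G)
  moreover have "G y + C - (G x + C) = (LINT t:{x..y}|lborel. g t)" if "x \<le> y" for x y
    using G(2)[OF that] by simp
  ultimately show ?thesis using that by blast
qed

section \<open>Classical representatives of functions in H^2\<close>

lemma deriv_test_function:
  assumes "\<phi> \<in> test_functions"
  shows "deriv \<phi> \<in> test_functions"
proof -
  have dn: "(deriv ^^ n) (deriv \<phi>) differentiable at x" for n x
    using assms unfolding test_functions_def by (auto simp flip: funpow_Suc_right simp: funpow_swap1 dest: spec[of _ "Suc n"])
  have "{x. deriv \<phi> x \<noteq> 0} \<subseteq> closure {x. \<phi> x \<noteq> 0}"
  proof
    fix x assume x: "x \<in> {x. deriv \<phi> x \<noteq> 0}"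
    show "x \<in> closure {x. \<phi> x \<noteq> 0}"
    proof (rule ccontr)
      assume n: "x \<notin> closure {x. \<phi> x \<noteq> 0}"
      have "((\<lambda>_. 0) has_real_derivative 0) (at x)" by simp
      then have "(\<phi> has_real_derivative 0) (at x)"
        by (rule has_field_derivative_transform_within_open[where S="- closure {x. \<phi> x \<noteq> 0}"])
          (use n closure_subset[of "{x. \<phi> x \<noteq> 0}"] in auto)
      then show False using x DERIV_imp_deriv by force
    qed
  qed
  moreover have "bounded (closure {x. \<phi> x \<noteq> 0})"
    using assms unfolding test_functions_def by (auto dest: compact_imp_bounded)
  ultimately have "compact (closure {x. deriv \<phi> x \<noteq> 0})"
    unfolding compact_closure by (metis bounded_subset)
  with dn show ?thesis by (simp add: test_functions_def)
qed

text \<open>The choice made in \<open>weak_deriv\<close> may pick another representative than the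
  witness \<open>g\<close> in \<open>H2\<close>. Since \<open>deriv \<phi>\<close> is again a test
  function, both have the same integral against it, so the weak derivative \<open>h\<close> of
  \<open>g\<close> serves the chosen representative as well.\<close>

lemma H2_weak_derivs:
  assumes "v \<in> H2"
  shows "v \<in> L2" "weak_deriv v \<in> L2" "weak_deriv (weak_deriv v) \<in> L2"
    "has_weak_deriv v (weak_deriv v)" "has_weak_deriv (weak_deriv v) (weak_deriv (weak_deriv v))"
proof -
  obtain g h where gh: "v \<in> L2" "g \<in> L2" "h \<in> L2" "has_weak_deriv v g" "has_weak_deriv g h"
    using assms unfolding H2_def by blast
  show "v \<in> L2" by (rule gh)
  have 1: "weak_deriv v \<in> L2 \<and> has_weak_deriv v (weak_deriv v)"
    unfolding weak_deriv_def by (rule someI[where P="\<lambda>g. g \<in> L2 \<and> has_weak_deriv v g"]) (use gh in blast)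
  then show "weak_deriv v \<in> L2" "has_weak_deriv v (weak_deriv v)" by auto
  have "has_weak_deriv (weak_deriv v) h"
    unfolding has_weak_deriv_def
  proof
    fix \<phi> assume t: "\<phi> \<in> test_functions"
    note t' = deriv_test_function[OF t]
    have "(LBINT x. deriv \<phi> x *\<^sub>R weak_deriv v x) = (LBINT x. deriv \<phi> x *\<^sub>R g x)"
    proof -
      have "(LBINT x. deriv (deriv \<phi>) x *\<^sub>R v x) = - (LBINT x. deriv \<phi> x *\<^sub>R weak_deriv v x)"
        using conjunct2[OF 1] t' unfolding has_weak_deriv_def by (rule bspec)
      moreover have "(LBINT x. deriv (deriv \<phi>) x *\<^sub>R v x) = - (LBINT x. deriv \<phi> x *\<^sub>R g x)"
        using gh(4) t' unfolding has_weak_deriv_def by (rule bspec)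
      ultimately show ?thesis by simp
    qed
    then show "(LBINT x. deriv \<phi> x *\<^sub>R weak_deriv v x) = - (LBINT x. \<phi> x *\<^sub>R h x)"
      using bspec[OF gh(5)[unfolded has_weak_deriv_def] t] by simp
  qed
  then have "weak_deriv (weak_deriv v) \<in> L2 \<and> has_weak_deriv (weak_deriv v) (weak_deriv (weak_deriv v))"
    unfolding weak_deriv_def[of "weak_deriv v"] using gh(3)
    by (intro someI[where P="\<lambda>g. g \<in> L2 \<and> has_weak_deriv (weak_deriv v) g"]) blast
  then show "weak_deriv (weak_deriv v) \<in> L2" "has_weak_deriv (weak_deriv v) (weak_deriv (weak_deriv v))" by auto
qed

text \<open>Here \<open>p\<close> will be \<open>Re\<close>, \<open>Im\<close> or
  \<open>- Im\<close>: real-linear and bounded by the norm, so that weak equations pass to the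
  components.\<close>

lemma L2_component:
  fixes f :: "real \<Rightarrow> complex" and p :: "complex \<Rightarrow> real"
  assumes f: "f \<in> L2" and p: "bounded_linear p" "\<And>w. \<bar>p w\<bar> \<le> norm w"
  shows "(\<lambda>x. p (f x)) \<in> borel_measurable borel" "integrable lborel (\<lambda>x. (p (f x))\<^sup>2)"
    "locally_integrable (\<lambda>x. p (f x))"
proof -
  have mf: "f \<in> borel_measurable borel" and i: "integrable lborel (\<lambda>x. (norm (f x))\<^sup>2)"
    using f by (auto simp: L2_def)
  have "p \<in> borel_measurable borel"
    by (intro borel_measurable_continuous_onI linear_continuous_on p)
  then show m: "(\<lambda>x. p (f x)) \<in> borel_measurable borel" using mf by measurable
  show sq: "integrable lborel (\<lambda>x. (p (f x))\<^sup>2)"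
  proof (rule Bochner_Integration.integrable_bound[OF i])
    show "(\<lambda>x. (p (f x))\<^sup>2) \<in> borel_measurable lborel" using m by measurable
    have "(p (f x))\<^sup>2 \<le> (norm (f x))\<^sup>2" for x
      using power_mono[OF p(2)[of "f x"], of 2] by simp
    then show "AE x in lborel. norm ((p (f x))\<^sup>2) \<le> norm ((norm (f x))\<^sup>2)" by simp
  qed
  show "locally_integrable (\<lambda>x. p (f x))" by (rule locally_integrable_square_integrable[OF m sq])
qed

lemma integrable_compact_mult_L2:
  fixes f :: "real \<Rightarrow> complex"
  assumes f: "f \<in> L2" and c: "continuous_on UNIV \<psi>" and out: "\<And>x. x \<notin> {A..B} \<Longrightarrow> \<psi> x = 0"
  shows "integrable lborel (\<lambda>x. \<psi> x *\<^sub>R f x)"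
proof -
  have mf: "f \<in> borel_measurable borel" and i: "integrable lborel (\<lambda>x. (norm (f x))\<^sup>2)"
    using f by (auto simp: L2_def)
  have [measurable]: "f \<in> borel_measurable borel" "\<psi> \<in> borel_measurable borel"
    using mf c by (auto intro: borel_measurable_continuous_onI)
  have nf: "locally_integrable (\<lambda>x. norm (f x))"
    by (rule locally_integrable_square_integrable[OF _ i]) measurable
  have "compact (\<psi> ` {A..B})" by (intro compact_continuous_image continuous_on_subset[OF c]) auto
  then obtain M where M: "\<And>x. x \<in> {A..B} \<Longrightarrow> norm (\<psi> x) \<le> M"
    using compact_imp_bounded bounded_iff by (metis (no_types, lifting) imageI)
  have "integrable lborel (\<lambda>x. M * (indicator {A..B} x * norm (f x)))"
    using locally_integrableD[OF nf, of A B] by (intro integrable_mult_right) (simp add: set_integrable_def)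
  then show ?thesis
  proof (rule Bochner_Integration.integrable_bound)
    have "norm (\<psi> x *\<^sub>R f x) \<le> norm (M * (indicator {A..B} x * norm (f x)))" for x
    proof (cases "x \<in> {A..B}")
      case True
      have "\<bar>\<psi> x\<bar> * norm (f x) \<le> \<bar>M\<bar> * norm (f x)"
        using M[OF True] by (intro mult_right_mono) auto
      then show ?thesis using True by (simp add: abs_mult)
    qed (use out in auto)
    then show "AE x in lborel. norm (\<psi> x *\<^sub>R f x) \<le> norm (M * (indicator {A..B} x * norm (f x)))" by simp
  qed measurable
qed

lemma component_antiderivative:
  fixes f g :: "real \<Rightarrow> complex" and p :: "complex \<Rightarrow> real"
  assumes f: "f \<in> L2" and g: "g \<in> L2" and w: "has_weak_deriv f g"
    and p: "bounded_linear p" "\<And>w. \<bar>p w\<bar> \<le> norm w"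
  obtains F where "continuous_on UNIV F" "\<And>x y. x \<le> y \<Longrightarrow> F y - F x = (LINT t:{x..y}|lborel. p (g t))"
    "AE x in lborel. p (f x) = F x"
proof -
  have weak: "(LBINT x. \<eta> x * p (f x)) = - (LBINT x. \<phi> x * p (g x))"
    if \<eta>: "flat_algebra \<eta>" and d: "\<And>x. (\<phi> has_real_derivative \<eta> x) (at x)"
      and out: "\<And>x. x \<notin> {A..B} \<Longrightarrow> \<eta> x = 0" "\<And>x. x \<notin> {A..B} \<Longrightarrow> \<phi> x = 0" for \<eta> \<phi> A B
  proof -
    note t = test_function_of_flat_derivative[OF \<eta> d, of A B]
    have "\<phi> \<in> test_functions" "deriv \<phi> = \<eta>" using t out(2) by blast+
    then have e: "(LBINT x. \<eta> x *\<^sub>R f x) = - (LBINT x. \<phi> x *\<^sub>R g x)"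
      using w unfolding has_weak_deriv_def by auto
    have i1: "integrable lborel (\<lambda>x. \<eta> x *\<^sub>R f x)"
      by (rule integrable_compact_mult_L2[OF f flat_algebra_continuous[OF \<eta>]]) (rule out(1))
    have "continuous_on UNIV \<phi>" using d by (meson DERIV_isCont continuous_at_imp_continuous_on)
    then have i2: "integrable lborel (\<lambda>x. \<phi> x *\<^sub>R g x)"
      by (rule integrable_compact_mult_L2[OF g]) (rule out(2))
    have "(LBINT x. \<eta> x * p (f x)) = p (LBINT x. \<eta> x *\<^sub>R f x)"
      using integral_bounded_linear[OF p(1) i1] linear_scale[OF bounded_linear.linear[OF p(1)]] by simp
    moreover have "(LBINT x. \<phi> x * p (g x)) = p (LBINT x. \<phi> x *\<^sub>R g x)"
      using integral_bounded_linear[OF p(1) i2] linear_scale[OF bounded_linear.linear[OF p(1)]] by simp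
    ultimately show ?thesis unfolding e by (simp add: linear_neg[OF bounded_linear.linear[OF p(1)]])
  qed
  have "\<exists>F. continuous_on UNIV F \<and> (\<forall>x y. x \<le> y \<longrightarrow> F y - F x = (LINT t:{x..y}|lborel. p (g t))) \<and>
      (AE x in lborel. p (f x) = F x)"
    by (rule weak_antiderivative[OF L2_component(3)[OF f p] L2_component(3)[OF g p] weak]) blast+
  then show ?thesis using that by blast
qed

text \<open>Replacing the integrand by a continuous representative does not change the integrals,
  and the fundamental theorem of calculus then applies at every point.\<close>

lemma DERIV_of_continuous_integrand:
  assumes F: "\<And>x y. x \<le> y \<Longrightarrow> F y - F x = (LINT t:{x..y}|lborel. k t)"
    and k: "k \<in> borel_measurable borel" and K: "continuous_on UNIV K" "AE x in lborel. k x = K x"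
  shows "(F has_real_derivative K x) (at x)"
proof -
  have [measurable]: "k \<in> borel_measurable borel" "K \<in> borel_measurable borel"
    using k K by (auto intro: borel_measurable_continuous_onI)
  have eq: "F (x - 1) + integral {x - 1..y} K = F y" if "y \<in> {x - 1<..<x + 1}" for y
  proof -
    have "(LINT t:{x - 1..y}|lborel. k t) = (LINT t:{x - 1..y}|lborel. K t)"
      unfolding set_lebesgue_integral_def
      by (rule integral_cong_AE) (use K(2) in \<open>auto elim: eventually_mono\<close>)
    also have "\<dots> = integral {x - 1..y} K"
      by (rule set_borel_integral_eq_integral)
        (rule locally_integrableD[OF locally_integrable_continuous[OF K(1)]])
    finally show ?thesis using F[of "x - 1" y] that by simp
  qed
  have "((\<lambda>u. integral {x-1..u} K) has_real_derivative K x) (at x within {x-1..x+1})"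
    by (rule integral_has_real_derivative) (auto intro: continuous_on_subset[OF K(1)])
  then have "((\<lambda>u. integral {x-1..u} K) has_real_derivative K x) (at x)"
    by (simp add: at_within_Icc_at)
  then have "((\<lambda>u. F (x-1) + integral {x-1..u} K) has_real_derivative K x) (at x)"
    by (auto intro!: derivative_eq_intros)
  then show ?thesis
    by (rule has_field_derivative_transform_within_open[where S="{x-1<..<x+1}"]) (use eq in auto)
qed

text \<open>Membership in \<open>H2\<close> yields a continuously differentiable representative, but
  a second derivative only almost everywhere. It becomes classical once the equation identifies it
  with a continuous function; the last clause is stated for all such \<open>K\<close> for this
  purpose.\<close>

lemma H2_component:
  fixes v :: "real \<Rightarrow> complex" and p :: "complex \<Rightarrow> real"
  assumes v: "v \<in> H2" and p: "bounded_linear p" "\<And>w. \<bar>p w\<bar> \<le> norm w"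
  obtains V V' where "\<And>x. (V has_real_derivative V' x) (at x)"
    "AE x in lborel. p (v x) = V x" "continuous_on UNIV V" "continuous_on UNIV V'"
    "integrable lborel (\<lambda>x. (V x)\<^sup>2)" "integrable lborel (\<lambda>x. (V' x)\<^sup>2)"
    "\<And>K. continuous_on UNIV K \<Longrightarrow> (AE x in lborel. p (weak_deriv (weak_deriv v) x) = K x) \<Longrightarrow>
      (\<forall>x. (V' has_real_derivative K x) (at x))"
proof -
  note H = H2_weak_derivs[OF v]
  obtain V where V: "continuous_on UNIV V" "\<And>x y. x \<le> y \<Longrightarrow> V y - V x = (LINT t:{x..y}|lborel. p (weak_deriv v t))"
    "AE x in lborel. p (v x) = V x"
    by (rule component_antiderivative[OF H(1,2,4) p]) blast
  obtain V' where V': "continuous_on UNIV V'"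
    "\<And>x y. x \<le> y \<Longrightarrow> V' y - V' x = (LINT t:{x..y}|lborel. p (weak_deriv (weak_deriv v) t))"
    "AE x in lborel. p (weak_deriv v x) = V' x"
    by (rule component_antiderivative[OF H(2,3,5) p]) blast
  have sq: "integrable lborel (\<lambda>x. (F x)\<^sup>2)" if "continuous_on UNIV F" "AE x in lborel. p (f x) = F x" "f \<in> L2" for f F
  proof -
    have [measurable]: "F \<in> borel_measurable borel" "(\<lambda>x. p (f x)) \<in> borel_measurable borel"
      using that L2_component(1)[OF that(3) p] by (auto intro: borel_measurable_continuous_onI)
    have "integrable lborel (\<lambda>x. (p (f x))\<^sup>2) \<longleftrightarrow> integrable lborel (\<lambda>x. (F x)\<^sup>2)"
      by (rule integrable_cong_AE) (use that(2) in \<open>auto elim: eventually_mono\<close>)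
    then show ?thesis using L2_component(2)[OF that(3) p] by simp
  qed
  show ?thesis
  proof (rule that[OF _ V(3,1) V'(1) sq[OF V(1,3) H(1)] sq[OF V'(1,3) H(2)]])
    show "(V has_real_derivative V' x) (at x)" for x
      by (rule DERIV_of_continuous_integrand[OF V(2) L2_component(1)[OF H(2) p] V'(1,3)])
    show "\<forall>x. (V' has_real_derivative K x) (at x)"
      if "continuous_on UNIV K" "AE x in lborel. p (weak_deriv (weak_deriv v) x) = K x" for K
      using DERIV_of_continuous_integrand[OF V'(2) L2_component(1)[OF H(3) p] that] by blast
  qed
qed

section \<open>The soliton and the reduction to the real system\<close>

text \<open>The first integral gives \<open>R'\<^sup>2\<close> in terms of \<open>R\<close>; with it
  \<open>R\<close> to the power \<open>- \<sigma>\<close> satisfies the linear equation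
  \<open>P'' = \<sigma>\<^sup>2 P\<close>, and evenness selects the hyperbolic cosine.\<close>

lemma soliton_explicit:
  assumes s: "soliton \<sigma> R" and \<sigma>: "\<sigma> > 0"
  shows "R x powr (2 * \<sigma>) = (\<sigma> + 1) * sech2 (\<sigma> * x)"
proof -
  define R1 where "R1 = deriv R"
  have pos: "R x > 0" and even: "R (- x) = R x" for x using s by (auto simp: soliton_def)
  have lim: "(R \<longlongrightarrow> 0) at_top" 
    using s tendsto_mono[OF at_top_le_at_infinity] unfolding soliton_def by blast
  have d: "(R has_real_derivative R1 x) (at x)"
    "(R1 has_real_derivative R x - R x powr (2 * \<sigma> + 1)) (at x)" for x
  proof -
    have a: "R differentiable at x" "R1 differentiable at x" "- R x + deriv R1 x + R x powr (2 * \<sigma> + 1) = 0"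
      using s by (auto simp: soliton_def R1_def)
    show "(R has_real_derivative R1 x) (at x)"
      using a(1) by (simp add: R1_def DERIV_deriv_iff_real_differentiable)
    have "(R1 has_real_derivative deriv R1 x) (at x)"
      using a(2) by (simp add: DERIV_deriv_iff_real_differentiable)
    then show "(R1 has_real_derivative R x - R x powr (2 * \<sigma> + 1)) (at x)"
      by (rule DERIV_cong) (use a(3) in linarith)
  qed
  have dpow: "((\<lambda>x. R x powr c) has_real_derivative c * R x powr (c - 1) * R1 x) (at x)" for c x
    using DERIV_powr[OF d(1)[of x] pos[of x] DERIV_const[of c]] pos[of x]
    by (simp add: powr_diff field_simps)
  have powr_split: "R x powr (2 * \<sigma> + 2) = R x * R x powr (2 * \<sigma> + 1)"
    "R x powr (2 * \<sigma> + 1) = R x * R x powr (2 * \<sigma>)" for x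
    using pos[of x] by (simp_all add: powr_add power2_eq_square)
  \<comment> \<open>The conserved energy, whose value is determined by the decay at
    infinity.\<close>
  define H where "H = (\<lambda>x. (R1 x)\<^sup>2 - (R x)\<^sup>2 + R x powr (2 * \<sigma> + 2) / (\<sigma> + 1))"
  have dH: "(H has_real_derivative 0) (at x)" for x
  proof -
    have "(H has_real_derivative 2 * R1 x * (R x - R x powr (2 * \<sigma> + 1)) - 2 * R x * R1 x
        + (2 * \<sigma> + 2) * R x powr (2 * \<sigma> + 2 - 1) * R1 x / (\<sigma> + 1)) (at x)"
      unfolding H_def
      by (intro DERIV_add DERIV_diff DERIV_cdivide dpow DERIV_cong[OF DERIV_power[OF d(1)]] DERIV_cong[OF DERIV_power[OF d(2)]])
        (simp_all add: mult_ac)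
    moreover have "2 * R1 x * (R x - R x powr (2 * \<sigma> + 1)) - 2 * R x * R1 x
        + (2 * \<sigma> + 2) * R x powr (2 * \<sigma> + 2 - 1) * R1 x / (\<sigma> + 1) = 0"
    proof -
      have e: "(2 * \<sigma> + 2) * y / (\<sigma> + 1) = 2 * y" for y :: real using \<sigma> by (simp add: field_simps)
      have "(2 * \<sigma> + 2) * R x powr (2 * \<sigma> + 2 - 1) * R1 x / (\<sigma> + 1) = 2 * (R x powr (2 * \<sigma> + 1) * R1 x)"
      proof -
        have ex: "2 * \<sigma> + 2 - 1 = 2 * \<sigma> + 1" by simp
        show ?thesis unfolding ex using e[of "R x powr (2 * \<sigma> + 1) * R1 x"] by (simp only: mult.assoc)
      qed
      then show ?thesis by (simp add: algebra_simps)
    qed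
    ultimately show ?thesis by simp
  qed
  have Hc: "H x = H 0" for x using DERIV_isconst_all[of H x 0] dH by blast
  have R1sq: "(R1 x)\<^sup>2 = H 0 + (R x)\<^sup>2 - R x powr (2 * \<sigma> + 2) / (\<sigma> + 1)" for x
    using Hc[of x] by (simp add: H_def)
  have "H 0 = 0"
  proof -
    \<comment> \<open>The hypotheses give \<open>R \<longlongrightarrow> 0\<close> but nothing on
      the derivative. The mean value theorem on unit intervals supplies points tending to infinity
      along which the derivative tends to 0, and this is enough because the energy is
      constant.\<close>
    have ex: "\<exists>\<xi>. real n < \<xi> \<and> \<xi> < real n + 1 \<and> R (real n + 1) - R (real n) = R1 \<xi>" for n :: nat
      using MVT2[of "real n" "real n + 1" R R1] d(1) by force
    then obtain \<xi> where \<xi>: "\<And>n. real n < \<xi> n" "\<And>n. R (real n + 1) - R (real n) = R1 (\<xi> n)" by metis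
    have f\<xi>: "filterlim \<xi> at_top sequentially"
      by (rule filterlim_at_top_mono[OF filterlim_real_sequentially]) (use \<xi>(1) in \<open>auto intro: always_eventually less_imp_le\<close>)
    have "((\<lambda>x. H 0 + (R x)\<^sup>2 - R x powr (2 * \<sigma> + 2) / (\<sigma> + 1)) \<longlongrightarrow> H 0 + 0\<^sup>2 - 0 / (\<sigma> + 1)) at_top"
      using \<sigma> pos by (intro tendsto_intros lim tendsto_zero_powrI[OF lim tendsto_const]) (auto simp: less_imp_le)
    then have "((\<lambda>x. (R1 x)\<^sup>2) \<longlongrightarrow> H 0) at_top" by (simp add: R1sq)
    then have 1: "(\<lambda>n. (R1 (\<xi> n))\<^sup>2) \<longlonglongrightarrow> H 0" by (rule filterlim_compose[OF _ f\<xi>])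
    have f1: "filterlim (\<lambda>n. real n + 1) at_top sequentially"
      by (rule filterlim_at_top_mono[OF filterlim_real_sequentially]) auto
    have "(\<lambda>n. (R (real n + 1) - R (real n))\<^sup>2) \<longlonglongrightarrow> (0 - 0)\<^sup>2"
      by (intro tendsto_power tendsto_diff filterlim_compose[OF lim f1] filterlim_compose[OF lim filterlim_real_sequentially])
    then have "(\<lambda>n. (R1 (\<xi> n))\<^sup>2) \<longlonglongrightarrow> 0" by (simp add: \<xi>(2))
    then show ?thesis using 1 LIMSEQ_unique by blast
  qed
  then have R1sq': "(R1 x)\<^sup>2 = (R x)\<^sup>2 - (R x)\<^sup>2 * R x powr (2 * \<sigma>) / (\<sigma> + 1)" for x
    using R1sq[of x] by (simp add: powr_split power2_eq_square)
  have R10: "R1 0 = 0" by (rule even_deriv_0[where h=R, OF d(1)[of 0] even])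
  \<comment> \<open>At the maximum the derivative vanishes by symmetry, so the zero energy fixes the
    amplitude.\<close>
  have R0: "R 0 powr (2 * \<sigma>) = \<sigma> + 1"
  proof -
    have "(R 0)\<^sup>2 * (R 0 powr (2 * \<sigma>)) = (R 0)\<^sup>2 * (\<sigma> + 1)"
      using R1sq'[of 0] R10 \<sigma> by (simp add: field_simps)
    then show ?thesis using pos[of 0] by simp
  qed
  text \<open>The power \<open>R\<^sup>-\<^sup>\<sigma>\<close> linearizes the soliton equation.\<close>
  define P where "P = (\<lambda>x. R x powr (- \<sigma>))"
  define P1 where "P1 = (\<lambda>x. - \<sigma> * R x powr (- \<sigma> - 1) * R1 x)"
  have dP: "(P has_real_derivative P1 x) (at x)" for x unfolding P_def P1_def by (rule dpow)
  have dP1: "(P1 has_real_derivative \<sigma>\<^sup>2 * P x) (at x)" for x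
  proof -
    have "(P1 has_real_derivative (- \<sigma> * ((- \<sigma> - 1) * R x powr (- \<sigma> - 1 - 1) * R1 x)) * R1 x
        + (R x - R x powr (2 * \<sigma> + 1)) * (- \<sigma> * R x powr (- \<sigma> - 1))) (at x)"
      unfolding P1_def by (intro DERIV_mult DERIV_cmult dpow d)
    moreover have "(- \<sigma> * ((- \<sigma> - 1) * R x powr (- \<sigma> - 1 - 1) * R1 x)) * R1 x
        + (R x - R x powr (2 * \<sigma> + 1)) * (- \<sigma> * R x powr (- \<sigma> - 1)) = \<sigma>\<^sup>2 * P x"
    proof -
      have step: "R x powr (c - 1) = R x powr c / R x" for c
        using pos[of x] powr_diff[of "R x" c 1] by simp
      have p: "R x powr (- \<sigma> - 1) = P x / R x" "R x powr (- \<sigma> - 1 - 1) = P x / (R x)\<^sup>2"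
        unfolding step P_def by (simp_all add: power2_eq_square)
      have "(- \<sigma> * ((- \<sigma> - 1) * R x powr (- \<sigma> - 1 - 1) * R1 x)) * R1 x = \<sigma> * (\<sigma> + 1) * (P x / (R x)\<^sup>2) * (R1 x)\<^sup>2"
        unfolding p by (simp add: power2_eq_square algebra_simps)
      also have "\<dots> = \<sigma> * (\<sigma> + 1) * P x * (1 - R x powr (2 * \<sigma>) / (\<sigma> + 1))"
        unfolding R1sq' using pos[of x] by (simp add: field_simps)
      also have "\<dots> = \<sigma> * (\<sigma> + 1) * P x - \<sigma> * P x * R x powr (2 * \<sigma>)"
        using \<sigma> by (simp add: field_simps)
      finally have first: "(- \<sigma> * ((- \<sigma> - 1) * R x powr (- \<sigma> - 1 - 1) * R1 x)) * R1 x =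
          \<sigma> * (\<sigma> + 1) * P x - \<sigma> * P x * R x powr (2 * \<sigma>)" .
      have "(R x - R x powr (2 * \<sigma> + 1)) * (- \<sigma> * R x powr (- \<sigma> - 1)) =
          - \<sigma> * P x + \<sigma> * P x * R x powr (2 * \<sigma>)"
        unfolding p powr_split using pos[of x] by (simp add: field_simps)
      then show ?thesis unfolding first by (simp add: power2_eq_square algebra_simps)
    qed
    ultimately show ?thesis by simp
  qed
  have P0: "P1 0 = 0" by (simp add: P1_def R10)
  \<comment> \<open>\<open>A\<close> and \<open>B\<close> are the coordinates of the solution in the
    basis of hyperbolic functions. Their constancy proves uniqueness for the linear equation
    directly.\<close>
  define A where "A = (\<lambda>x. P x * cosh (\<sigma> * x) - P1 x * sinh (\<sigma> * x) / \<sigma>)"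
  define B where "B = (\<lambda>x. P1 x * cosh (\<sigma> * x) - \<sigma> * P x * sinh (\<sigma> * x))"
  have dA: "(A has_real_derivative 0) (at x)" for x
    unfolding A_def
    by (rule derivative_eq_intros dP dP1 refl)+ (use \<sigma> in \<open>simp_all add: field_simps power2_eq_square\<close>)
  have dB: "(B has_real_derivative 0) (at x)" for x
    unfolding B_def
    by (rule derivative_eq_intros dP dP1 refl)+ (simp_all add: field_simps power2_eq_square)
  have "A x = A 0" "B x = B 0" using DERIV_isconst_all[of A x 0] DERIV_isconst_all[of B x 0] dA dB by blast+
  then have AB: "A x = P 0" "B x = 0" by (simp_all add: A_def B_def P0)
  have "A x * cosh (\<sigma> * x) + B x * sinh (\<sigma> * x) / \<sigma> = P x * ((cosh (\<sigma> * x))\<^sup>2 - (sinh (\<sigma> * x))\<^sup>2)"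
    unfolding A_def B_def using \<sigma> by (simp add: field_simps power2_eq_square)
  then have Px: "P x = P 0 * cosh (\<sigma> * x)" using AB by (simp add: cosh_square_eq)
  have P2: "R x powr (2 * \<sigma>) = 1 / (P x)\<^sup>2" for x
  proof -
    have "R x powr (2 * \<sigma>) = R x powr \<sigma> * R x powr \<sigma>" by (simp flip: powr_add)
    then show ?thesis by (simp add: P_def powr_minus power2_eq_square inverse_eq_divide)
  qed
  have "R x powr (2 * \<sigma>) = R 0 powr (2 * \<sigma>) / (cosh (\<sigma> * x))\<^sup>2"
    unfolding P2 Px by (simp add: power_mult_distrib)
  moreover have "sech2 y = 1 / (cosh y)\<^sup>2" for y
  proof -
    have "sech2 y = ((cosh y)\<^sup>2 - (sinh y)\<^sup>2) / (cosh y)\<^sup>2"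
      by (simp add: sech2_def tanh_def power_divide diff_divide_distrib)
    then show ?thesis by (simp add: cosh_square_eq)
  qed
  ultimately show ?thesis unfolding R0 by simp
qed

section \<open>Parity, scaling and the passage to complex eigenfunctions\<close>

lemma sobolev2_zero_imp:
  assumes u: "sobolev2 u u' u''" and z: "\<And>y. u y = 0"
  shows "u'' y = 0"
proof -
  have "u = (\<lambda>_. 0)" using z by auto
  moreover have d: "(u has_real_derivative u' y) (at y)" "(u' has_real_derivative u'' y) (at y)" for y
    using u by (auto simp: sobolev2_def)
  ultimately have u': "u' y = 0" for y using DERIV_unique[OF d(1)[of y], of 0] by simp
  then have "u' = (\<lambda>_. 0)" by auto
  then show ?thesis using DERIV_unique[OF d(2)[of y], of 0] by simp
qed

lemma no_eigenfunction_with_parity: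
  assumes a: "0 < a" "a < 1/2" and \<mu>: "0 < \<mu>"
    and v: "sobolev2 v v' v''" and u: "sobolev2 u u' u''"
    and eqv: "schroedinger (a\<^sup>2) (a * (a + 1)) v v'' = (\<lambda>y. \<mu> * u y)"
    and equ: "schroedinger (a\<^sup>2) ((a + 1) * (a + 2)) u u'' = (\<lambda>y. \<mu> * v y)"
    and e: "e = 1 \<or> e = - (1::real)" and parity: "\<And>y. v (- y) = e * v y" "\<And>y. u (- y) = e * u y"
  shows "v y = 0 \<and> u y = 0"
proof (cases "\<mu> \<le> a\<^sup>2")
  case True
  interpret sech_ground_state a by unfold_locales (use a in auto)
  have u0: "u y = 0" for y by (rule no_gap_eigenfunction[OF \<mu> True v u eqv equ e parity(2)])
  have "\<mu> * v y = 0"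
    using fun_cong[OF equ, of y] sobolev2_zero_imp[OF u u0] by (simp add: schroedinger_def u0)
  then show ?thesis using \<mu> u0 by simp
next
  case False
  then show ?thesis using no_embedded_eigenfunction[OF _ _ _ v u eqv equ e parity] a by simp
qed

lemma integrable_affine:
  fixes f :: "real \<Rightarrow> real"
  assumes "integrable lborel f" "c \<noteq> 0"
  shows "integrable lborel (\<lambda>y. f (c * y))"
  using lborel_integrable_real_affine[OF assms(1,2), of 0] by simp

lemma sobolev2_dilate:
  assumes "sobolev2 f f' f''" "c \<noteq> 0"
  shows "sobolev2 (\<lambda>y. f (c * y)) (\<lambda>y. c * f' (c * y)) (\<lambda>y. c\<^sup>2 * f'' (c * y))"
  unfolding sobolev2_def
proof (intro conjI allI)
  have d: "(f has_real_derivative f' y) (at y)" "(f' has_real_derivative f'' y) (at y)" for y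
    using assms by (auto simp: sobolev2_def)
  show "((\<lambda>y. f (c * y)) has_real_derivative c * f' (c * y)) (at y)" for y
    by (rule DERIV_cong[OF DERIV_chain2[OF d(1) DERIV_cmult[OF DERIV_ident]]]) simp
  show "((\<lambda>y. c * f' (c * y)) has_real_derivative c\<^sup>2 * f'' (c * y)) (at y)" for y
    by (rule DERIV_cong[OF DERIV_cmult[OF DERIV_chain2[OF d(2) DERIV_cmult[OF DERIV_ident]]]])
      (simp add: power2_eq_square)
  show "continuous_on UNIV (\<lambda>y. c\<^sup>2 * f'' (c * y))"
    by (intro continuous_intros continuous_on_compose2[OF sobolev2_cont(3)[OF assms(1)]]) auto
  have "integrable lborel (\<lambda>y. (f (c * y))\<^sup>2)" "integrable lborel (\<lambda>y. (f' (c * y))\<^sup>2)" "integrable lborel (\<lambda>y. (f'' (c * y))\<^sup>2)"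
    using integrable_affine[of "\<lambda>y. (f y)\<^sup>2" c] integrable_affine[of "\<lambda>y. (f' y)\<^sup>2" c]
      integrable_affine[of "\<lambda>y. (f'' y)\<^sup>2" c] assms by (auto simp: sobolev2_def)
  then show "integrable lborel (\<lambda>y. (f (c * y))\<^sup>2)" "integrable lborel (\<lambda>y. (c * f' (c * y))\<^sup>2)"
    "integrable lborel (\<lambda>y. (c\<^sup>2 * f'' (c * y))\<^sup>2)"
    by (simp_all add: power_mult_distrib)
qed

text \<open>The operators commute with reflection, so the even and the odd part of a solution solve
  the same equations.\<close>

lemma no_eigenfunction:
  assumes a: "0 < a" "a < 1/2" and \<mu>: "0 < \<mu>"
    and v: "sobolev2 v v' v''" and u: "sobolev2 u u' u''"
    and eqv: "schroedinger (a\<^sup>2) (a * (a + 1)) v v'' = (\<lambda>y. \<mu> * u y)"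
    and equ: "schroedinger (a\<^sup>2) ((a + 1) * (a + 2)) u u'' = (\<lambda>y. \<mu> * v y)"
  shows "v y = 0 \<and> u y = 0"
proof -
  \<comment> \<open>The factors \<open>1 *\<close> and \<open>- 1 *\<close> reproduce the shape of
    \<open>sobolev2_lincomb\<close> and \<open>sobolev2_dilate\<close>, reflection being dilation by
    \<open>- 1\<close>.\<close>
  define part where "part e w y = 1 * w y + e * w (- 1 * y)" for e :: real and w :: "real \<Rightarrow> real" and y
  define part' where "part' e w y = 1 * w y + e * (- 1 * w (- 1 * y))" for e :: real and w :: "real \<Rightarrow> real" and y
  have s: "sobolev2 (part e w) (part' e w') (part e w'')" if "sobolev2 w w' w''" for e w w' w''
    using sobolev2_lincomb[OF that sobolev2_dilate[OF that, of "- 1"], of 1 e]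
    unfolding part_def[abs_def] part'_def[abs_def] by simp
  have sch: "schroedinger A c (part e w) (part e w'') y = part e (schroedinger A c w w'') y" for A c e w w'' y
    unfolding schroedinger_def part_def by (simp add: algebra_simps)
  have zero: "part e v y = 0 \<and> part e u y = 0" if e: "e = 1 \<or> e = - 1" for e y
  proof (rule no_eigenfunction_with_parity[OF a \<mu> s[OF v] s[OF u] _ _ e])
    show "schroedinger (a\<^sup>2) (a * (a + 1)) (part e v) (part e v'') = (\<lambda>y. \<mu> * part e u y)"
      unfolding fun_eq_iff sch eqv by (simp add: part_def algebra_simps)
    show "schroedinger (a\<^sup>2) ((a + 1) * (a + 2)) (part e u) (part e u'') = (\<lambda>y. \<mu> * part e v y)"
      unfolding fun_eq_iff sch equ by (simp add: part_def algebra_simps)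
    show "part e v (- y) = e * part e v y" "part e u (- y) = e * part e u y" for y
      using e by (auto simp: part_def)
  qed
  show ?thesis using zero[of 1 y] zero[of "- 1" y] by (auto simp: part_def)
qed

text \<open>The substitution \<open>y = \<sigma> x\<close> turns the operators \<open>L\<^sub>-\<close>, \<open>L\<^sub>+\<close> into \<open>\<sigma>\<^sup>2\<close> times Poeschl-Teller
  operators with parameters \<open>a\<close> and \<open>a + 1\<close>, where \<open>a = 1 / \<sigma>\<close>.\<close>

lemma no_real_eigenfunction:
  assumes \<sigma>: "\<sigma> > 2" and \<mu>: "\<mu> \<noteq> 0"
    and v: "sobolev2 v v' v''" and u: "sobolev2 u u' u''"
    and eqv: "\<And>x. v'' x = v x - (\<sigma> + 1) * sech2 (\<sigma> * x) * v x - \<mu> * u x"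
    and equ: "\<And>x. u'' x = u x - (2 * \<sigma> + 1) * ((\<sigma> + 1) * sech2 (\<sigma> * x)) * u x - \<mu> * v x"
  shows "v x = 0 \<and> u x = 0"
proof -
  define a where "a = 1 / \<sigma>"
  have a: "0 < a" "a < 1/2" "a * \<sigma> = 1" using \<sigma> by (auto simp: a_def field_simps)
  have a': "a\<^sup>2 * (\<sigma> + 1) = a * (a + 1)" "a\<^sup>2 * ((2 * \<sigma> + 1) * (\<sigma> + 1)) = (a + 1) * (a + 2)"
    using \<sigma> by (simp_all add: a_def field_simps power2_eq_square)
  define \<nu> where "\<nu> = a\<^sup>2 * \<bar>\<mu>\<bar>"
  have \<nu>: "0 < \<nu>" using a \<mu> by (simp add: \<nu>_def)
  \<comment> \<open>Multiplying \<open>u\<close> by the sign of \<open>\<mu>\<close> replaces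
    \<open>\<mu>\<close> by its absolute value in both equations, so only positive values have to be
    treated.\<close>
  define r where "r = sgn \<mu>"
  have r: "r * r = 1" "r * \<mu> = \<bar>\<mu>\<bar>" "\<mu> = r * \<bar>\<mu>\<bar>" using \<mu> by (auto simp: r_def sgn_if)
  note sv = sobolev2_dilate[OF v, of a] and su = sobolev2_dilate[OF u, of a]
  have ru: "sobolev2 (\<lambda>y. r * u (a * y)) (\<lambda>y. r * (a * u' (a * y))) (\<lambda>y. r * (a\<^sup>2 * u'' (a * y)))"
    using sobolev2_lincomb[OF su su, of r 0] a by simp
  have sx: "sech2 (\<sigma> * (a * y)) = sech2 y" for y using a(3) by (simp add: mult.assoc[symmetric] mult.commute[of \<sigma>])
  have "v (a * y) = 0 \<and> r * u (a * y) = 0" for y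
  proof (rule no_eigenfunction[OF a(1,2) \<nu> sv ru])
    show "schroedinger (a\<^sup>2) (a * (a + 1)) (\<lambda>y. v (a * y)) (\<lambda>y. a\<^sup>2 * v'' (a * y)) = (\<lambda>y. \<nu> * (r * u (a * y)))"
    proof
      fix y
      have "schroedinger (a\<^sup>2) (a * (a + 1)) (\<lambda>y. v (a * y)) (\<lambda>y. a\<^sup>2 * v'' (a * y)) y =
          a\<^sup>2 * (r * \<bar>\<mu>\<bar>) * u (a * y)"
        unfolding schroedinger_def eqv sx a'(1)[symmetric] r(3)[symmetric] by (simp add: algebra_simps)
      then show "schroedinger (a\<^sup>2) (a * (a + 1)) (\<lambda>y. v (a * y)) (\<lambda>y. a\<^sup>2 * v'' (a * y)) y = \<nu> * (r * u (a * y))"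
        by (simp add: \<nu>_def mult_ac)
    qed
    show "schroedinger (a\<^sup>2) ((a + 1) * (a + 2)) (\<lambda>y. r * u (a * y)) (\<lambda>y. r * (a\<^sup>2 * u'' (a * y))) = (\<lambda>y. \<nu> * v (a * y))"
    proof
      fix y
      have "schroedinger (a\<^sup>2) ((a + 1) * (a + 2)) (\<lambda>y. r * u (a * y)) (\<lambda>y. r * (a\<^sup>2 * u'' (a * y))) y =
          a\<^sup>2 * (r * \<mu>) * v (a * y)"
        unfolding schroedinger_def equ sx a'(2)[symmetric] by (simp add: algebra_simps)
      then show "schroedinger (a\<^sup>2) ((a + 1) * (a + 2)) (\<lambda>y. r * u (a * y)) (\<lambda>y. r * (a\<^sup>2 * u'' (a * y))) y = \<nu> * v (a * y)"
        unfolding r(2) by (simp add: \<nu>_def)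
    qed
  qed (use a in auto)
  from this[of "\<sigma> * x"] show ?thesis using a(3) r(1) by (auto simp: mult.assoc[symmetric])
qed

lemma square_integrable_rhs:
  fixes v u :: "real \<Rightarrow> real"
  assumes c: "continuous_on UNIV v" "continuous_on UNIV u"
    and i: "integrable lborel (\<lambda>x. (v x)\<^sup>2)" "integrable lborel (\<lambda>x. (u x)\<^sup>2)"
  shows "continuous_on UNIV (\<lambda>x. v x - k * sech2 (\<sigma> * x) * v x - \<mu> * u x)"
    and "integrable lborel (\<lambda>x. (v x - k * sech2 (\<sigma> * x) * v x - \<mu> * u x)\<^sup>2)"
proof -
  have cs: "continuous_on UNIV (\<lambda>x. sech2 (\<sigma> * x))"
    by (rule continuous_on_compose2[OF continuous_on_sech2[of UNIV]]) (auto intro!: continuous_intros)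
  show "continuous_on UNIV (\<lambda>x. v x - k * sech2 (\<sigma> * x) * v x - \<mu> * u x)"
    by (intro continuous_intros c cs)
  have "integrable lborel (\<lambda>x. (sech2 (\<sigma> * x) * v x)\<^sup>2)"
  proof (rule Bochner_Integration.integrable_bound[OF i(1)])
    show "(\<lambda>x. (sech2 (\<sigma> * x) * v x)\<^sup>2) \<in> borel_measurable lborel"
      using c cs by (auto intro!: borel_measurable_continuous_onI continuous_intros)
    have "\<bar>sech2 (\<sigma> * x) * v x\<bar> \<le> \<bar>v x\<bar>" for x
      using sech2_pos[of "\<sigma> * x"] sech2_le_1[of "\<sigma> * x"] mult_right_mono[of "sech2 (\<sigma> * x)" 1 "\<bar>v x\<bar>"]
      by (simp add: abs_mult)
    then show "AE x in lborel. norm ((sech2 (\<sigma> * x) * v x)\<^sup>2) \<le> norm ((v x)\<^sup>2)"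
      by (simp add: abs_le_square_iff)
  qed
  then have i1: "integrable lborel (\<lambda>x. (1 * v x + (- k) * (sech2 (\<sigma> * x) * v x))\<^sup>2)"
    using c i by (intro continuous_square_integrable_add) (auto intro!: continuous_intros cs)
  have "integrable lborel (\<lambda>x. (1 * (1 * v x + (- k) * (sech2 (\<sigma> * x) * v x)) + (- \<mu>) * u x)\<^sup>2)"
    by (rule continuous_square_integrable_add[OF _ c(2) i1 i(2)]) (intro continuous_intros c cs)
  then show "integrable lborel (\<lambda>x. (v x - k * sech2 (\<sigma> * x) * v x - \<mu> * u x)\<^sup>2)"
    by (simp add: mult.assoc)
qed

text \<open>Complex eigenfunctions are split into real pairs: for \<open>z = i \<mu>\<close> the pairs \<open>(Re v, - Im u)\<close> and
  \<open>(Im v, Re u)\<close> solve the same real system.\<close>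

lemma H2_pair_vanishes:
  fixes p q :: "complex \<Rightarrow> real"
  assumes \<sigma>: "\<sigma> > 2" and \<mu>: "\<mu> \<noteq> 0" and v: "v \<in> H2" and u: "u \<in> H2"
    and p: "bounded_linear p" "\<And>w. \<bar>p w\<bar> \<le> norm w" and q: "bounded_linear q" "\<And>w. \<bar>q w\<bar> \<le> norm w"
    and eqv: "AE x in lborel. p (weak_deriv (weak_deriv v) x) =
      p (v x) - (\<sigma> + 1) * sech2 (\<sigma> * x) * p (v x) - \<mu> * q (u x)"
    and equ: "AE x in lborel. q (weak_deriv (weak_deriv u) x) =
      q (u x) - (2 * \<sigma> + 1) * ((\<sigma> + 1) * sech2 (\<sigma> * x)) * q (u x) - \<mu> * p (v x)"
  shows "AE x in lborel. p (v x) = 0 \<and> q (u x) = 0"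
proof -
  obtain V V' where V: "\<And>x. (V has_real_derivative V' x) (at x)"
    "AE x in lborel. p (v x) = V x" "continuous_on UNIV V" "continuous_on UNIV V'"
    "integrable lborel (\<lambda>x. (V x)\<^sup>2)" "integrable lborel (\<lambda>x. (V' x)\<^sup>2)"
    "\<And>K. continuous_on UNIV K \<Longrightarrow> (AE x in lborel. p (weak_deriv (weak_deriv v) x) = K x) \<Longrightarrow>
      (\<forall>x. (V' has_real_derivative K x) (at x))"
    by (rule H2_component[OF v p]) blast
  obtain U U' where U: "\<And>x. (U has_real_derivative U' x) (at x)"
    "AE x in lborel. q (u x) = U x" "continuous_on UNIV U" "continuous_on UNIV U'"
    "integrable lborel (\<lambda>x. (U x)\<^sup>2)" "integrable lborel (\<lambda>x. (U' x)\<^sup>2)"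
    "\<And>K. continuous_on UNIV K \<Longrightarrow> (AE x in lborel. q (weak_deriv (weak_deriv u) x) = K x) \<Longrightarrow>
      (\<forall>x. (U' has_real_derivative K x) (at x))"
    by (rule H2_component[OF u q]) blast
  define V'' where "V'' = (\<lambda>x. V x - (\<sigma> + 1) * sech2 (\<sigma> * x) * V x - \<mu> * U x)"
  define U'' where "U'' = (\<lambda>x. U x - ((2 * \<sigma> + 1) * (\<sigma> + 1)) * sech2 (\<sigma> * x) * U x - \<mu> * V x)"
  have rV: "continuous_on UNIV V''" "integrable lborel (\<lambda>x. (V'' x)\<^sup>2)"
    unfolding V''_def by (rule square_integrable_rhs[OF V(3) U(3) V(5) U(5)])+
  have rU: "continuous_on UNIV U''" "integrable lborel (\<lambda>x. (U'' x)\<^sup>2)"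
    unfolding U''_def by (rule square_integrable_rhs[OF U(3) V(3) U(5) V(5)])+
  have "AE x in lborel. p (weak_deriv (weak_deriv v) x) = V'' x"
    using eqv V(2) U(2) by eventually_elim (simp add: V''_def)
  from V(7)[OF rV(1) this] have sV: "sobolev2 V V' V''"
    unfolding sobolev2_def by (intro conjI allI V(1,5,6) rV) simp
  have "AE x in lborel. q (weak_deriv (weak_deriv u) x) = U'' x"
    using equ V(2) U(2) by eventually_elim (simp add: U''_def mult.assoc)
  from U(7)[OF rU(1) this] have sU: "sobolev2 U U' U''"
    unfolding sobolev2_def by (intro conjI allI U(1,5,6) rU) simp
  have "V x = 0 \<and> U x = 0" for x
    by (rule no_real_eigenfunction[OF \<sigma> \<mu> sV sU]) (simp_all add: V''_def U''_def mult.assoc)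
  then show ?thesis using V(2) U(2) by (auto elim: eventually_elim2)
qed

theorem theorem3:
  fixes \<sigma> :: real and R :: "real \<Rightarrow> real"
  assumes "2.4537956056 < \<sigma>" and "\<sigma> < 6.1288520139"
    and "soliton \<sigma> R"
  shows "\<not> (\<exists>z::complex. z \<noteq> 0 \<and> Re z = 0 \<and> is_eigenvalue (H2 \<times> H2) (JL \<sigma> R) z)"
proof
  assume "\<exists>z::complex. z \<noteq> 0 \<and> Re z = 0 \<and> is_eigenvalue (H2 \<times> H2) (JL \<sigma> R) z"
  then obtain z u v where z: "z \<noteq> 0" "Re z = 0" and uv: "u \<in> H2" "v \<in> H2"
    and nz: "\<not> (AE x in lborel. u x = 0 \<and> v x = 0)"
    and eq: "AE x in lborel. L_minus \<sigma> R v x = z * u x \<and> - L_plus \<sigma> R u x = z * v x"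
    unfolding is_eigenvalue_def JL_def by auto
  have \<sigma>: "\<sigma> > 2" using assms(1) by simp
  have pow: "R x powr (2 * \<sigma>) = (\<sigma> + 1) * sech2 (\<sigma> * x)" for x
    by (rule soliton_explicit[OF assms(3)]) (use \<sigma> in simp)
  define \<mu> where "\<mu> = Im z"
  have \<mu>: "\<mu> \<noteq> 0" using z by (auto simp: \<mu>_def complex_eq_iff)
  have zi: "Re (z * w) = - (\<mu> * Im w)" "Im (z * w) = \<mu> * Re w" for w
    using z(2) by (simp_all add: \<mu>_def)
  have cr: "Re (of_real c * w) = c * Re w" "Im (of_real c * w) = c * Im w" for c w by simp_all
  have comp: "AE x in lborel.
      Re (weak_deriv (weak_deriv v) x) = Re (v x) - (\<sigma> + 1) * sech2 (\<sigma> * x) * Re (v x) + \<mu> * Im (u x) \<and>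
      Im (weak_deriv (weak_deriv v) x) = Im (v x) - (\<sigma> + 1) * sech2 (\<sigma> * x) * Im (v x) - \<mu> * Re (u x) \<and>
      Re (weak_deriv (weak_deriv u) x) = Re (u x) - (2 * \<sigma> + 1) * ((\<sigma> + 1) * sech2 (\<sigma> * x)) * Re (u x) - \<mu> * Im (v x) \<and>
      Im (weak_deriv (weak_deriv u) x) = Im (u x) - (2 * \<sigma> + 1) * ((\<sigma> + 1) * sech2 (\<sigma> * x)) * Im (u x) + \<mu> * Re (v x)"
    using eq
  proof eventually_elim
    case (elim x)
    have m: "weak_deriv (weak_deriv v) x = v x - of_real ((\<sigma> + 1) * sech2 (\<sigma> * x)) * v x - z * u x"
      using elim unfolding L_minus_def pow by (simp add: algebra_simps)
    have l: "weak_deriv (weak_deriv u) x = u x - of_real ((2 * \<sigma> + 1) * ((\<sigma> + 1) * sech2 (\<sigma> * x))) * u x + z * v x"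
      using elim unfolding L_plus_def pow by (simp add: algebra_simps)
    show ?case unfolding m l minus_complex.sel plus_complex.sel zi cr by simp
  qed
  \<comment> \<open>The minus sign gives both coupling terms of this pair the same factor
    \<open>- \<mu>\<close>, as \<open>H2_pair_vanishes\<close> requires.\<close>
  have bl: "bounded_linear (\<lambda>w. - Im w)" by (intro bounded_linear_minus bounded_linear_Im)
  have "AE x in lborel. Re (v x) = 0 \<and> - Im (u x) = 0"
  proof (rule H2_pair_vanishes[OF \<sigma> \<mu> uv(2,1) bounded_linear_Re abs_Re_le_cmod bl])
    show "\<bar>- Im w\<bar> \<le> norm w" for w by (simp add: abs_Im_le_cmod)
    show "AE x in lborel. Re (weak_deriv (weak_deriv v) x) =
        Re (v x) - (\<sigma> + 1) * sech2 (\<sigma> * x) * Re (v x) - \<mu> * - Im (u x)"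
      using comp by eventually_elim simp
    show "AE x in lborel. - Im (weak_deriv (weak_deriv u) x) =
        - Im (u x) - (2 * \<sigma> + 1) * ((\<sigma> + 1) * sech2 (\<sigma> * x)) * - Im (u x) - \<mu> * Re (v x)"
      using comp by eventually_elim simp
  qed
  moreover have "AE x in lborel. Im (v x) = 0 \<and> Re (u x) = 0"
  proof (rule H2_pair_vanishes[OF \<sigma> \<mu> uv(2,1) bounded_linear_Im abs_Im_le_cmod bounded_linear_Re abs_Re_le_cmod])
    show "AE x in lborel. Im (weak_deriv (weak_deriv v) x) =
        Im (v x) - (\<sigma> + 1) * sech2 (\<sigma> * x) * Im (v x) - \<mu> * Re (u x)"
      using comp by eventually_elim simp
    show "AE x in lborel. Re (weak_deriv (weak_deriv u) x) =
        Re (u x) - (2 * \<sigma> + 1) * ((\<sigma> + 1) * sech2 (\<sigma> * x)) * Re (u x) - \<mu> * Im (v x)"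
      using comp by eventually_elim simp
  qed
  ultimately have "AE x in lborel. u x = 0 \<and> v x = 0"
    by eventually_elim (simp add: complex_eq_iff)
  then show False using nz by contradiction
qed

end
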